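(* Let $(M,(\,,))$ be a connected, non-compact Riemannian manifold of dimension $m\ge 2$, let $n\ge 2$, and let $\varphi:M\to\mathbb{R}^n$ be a map of class $C^2$ such that $|d\varphi(x)|^2>0$ for every $x\in M$. Consider the elliptic operator $L=|d\varphi|^{-2}\Delta$ and assume that $M$ is $L$-stochastically complete. Let $o\in\mathbb{R}^n\setminus\varphi(M)$, let $v\in\mathbb{S}^{n-1}$ be a unit vector, let $\theta\in(0,\pi/2)$, and let $\mathcal{C}=\mathcal{C}_{o,v,\theta}$ be the non-degenerate cone with vertex $o$, direction $v$ and width $\theta$. Let $\pi_v$ be the hyperplane orthogonal to $v$ passing through $o$, and let $d(\pi_v,\varphi(M))$ be the Euclidean distance between $\pi_v$ and $\varphi(M)$. If $\varphi(M)\subseteq\mathcal{C}$, then $$\cos(\theta)\le\sqrt{\frac{1}{A_1}\,d(\pi_v,\varphi(M))\,\sup_M\left[\frac{|\tau(\varphi)|}{|d\varphi|^2}\right]}.$$ Moreover, if $\varphi$ is an isometric immersion, the same inequality holds with $A_1$ replaced by $A_m$.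
   Context: $\mathbb{R}^n$ carries its canonical flat metric $\langle\,,\rangle$. The cone is $$\mathcal{C}_{o,v,\theta}=\Big\{z\in\mathbb{R}^n\setminus\{o\}:\Big\langle\frac{z-o}{|z-o|},v\Big\rangle\ge\cos(\theta)\Big\},\qquad \theta\in(0,\pi/2).$$ $|d\varphi|^2$ is the square of the Hilbert–Schmidt norm of $d\varphi$, and $\tau(\varphi)=\mathrm{tr}\,\nabla d\varphi$ is the tension field of $\varphi$ (if $\varphi$ is an isometric immersion, $|d\varphi|^2=m$ and $\tau(\varphi)=mH$ with $H$ the mean curvature vector). $\Delta$ is the Laplace–Beltrami operator of $M$. For $\eta>0$, $$A_\eta=\sup\Big\{\xi\alpha^2\sqrt{1-\alpha^2}\ :\ \xi\in(0,1),\ \alpha\in\big(0,\min\{1,\eta\sqrt{1-\xi}\}\big)\Big\}.$$ $L$-stochastic completeness means that the diffusion generated by $L$ (which is symmetric on $L^2(M,|d\varphi|^2dx)$) has infinite intrinsic lifetime. It is known to be equivalent to the weak maximum principle for $L$: for every $u\in C^2(M)$ with $u^*=\sup_M u<+\infty$ there is a sequence $\{x_k\}\subset M$ with $u(x_k)>u^*-\frac1k$ and $Lu(x_k)<\frac1k$ for every $k\in\mathbb{N}$. No geodesic completeness of $M$ is assumed. Convention: if $\sup_M[|\tau(\varphi)|/|d\varphi|^2]=+\infty$, the right-hand side of the inequality is read as $+\infty$ (no restriction on $\theta$), also when $d(\pi_v,\varphi(M))=0$. *)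

theory Defs
  imports "HOL-Probability.Probability"
begin

section \<open>Calculus in coordinates\<close>

definition partial :: "'m \<Rightarrow> (real^'m \<Rightarrow> 'b::real_normed_vector) \<Rightarrow> real^'m \<Rightarrow> 'b" where
  "partial i F y = frechet_derivative F (at y) (axis i 1)"

text \<open>The set \<open>S\<close> is always open below. Differentiability at every point together with
  partial derivatives of class \<open>C\<^sup>k\<close> is then the usual notion of class \<open>C\<^bsup>k+1\<^esup>\<close>.\<close>

primrec Ck_on :: "nat \<Rightarrow> (real^'m \<Rightarrow> 'b::real_normed_vector) \<Rightarrow> (real^'m) set \<Rightarrow> bool" where
  "Ck_on 0 F S \<longleftrightarrow> continuous_on S F"
| "Ck_on (Suc k) F S \<longleftrightarrow> (\<forall>y\<in>S. F differentiable (at y)) \<and> (\<forall>i. Ck_on k (partial i F) S)"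

definition smooth_on :: "(real^'m \<Rightarrow> 'b::real_normed_vector) \<Rightarrow> (real^'m) set \<Rightarrow> bool" where
  "smooth_on F S \<longleftrightarrow> (\<forall>k. Ck_on k F S)"


section \<open>Riemannian manifolds\<close>

text \<open>The underlying space of the manifold is the whole type \<open>'a\<close>, with the topology given by its
  type class (Hausdorff, second countable); its dimension is \<open>CARD('m)\<close>. A chart is a pair of its
  domain and its coordinate map, the values of the latter outside the domain being irrelevant.\<close>

type_synonym ('a, 'm) chart = "'a set \<times> ('a \<Rightarrow> real^'m)"

definition chart_dom :: "('a, 'm) chart \<Rightarrow> 'a set" where
  "chart_dom c = fst c"

definition chart_map :: "('a, 'm) chart \<Rightarrow> 'a \<Rightarrow> real^'m" where
  "chart_map c = snd c"

definition chart_image :: "('a, 'm) chart \<Rightarrow> (real^'m) set" where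
  "chart_image c = chart_map c ` chart_dom c"

definition chart_inv :: "('a, 'm) chart \<Rightarrow> real^'m \<Rightarrow> 'a" where
  "chart_inv c = inv_into (chart_dom c) (chart_map c)"

definition is_chart :: "('a::topological_space, 'm::finite) chart \<Rightarrow> bool" where
  "is_chart c \<longleftrightarrow> open (chart_dom c) \<and> open (chart_image c) \<and>
     homeomorphism (chart_dom c) (chart_image c) (chart_map c) (chart_inv c)"

definition transition :: "('a, 'm) chart \<Rightarrow> ('a, 'm) chart \<Rightarrow> real^'m \<Rightarrow> real^'m" where
  "transition c d = chart_map d \<circ> chart_inv c"

definition smooth_atlas :: "('a::topological_space, 'm::finite) chart set \<Rightarrow> bool" where
  "smooth_atlas A \<longleftrightarrow> (\<forall>c\<in>A. is_chart c) \<and> (\<Union>c\<in>A. chart_dom c) = UNIV \<and>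
     (\<forall>c\<in>A. \<forall>d\<in>A. smooth_on (transition c d) (chart_map c ` (chart_dom c \<inter> chart_dom d)))"

text \<open>A metric is given by its components: \<open>g c y $ i $ j\<close> is the component \<open>g\<^sub>i\<^sub>j\<close> in the chart
  \<open>c\<close> at the point with coordinates \<open>y\<close>. The last clause is the transformation law of a
  covariant 2-tensor.\<close>

type_synonym ('a, 'm) metric_field = "('a, 'm) chart \<Rightarrow> real^'m \<Rightarrow> real^'m^'m"

definition riemannian_metric ::
    "('a, 'm::finite) chart set \<Rightarrow> ('a, 'm) metric_field \<Rightarrow> bool" where
  "riemannian_metric A g \<longleftrightarrow>
     (\<forall>c\<in>A. smooth_on (g c) (chart_image c) \<and>
        (\<forall>y\<in>chart_image c. transpose (g c y) = g c y \<and> (\<forall>w. w \<noteq> 0 \<longrightarrow> w \<bullet> (g c y *v w) > 0))) \<and>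
     (\<forall>c\<in>A. \<forall>d\<in>A. \<forall>p\<in>chart_dom c \<inter> chart_dom d. \<forall>i j.
        g c (chart_map c p) $ i $ j =
          (\<Sum>a\<in>UNIV. \<Sum>b\<in>UNIV.
             partial i (transition c d) (chart_map c p) $ a *
             partial j (transition c d) (chart_map c p) $ b *
             g d (chart_map d p) $ a $ b))"

definition riemannian_manifold ::
    "('a::{t2_space,second_countable_topology}, 'm::finite) chart set
      \<Rightarrow> ('a, 'm) metric_field \<Rightarrow> bool" where
  "riemannian_manifold A g \<longleftrightarrow> smooth_atlas A \<and> riemannian_metric A g"

definition C2_map :: "('a, 'm::finite) chart set \<Rightarrow> ('a \<Rightarrow> 'b::real_normed_vector) \<Rightarrow> bool" where
  "C2_map A f \<longleftrightarrow> (\<forall>c\<in>A. Ck_on 2 (f \<circ> chart_inv c) (chart_image c))"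

text \<open>The quantities below are independent of the chart around the point; they are evaluated in a
  chosen one.\<close>

definition chart_at :: "('a, 'm::finite) chart set \<Rightarrow> 'a \<Rightarrow> ('a, 'm) chart" where
  "chart_at A p = (SOME c. c \<in> A \<and> p \<in> chart_dom c)"

definition christoffel ::
    "('a, 'm::finite) metric_field \<Rightarrow> ('a, 'm) chart \<Rightarrow> real^'m \<Rightarrow> 'm \<Rightarrow> 'm \<Rightarrow> 'm \<Rightarrow> real" where
  "christoffel g c y k i j =
     1/2 * (\<Sum>l\<in>UNIV. matrix_inv (g c y) $ k $ l *
       (partial i (\<lambda>z. g c z $ j $ l) y + partial j (\<lambda>z. g c z $ i $ l) y
        - partial l (\<lambda>z. g c z $ i $ j) y))"

text \<open>Components of \<open>\<nabla>df\<close> for a map \<open>f\<close> into a flat space: the target has no Christoffel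
  symbols.\<close>

definition hessian ::
    "('a, 'm::finite) metric_field \<Rightarrow> ('a \<Rightarrow> 'b::real_normed_vector) \<Rightarrow> ('a, 'm) chart \<Rightarrow>
      real^'m \<Rightarrow> 'm \<Rightarrow> 'm \<Rightarrow> 'b" where
  "hessian g f c y i j =
     partial i (partial j (f \<circ> chart_inv c)) y
     - (\<Sum>k\<in>UNIV. christoffel g c y k i j *\<^sub>R partial k (f \<circ> chart_inv c) y)"

definition tension_field ::
    "('a, 'm::finite) chart set \<Rightarrow> ('a, 'm) metric_field \<Rightarrow>
      ('a \<Rightarrow> 'b::real_normed_vector) \<Rightarrow> 'a \<Rightarrow> 'b" where
  "tension_field A g f p =
     (let c = chart_at A p; y = chart_map c p in
      \<Sum>i\<in>UNIV. \<Sum>j\<in>UNIV. matrix_inv (g c y) $ i $ j *\<^sub>R hessian g f c y i j)"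

definition laplace_beltrami ::
    "('a, 'm::finite) chart set \<Rightarrow> ('a, 'm) metric_field \<Rightarrow> ('a \<Rightarrow> real) \<Rightarrow> 'a \<Rightarrow> real" where
  "laplace_beltrami A g u p =
     (let c = chart_at A p; y = chart_map c p in
      \<Sum>i\<in>UNIV. \<Sum>j\<in>UNIV. matrix_inv (g c y) $ i $ j * hessian g u c y i j)"

text \<open>The squared Hilbert--Schmidt norm \<open>|df|\<^sup>2\<close>.\<close>

definition energy_density ::
    "('a, 'm::finite) chart set \<Rightarrow> ('a, 'm) metric_field \<Rightarrow>
      ('a \<Rightarrow> 'b::real_inner) \<Rightarrow> 'a \<Rightarrow> real" where
  "energy_density A g f p =
     (let c = chart_at A p; y = chart_map c p in
      \<Sum>i\<in>UNIV. \<Sum>j\<in>UNIV. matrix_inv (g c y) $ i $ j *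
        (partial i (f \<circ> chart_inv c) y \<bullet> partial j (f \<circ> chart_inv c) y))"

definition isometric_immersion ::
    "('a, 'm::finite) chart set \<Rightarrow> ('a, 'm) metric_field \<Rightarrow> ('a \<Rightarrow> 'b::real_inner) \<Rightarrow> bool" where
  "isometric_immersion A g f \<longleftrightarrow>
     (\<forall>c\<in>A. \<forall>y\<in>chart_image c. \<forall>i j.
        g c y $ i $ j = partial i (f \<circ> chart_inv c) y \<bullet> partial j (f \<circ> chart_inv c) y)"

definition map_laplacian ::
    "('a, 'm::finite) chart set \<Rightarrow> ('a, 'm) metric_field \<Rightarrow> ('a \<Rightarrow> 'b::real_inner) \<Rightarrow>
      ('a \<Rightarrow> real) \<Rightarrow> 'a \<Rightarrow> real" where
  "map_laplacian A g \<phi> u p = laplace_beltrami A g u p / energy_density A g \<phi> p"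


section \<open>Diffusions and stochastic completeness\<close>

text \<open>Paths are continuous in the one-point compactification of \<open>M\<close>, whose added point \<open>None\<close> is
  the cemetery, and are absorbed there. Values at negative times play no role: no \<open>\<sigma>\<close>-algebra
  below sees them.\<close>

definition paths :: "(real \<Rightarrow> 'a::topological_space option) set" where
  "paths = {\<omega>. continuous_map (top_of_set {0..}) (Alexandroff_compactification euclidean) \<omega> \<and>
               (\<forall>s t. 0 \<le> s \<and> s \<le> t \<and> \<omega> s = None \<longrightarrow> \<omega> t = None)}"

definition path_algebra :: "real set \<Rightarrow> (real \<Rightarrow> 'a::topological_space option) measure" where
  "path_algebra I = sigma paths
     {{\<omega>\<in>paths. \<omega> s \<in> U} | s U. s \<in> I \<and> openin (Alexandroff_compactification euclidean) U}"

text \<open>The lifetime is \<open>\<infinity>\<close> for paths that never reach the cemetery.\<close>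

definition lifetime :: "(real \<Rightarrow> 'a option) \<Rightarrow> ereal" where
  "lifetime \<omega> = Inf (ereal ` {t. 0 \<le> t \<and> \<omega> t = None})"

definition martingale ::
    "'w measure \<Rightarrow> (real \<Rightarrow> 'w measure) \<Rightarrow> (real \<Rightarrow> 'w \<Rightarrow> real) \<Rightarrow> bool" where
  "martingale P F X \<longleftrightarrow>
     (\<forall>t\<ge>0. X t \<in> borel_measurable (F t) \<and> integrable P (X t)) \<and>
     (\<forall>s t. 0 \<le> s \<and> s \<le> t \<longrightarrow> (AE \<omega> in P. real_cond_exp P (F s) (X t) \<omega> = X s \<omega>))"

definition at_cemetery_zero :: "('a \<Rightarrow> real) \<Rightarrow> 'a option \<Rightarrow> real" where
  "at_cemetery_zero f z = (case z of None \<Rightarrow> 0 | Some p \<Rightarrow> f p)"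

definition test_function ::
    "('a::topological_space, 'm::finite) chart set \<Rightarrow> ('a \<Rightarrow> real) \<Rightarrow> bool" where
  "test_function A f \<longleftrightarrow> C2_map A f \<and> compact (closure {p. f p \<noteq> 0})"

text \<open>\<open>P\<close> is the law on path space of the diffusion generated by \<open>L\<close> and issued from \<open>x\<close>, up to its
  intrinsic lifetime, in the sense of the martingale problem.\<close>

definition diffusion_law ::
    "('a::topological_space, 'm::finite) chart set \<Rightarrow> (('a \<Rightarrow> real) \<Rightarrow> 'a \<Rightarrow> real) \<Rightarrow> 'a \<Rightarrow>
      (real \<Rightarrow> 'a option) measure \<Rightarrow> bool" where
  "diffusion_law A L x P \<longleftrightarrow>
     prob_space P \<and> sets P = sets (path_algebra {0..}) \<and>
     (AE \<omega> in P. \<omega> 0 = Some x) \<and>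
     (\<forall>f. test_function A f \<longrightarrow>
        martingale P (\<lambda>t. path_algebra {0..t})
          (\<lambda>t \<omega>. at_cemetery_zero f (\<omega> t) - at_cemetery_zero f (\<omega> 0)
             - (LINT s:{0..t}|lborel. at_cemetery_zero (L f) (\<omega> s))))"

text \<open>``The diffusion has infinite lifetime'' is read as existence of the law from every starting
  point and infinite lifetime of any such law; for the nondegenerate operators considered here
  the law exists and is unique.\<close>

definition stochastically_complete ::
    "('a::topological_space, 'm::finite) chart set \<Rightarrow> (('a \<Rightarrow> real) \<Rightarrow> 'a \<Rightarrow> real) \<Rightarrow> bool" where
  "stochastically_complete A L \<longleftrightarrow>
     (\<forall>x. (\<exists>P. diffusion_law A L x P) \<and>
          (\<forall>P. diffusion_law A L x P \<longrightarrow> (AE \<omega> in P. lifetime \<omega> = \<infinity>)))"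


section \<open>Cones and the bound\<close>

definition cone_at :: "'b::real_inner \<Rightarrow> 'b \<Rightarrow> real \<Rightarrow> 'b set" where
  "cone_at q v \<theta> = {z. z \<noteq> q \<and> ((z - q) /\<^sub>R norm (z - q)) \<bullet> v \<ge> cos \<theta>}"

definition hyperplane_at :: "'b::real_inner \<Rightarrow> 'b \<Rightarrow> 'b set" where
  "hyperplane_at q v = {z. (z - q) \<bullet> v = 0}"

definition A_const :: "real \<Rightarrow> real" where
  "A_const \<eta> = Sup {\<xi> * \<alpha>\<^sup>2 * sqrt (1 - \<alpha>\<^sup>2) | \<xi> \<alpha>.
     0 < \<xi> \<and> \<xi> < 1 \<and> 0 < \<alpha> \<and> \<alpha> < min 1 (\<eta> * sqrt (1 - \<xi>))}"

text \<open>The case distinction is needed because \<open>0 * \<infinity> = 0\<close> in \<^typ>\<open>ereal\<close>, whereas here an infinite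
  supremum means no restriction even if the distance \<open>d\<close> is 0.\<close>

definition cone_bound :: "real \<Rightarrow> real \<Rightarrow> ereal \<Rightarrow> ereal" where
  "cone_bound a d S = (if S = \<infinity> then \<infinity> else ereal (sqrt (1 / a * d * real_of_ereal S)))"

end

theory Submission
  imports Defs
begin

text \<open>Let \<open>\<beta> = cos \<theta>\<close>, \<open>d\<close> the distance to the hyperplane and \<open>T\<close> the supremum of \<open>|\<tau>(\<phi>)|/|d\<phi>|\<^sup>2\<close>.
  Since \<open>A\<^sub>\<eta> \<le> 1/2\<close> for every \<open>\<eta>\<close>, it is enough to show \<open>\<beta>\<^sup>2 \<le> 2 d T\<close>. Otherwise choose \<open>c > T\<close> and \<open>k\<close> with
  \<open>d < k < \<beta>\<^sup>2/(2c)\<close>, and put \<open>u = k + c|z|\<^sup>2/2 - \<langle>z, v\<rangle>\<close> with \<open>z = \<phi> - o\<close>. In the cone \<open>\<langle>z, v\<rangle> \<ge> \<beta>|z|\<close>, so \<open>u < 0\<close>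
  where \<open>|z| = \<beta>/c\<close>, and \<open>w = max(u, 0)\<^sup>3\<close>, cut off to \<open>0\<close> beyond that radius, is bounded and of class
  \<open>C\<^sup>2\<close>; it does not vanish because \<open>u > 0\<close> where \<open>\<langle>z, v\<rangle> < k\<close>. Inside that radius
  \<open>|v - c z|\<^sup>2 \<le> 1 - 2\<beta>c|z| + c\<^sup>2|z|\<^sup>2 \<le> 1\<close>, hence \<open>L u = c - \<langle>v - c z, \<tau>\<rangle>/|d\<phi>|\<^sup>2 \<ge> c - T > 0\<close> and
  \<open>L w \<ge> \<lambda> w\<close> for some \<open>\<lambda> > 0\<close>.

  Such a \<open>w\<close> contradicts stochastic completeness. Localising the martingale problem by cutoffs along an
  exhaustion gives \<open>E w(X\<^sub>t) - w(x) \<ge> \<lambda> E \<integral> w(X\<^sub>s) ds\<close> over \<open>[0,t]\<close> when the lifetime is infinite; hence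
  \<open>E w(X\<^sub>s) \<ge> w(x)\<close> and then \<open>E w(X\<^sub>t) \<ge> (1 + \<lambda>t) w(x)\<close>, which is unbounded in \<open>t\<close>.\<close>

section \<open>Maps of class \<open>C\<^sup>k\<close> in coordinates\<close>

text \<open>The cube is the lowest integer power of the positive part that is of class C^2, as test
  functions have to be. The radius \<beta>/c is where k + c r^2/2 - \<beta> r attains its minimum k
  - \<beta>^2/(2c), which the choice of k makes negative; so the cutoff happens where the function
  already vanishes. A cutoff is unavoidable: \<phi> may be unbounded, and the estimate |v - c z|
  \<le> 1 can fail once c|z| > 2\<beta>.

  A second obstacle lies in the operator. \<Delta> and the energy density are evaluated in a chart
  selected at each point separately, whereas the martingale argument needs L f to be continuous,
  along paths as well as at the cemetery. Hence the long computation showing that the Hessian is a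
  tensor. The tension field is used only in the selected chart.

  Since w has no compact support, it is multiplied by cutoffs, and the product is a subsolution only
  where the cutoff is 1. Paths leaving that region are charged with the upper bound of w; almost
  surely none remains in the limit, because a path that stays alive traces a compact set on [0,t].
  The exhaustion comes from second countability.\<close>

lemma partial_eqI: "(F has_derivative D) (at y) \<Longrightarrow> partial i F y = D (axis i 1)"
  unfolding partial_def by (metis frechet_derivative_at)

text \<open>Expansion of the argument in the standard basis. In this form the derivative rules of
  the library turn into rules for \<open>partial\<close> by evaluation at a basis vector, where
  \<open>sum_axis_scaleR\<close> collapses the sum.\<close>

lemma has_derivative_partial:
  assumes "F differentiable (at y)"
  shows "(F has_derivative (\<lambda>w. \<Sum>i\<in>UNIV. w $ i *\<^sub>R partial i F y)) (at y)"
proof -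
  have D: "(F has_derivative frechet_derivative F (at y)) (at y)"
    using assms frechet_derivative_works by blast
  have "frechet_derivative F (at y) w = (\<Sum>i\<in>UNIV. w $ i *\<^sub>R partial i F y)" for w
  proof -
    interpret linear "frechet_derivative F (at y)"
      using D has_derivative_linear by blast
    have "w = (\<Sum>i\<in>UNIV. w $ i *\<^sub>R axis i 1)"
      by (simp add: vec_eq_iff axis_def if_distrib cong: if_cong)
    then have "frechet_derivative F (at y) w = frechet_derivative F (at y) (\<Sum>i\<in>UNIV. w $ i *\<^sub>R axis i 1)"
      by simp
    then show ?thesis by (simp add: sum scaleR partial_def)
  qed
  then show ?thesis using D by (metis (no_types, lifting) ext)
qed

text \<open>Valid also where neither function is differentiable: both have the same derivatives at
  \<open>y\<close>, so the choice inside \<open>frechet_derivative\<close> is the same.\<close>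

lemma partial_cong:
  assumes "open S" "y \<in> S" "\<And>z. z \<in> S \<Longrightarrow> F z = G z"
  shows "partial i F y = partial i G y"
proof -
  have "(F has_derivative D) (at y) \<longleftrightarrow> (G has_derivative D) (at y)" for D
    using has_derivative_transform_within_open[OF _ assms(1,2)] assms(3) by metis
  then show ?thesis by (simp add: partial_def frechet_derivative_def)
qed

lemma differentiable_cong_open:
  assumes "open S" "y \<in> S" "\<And>z. z \<in> S \<Longrightarrow> F z = G z"
  shows "F differentiable (at y) \<longleftrightarrow> G differentiable (at y)"
  unfolding differentiable_def
  using has_derivative_transform_within_open[OF _ assms(1,2)] assms(3) by metis

lemma Ck_on_cong:
  assumes "open S" "\<And>z. z \<in> S \<Longrightarrow> F z = G z" "Ck_on k F S"
  shows "Ck_on k G S"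
  using assms(2,3)
proof (induction k arbitrary: F G)
  case 0
  then show ?case using continuous_on_cong[of S S F G] by simp
next
  case (Suc k)
  have "G differentiable (at y)" if "y \<in> S" for y
    using differentiable_cong_open[OF assms(1) that, of F G] Suc.prems that by auto
  moreover have "Ck_on k (partial i G) S" for i
  proof (rule Suc.IH)
    show "partial i F z = partial i G z" if "z \<in> S" for z
      using partial_cong[OF assms(1) that] Suc.prems(1) by blast
    show "Ck_on k (partial i F) S" using Suc.prems(2) by simp
  qed
  ultimately show ?case by simp
qed

text \<open>Allows gluing: functions defined by cases, such as the chart cutoffs and the truncated
  barrier, are handled on an open cover.\<close>

lemma Ck_on_local:
  assumes "\<And>y. y \<in> S \<Longrightarrow> \<exists>T. open T \<and> y \<in> T \<and> Ck_on k F T"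
  shows "Ck_on k F S"
  using assms
proof (induction k arbitrary: F)
  case 0
  have "continuous (at y) F" if "y \<in> S" for y
    using 0[OF that] by (auto simp: continuous_on_eq_continuous_at)
  then show ?case by (simp add: continuous_at_imp_continuous_on)
next
  case (Suc k)
  have "F differentiable (at y)" if "y \<in> S" for y
    using Suc.prems[OF that] by auto
  moreover have "Ck_on k (partial i F) S" for i
  proof (rule Suc.IH)
    fix y assume "y \<in> S"
    from Suc.prems[OF this] show "\<exists>T. open T \<and> y \<in> T \<and> Ck_on k (partial i F) T"
      by auto
  qed
  ultimately show ?case by simp
qed

lemma Ck_on_pred: "Ck_on (Suc k) F S \<Longrightarrow> Ck_on k F S"
proof (induction k arbitrary: F)
  case 0
  then show ?case
    by (auto intro!: continuous_at_imp_continuous_on differentiable_imp_continuous_within)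
next
  case (Suc k)
  then show ?case by (metis Ck_on.simps(2))
qed

lemma Ck_on_2_imp:
  assumes "Ck_on 2 F S"
  shows "Ck_on (Suc 0) F S" "\<And>i. Ck_on (Suc 0) (partial i F) S" "continuous_on S F"
    "\<And>y. y \<in> S \<Longrightarrow> F differentiable (at y)"
    "\<And>i y. y \<in> S \<Longrightarrow> partial i F differentiable (at y)"
    "\<And>i. continuous_on S (partial i F)"
    "\<And>i j. continuous_on S (partial i (partial j F))"
  using assms Ck_on_pred[of _ F S] Ck_on_pred[of 0 "partial _ F" S] Ck_on_pred[of 0 F S]
  by (auto simp: numeral_2_eq_2)

section \<open>Closure of the classes C^k under algebraic operations and composition\<close>

lemma Ck_on_const:
  fixes S :: "(real^'m) set"
  shows "Ck_on k (\<lambda>y. c) S"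
proof (induction k arbitrary: c)
  case (Suc k)
  have "partial i (\<lambda>y::real^'m. c) = (\<lambda>y. 0)" for i
    by (simp add: fun_eq_iff partial_def)
  then show ?case using Suc by simp
qed simp

lemma sum_axis_scaleR:
  fixes f :: "'n::finite \<Rightarrow> 'b::real_vector"
  shows "(\<Sum>i\<in>UNIV. axis j (1::real) $ i *\<^sub>R f i) = f j"
proof -
  have "(\<Sum>i\<in>UNIV. axis j (1::real) $ i *\<^sub>R f i) = (\<Sum>i\<in>UNIV. if j = i then f i else 0)"
    by (intro sum.cong) (auto simp: axis_def)
  then show ?thesis by simp
qed

lemma sum_scaleR_axis_scaleR:
  fixes f :: "'n::finite \<Rightarrow> 'b::real_vector"
  shows "(\<Sum>i\<in>UNIV. (r *\<^sub>R axis j (1::real)) $ i *\<^sub>R f i) = r *\<^sub>R f j"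
proof -
  have "(\<Sum>i\<in>UNIV. (r *\<^sub>R axis j (1::real)) $ i *\<^sub>R f i) = (\<Sum>i\<in>UNIV. if j = i then r *\<^sub>R f i else 0)"
    by (intro sum.cong) (auto simp: axis_def)
  then show ?thesis by simp
qed

lemma Ck_on_bounded_linear:
  assumes h: "bounded_linear h" and "open S" "Ck_on k F S"
  shows "Ck_on k (\<lambda>y. h (F y)) S"
  using assms(3)
proof (induction k arbitrary: F)
  case 0
  then show ?case using bounded_linear.continuous_on[OF h] by simp
next
  case (Suc k)
  have D: "((\<lambda>y. h (F y)) has_derivative (\<lambda>w. h (\<Sum>i\<in>UNIV. w $ i *\<^sub>R partial i F y))) (at y)"
    if "y \<in> S" for y
    using bounded_linear.has_derivative[OF h has_derivative_partial[of F y]] Suc.prems that by auto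
  have "h (partial i F y) = partial i (\<lambda>y. h (F y)) y" if "y \<in> S" for y i
    using partial_eqI[OF D[OF that], of i] by (simp only: sum_axis_scaleR)
  then have "Ck_on k (partial i (\<lambda>y. h (F y))) S" for i
    using Ck_on_cong[OF \<open>open S\<close> _ Suc.IH[of "partial i F"], of "partial i (\<lambda>y. h (F y))"] Suc.prems by simp
  then show ?case using D by (auto simp: differentiable_def)
qed

lemma partial_add:
  assumes "F differentiable (at y)" "G differentiable (at y)"
  shows "partial i (\<lambda>y. F y + G y) y = partial i F y + partial i G y"
  using partial_eqI[OF has_derivative_add[OF assms[THEN has_derivative_partial]], of i]
  by (simp add: sum_axis_scaleR)

lemma Ck_on_add:
  assumes "open S" "Ck_on k F S" "Ck_on k G S"
  shows "Ck_on k (\<lambda>y. F y + G y) S"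
  using assms(2,3)
proof (induction k arbitrary: F G)
  case 0
  then show ?case by (simp add: continuous_on_add)
next
  case (Suc k)
  have "Ck_on k (partial i (\<lambda>y. F y + G y)) S" for i
  proof (rule Ck_on_cong[OF \<open>open S\<close> _ Suc.IH])
    show "partial i F z + partial i G z = partial i (\<lambda>y. F y + G y) z" if "z \<in> S" for z
      by (rule partial_add[symmetric]) (use Suc.prems that in auto)
  qed (use Suc.prems in auto)
  then show ?case using Suc.prems by auto
qed

lemma partial_bilinear:
  assumes "bounded_bilinear b" "F differentiable (at y)" "G differentiable (at y)"
  shows "partial i (\<lambda>y. b (F y) (G y)) y = b (F y) (partial i G y) + b (partial i F y) (G y)"
  using partial_eqI[OF bounded_bilinear.FDERIV[OF assms(1) assms(2,3)[THEN has_derivative_partial]], of i]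
  by (simp add: sum_axis_scaleR)

lemma differentiable_bilinear:
  fixes y :: "real^'m"
  assumes "bounded_bilinear b" "F differentiable (at y)" "G differentiable (at y)"
  shows "(\<lambda>y. b (F y) (G y)) differentiable (at y)"
  using bounded_bilinear.FDERIV[OF assms(1) assms(2,3)[THEN has_derivative_partial]]
  by (rule differentiableI)

lemma Ck_on_bilinear:
  assumes b: "bounded_bilinear b" and "open S" "Ck_on k F S" "Ck_on k G S"
  shows "Ck_on k (\<lambda>y. b (F y) (G y)) S"
  using assms(3,4)
proof (induction k arbitrary: F G)
  case 0
  then show ?case by (simp add: bounded_bilinear.continuous_on[OF b])
next
  case (Suc k)
  have "Ck_on k (\<lambda>y. b (F y) (partial i G y) + b (partial i F y) (G y)) S" for i
    using Suc.prems Ck_on_pred[of k F S] Ck_on_pred[of k G S]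
    by (intro Ck_on_add \<open>open S\<close> Suc.IH) auto
  then have "Ck_on k (partial i (\<lambda>y. b (F y) (G y))) S" for i
  proof (rule Ck_on_cong[OF \<open>open S\<close>, rotated])
    show "b (F z) (partial i G z) + b (partial i F z) (G z) = partial i (\<lambda>y. b (F y) (G y)) z"
      if "z \<in> S" for z
      by (rule partial_bilinear[OF b, symmetric]) (use Suc.prems that in auto)
  qed
  then show ?case using Suc.prems by (auto intro: differentiable_bilinear[OF b])
qed

lemma Ck_on_ident:
  fixes S :: "(real^'m) set"
  shows "Ck_on k (\<lambda>y. y) S"
proof (cases k)
  case (Suc k')
  have "partial i (\<lambda>y. y) = (\<lambda>y. axis i 1 :: real^'m)" for i
    by (rule ext, rule partial_eqI[OF has_derivative_ident])
  then show ?thesis using Suc by (simp add: Ck_on_const)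
qed simp

lemma Ck_on_sum:
  assumes "open S" "finite I" "\<And>i. i \<in> I \<Longrightarrow> Ck_on k (F i) S"
  shows "Ck_on k (\<lambda>y. \<Sum>i\<in>I. F i y) S"
  using assms(2,3) by (induction rule: finite_induct) (auto simp: Ck_on_const intro!: Ck_on_add[OF assms(1)])

lemma has_derivative_comp_partial:
  fixes G :: "real^'n \<Rightarrow> 'b::real_normed_vector" and F :: "real^'m \<Rightarrow> real^'n"
  assumes "F differentiable (at y)" "G differentiable (at (F y))"
  shows "((\<lambda>y. G (F y)) has_derivative
    (\<lambda>w. \<Sum>a\<in>UNIV. (\<Sum>i\<in>UNIV. w $ i *\<^sub>R partial i F y) $ a *\<^sub>R partial a G (F y))) (at y)"
  using diff_chain_at[OF has_derivative_partial[OF assms(1)] has_derivative_partial[OF assms(2)]]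
  by (simp add: o_def)

lemma partial_comp:
  fixes G :: "real^'n \<Rightarrow> 'b::real_normed_vector" and F :: "real^'m \<Rightarrow> real^'n"
  assumes "F differentiable (at y)" "G differentiable (at (F y))"
  shows "partial i (\<lambda>y. G (F y)) y = (\<Sum>a\<in>UNIV. partial i F y $ a *\<^sub>R partial a G (F y))"
  using partial_eqI[OF has_derivative_comp_partial[OF assms], of i]
  by (simp only: sum_axis_scaleR)

text \<open>Only \<open>G\<close> varies in the induction: the chain rule yields
  \<open>partial a G\<close> composed with the same \<open>F\<close>, and the factors
  \<open>partial i F\<close> are absorbed by the product rule.\<close>

lemma Ck_on_compose:
  fixes G :: "real^'n \<Rightarrow> 'b::real_normed_vector" and F :: "real^'m \<Rightarrow> real^'n"
  assumes "open S" "F ` S \<subseteq> T" "Ck_on k F S" "Ck_on k G T"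
  shows "Ck_on k (\<lambda>y. G (F y)) S"
  using assms(3,4)
proof (induction k arbitrary: G)
  case 0
  then show ?case using assms(2) by (auto intro: continuous_on_compose2)
next
  case (Suc k)
  have diff: "F differentiable (at y)" "G differentiable (at (F y))" if "y \<in> S" for y
    using Suc.prems that assms(2) by auto
  have "Ck_on k (\<lambda>y. \<Sum>a\<in>UNIV. partial i F y $ a *\<^sub>R partial a G (F y)) S" for i
  proof (rule Ck_on_sum[OF \<open>open S\<close>])
    fix a
    have "Ck_on k (\<lambda>y. partial i F y $ a) S"
      using Suc.prems by (intro Ck_on_bounded_linear[OF bounded_linear_vec_nth \<open>open S\<close>]) auto
    moreover have "Ck_on k (\<lambda>y. partial a G (F y)) S"
      using Suc.prems Ck_on_pred[of k F S] by (intro Suc.IH) auto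
    ultimately show "Ck_on k (\<lambda>y. partial i F y $ a *\<^sub>R partial a G (F y)) S"
      by (rule Ck_on_bilinear[OF bounded_bilinear_scaleR \<open>open S\<close>])
  qed simp
  then have "Ck_on k (partial i (\<lambda>y. G (F y))) S" for i
  proof (rule Ck_on_cong[OF \<open>open S\<close>, rotated])
    show "(\<Sum>a\<in>UNIV. partial i F z $ a *\<^sub>R partial a G (F z)) = partial i (\<lambda>y. G (F y)) z"
      if "z \<in> S" for z
      by (rule partial_comp[symmetric]) (use diff that in auto)
  qed
  moreover have "(\<lambda>y. G (F y)) differentiable (at y)" if "y \<in> S" for y
    using has_derivative_comp_partial[OF diff[OF that]] by (rule differentiableI)
  ultimately show ?case by simp
qed

section \<open>Chain rule for functions of one real variable and powers of the positive part\<close>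

lemma has_derivative_real_comp_partial:
  assumes "u differentiable (at y)" "(h has_real_derivative d) (at (u y))"
  shows "((\<lambda>y. h (u y)) has_derivative (\<lambda>w. d * (\<Sum>i\<in>UNIV. w $ i *\<^sub>R partial i u y))) (at y)"
  using diff_chain_at[OF has_derivative_partial[OF assms(1)] assms(2)[unfolded has_field_derivative_def]]
  by (simp add: o_def)

lemma partial_real_comp:
  assumes "u differentiable (at y)" "(h has_real_derivative d) (at (u y))"
  shows "partial i (\<lambda>y. h (u y)) y = d * partial i u y"
  using partial_eqI[OF has_derivative_real_comp_partial[OF assms], of i]
  by (simp only: sum_axis_scaleR)

text \<open>Away from 0 the function is locally a power or constant. At 0 the difference quotient is
  itself a positive power of \<open>max 0 h\<close> and tends to 0.\<close>

lemma DERIV_max_0_power: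
  fixes x :: real
  shows "((\<lambda>s. max 0 s ^ Suc (Suc n)) has_real_derivative real (Suc (Suc n)) * max 0 x ^ Suc n) (at x)"
proof (cases "x = 0")
  case True
  have "((\<lambda>s. max 0 s ^ Suc (Suc n)) has_real_derivative 0) (at 0)"
    unfolding DERIV_def
  proof (rule Lim_null_comparison)
    show "\<forall>\<^sub>F h in at 0. norm ((max 0 (0 + h) ^ Suc (Suc n) - max 0 (0::real) ^ Suc (Suc n)) / h)
       \<le> \<bar>max 0 h ^ Suc n\<bar>"
      by (rule always_eventually) (auto simp: max_def)
    show "((\<lambda>h. \<bar>max 0 h ^ Suc n\<bar>) \<longlongrightarrow> 0) (at (0::real))"
      by (auto intro!: tendsto_eq_intros)
  qed
  then show ?thesis using True by simp
next
  case False
  show ?thesis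
  proof (cases "x > 0")
    case True
    have "((\<lambda>s. s ^ Suc (Suc n)) has_real_derivative real (Suc (Suc n)) * max 0 x ^ Suc n) (at x)"
      using True using DERIV_pow[of "Suc (Suc n)" x UNIV] by simp
    then show ?thesis
      by (rule has_field_derivative_transform_within_open[where S="{0<..}"]) (use True in auto)
  next
    case F: False
    have "((\<lambda>s. 0) has_real_derivative real (Suc (Suc n)) * max 0 x ^ Suc n) (at x)"
      using F by (auto simp: max_def)
    then show ?thesis
      by (rule has_field_derivative_transform_within_open[where S="{..<0}"]) (use F False in auto)
  qed
qed

lemma DERIV_pos_cube: "((\<lambda>s. max 0 s ^ 3) has_real_derivative 3 * (max 0 x)\<^sup>2) (at x)"
  using DERIV_max_0_power[of 1 x] by (simp add: numeral_eq_Suc)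

lemma DERIV_pos_square: "((\<lambda>s. (max 0 s)\<^sup>2) has_real_derivative 2 * max 0 x) (at (x::real))"
  using DERIV_max_0_power[of 0 x] by (simp add: numeral_eq_Suc)

lemma partial_pos_cube:
  fixes u :: "real^'m \<Rightarrow> real"
  assumes "u differentiable (at y)"
  shows "partial i (\<lambda>y. max 0 (u y) ^ 3) y = 3 * (max 0 (u y))\<^sup>2 * partial i u y"
  using partial_real_comp[OF assms DERIV_pos_cube] .

text \<open>The product of first derivatives is kept apart because its contraction with the inverse
  metric has a sign.\<close>

lemma partial_partial_pos_cube:
  fixes u :: "real^'m \<Rightarrow> real"
  assumes "open S" "y \<in> S" "Ck_on 2 u S"
  shows "partial i (partial j (\<lambda>y. max 0 (u y) ^ 3)) y =
    6 * max 0 (u y) * partial i u y * partial j u y + 3 * (max 0 (u y))\<^sup>2 * partial i (partial j u) y"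
    "(\<lambda>y. max 0 (u y) ^ 3) differentiable (at y)"
    "partial j (\<lambda>y. max 0 (u y) ^ 3) differentiable (at y)"
proof -
  note C = Ck_on_2_imp[OF assms(3)]
  have d1: "((\<lambda>y. 3 * (max 0 (u y))\<^sup>2) has_derivative
      (\<lambda>w. 3 * (2 * max 0 (u y) * (\<Sum>i\<in>UNIV. w $ i *\<^sub>R partial i u y)))) (at y)"
    by (rule has_derivative_mult_right[OF has_derivative_real_comp_partial[OF C(4)[OF assms(2)] DERIV_pos_square]])
  have d2: "((\<lambda>y. 3 * (max 0 (u y))\<^sup>2 * partial j u y) has_derivative (\<lambda>w.
      3 * (max 0 (u y))\<^sup>2 * (\<Sum>i\<in>UNIV. w $ i *\<^sub>R partial i (partial j u) y) +
      3 * (2 * max 0 (u y) * (\<Sum>i\<in>UNIV. w $ i *\<^sub>R partial i u y)) * partial j u y)) (at y)"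
    by (rule has_derivative_mult[OF d1 has_derivative_partial[OF C(5)[OF assms(2)]]])
  have eq: "\<And>z. z \<in> S \<Longrightarrow> 3 * (max 0 (u z))\<^sup>2 * partial j u z = partial j (\<lambda>y. max 0 (u y) ^ 3) z"
    using partial_pos_cube[OF C(4)] by simp
  have d3: "(partial j (\<lambda>y. max 0 (u y) ^ 3) has_derivative (\<lambda>w.
      3 * (max 0 (u y))\<^sup>2 * (\<Sum>i\<in>UNIV. w $ i *\<^sub>R partial i (partial j u) y) +
      3 * (2 * max 0 (u y) * (\<Sum>i\<in>UNIV. w $ i *\<^sub>R partial i u y)) * partial j u y)) (at y)"
    using has_derivative_transform_within_open[OF d2 assms(1,2) eq] .
  show "partial i (partial j (\<lambda>y. max 0 (u y) ^ 3)) y =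
    6 * max 0 (u y) * partial i u y * partial j u y + 3 * (max 0 (u y))\<^sup>2 * partial i (partial j u) y"
    using partial_eqI[OF d3, of i] by (simp add: sum_axis_scaleR[where 'b=real, simplified])
  show "partial j (\<lambda>y. max 0 (u y) ^ 3) differentiable (at y)"
    using d3 by (rule differentiableI)
  show "(\<lambda>y. max 0 (u y) ^ 3) differentiable (at y)"
    using has_derivative_real_comp_partial[OF C(4)[OF assms(2)] DERIV_pos_cube] by (rule differentiableI)
qed

lemma Ck_on_pos_cube:
  fixes u :: "real^'m \<Rightarrow> real"
  assumes "open S" "Ck_on 2 u S"
  shows "Ck_on 2 (\<lambda>y. max 0 (u y) ^ 3) S"
proof -
  note C = Ck_on_2_imp[OF assms(2)]
  have "continuous_on S (\<lambda>y. 6 * max 0 (u y) * partial i u y * partial j u y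
      + 3 * (max 0 (u y))\<^sup>2 * partial i (partial j u) y)" for i j
    by (intro continuous_intros continuous_on_max C)
  then have "continuous_on S (partial i (partial j (\<lambda>y. max 0 (u y) ^ 3)))" for i j
    using partial_partial_pos_cube(1)[OF assms(1) _ assms(2)]
    by (subst continuous_on_cong[OF refl]) auto
  then show ?thesis
    using partial_partial_pos_cube(2,3)[OF assms(1) _ assms(2)] by (simp add: numeral_2_eq_2)
qed

text \<open>The second difference over a small square of side \<open>h\<close> is \<open>h\<^sup>2\<close> times either mixed derivative at some
  point of the square, by the mean value theorem in both orders.\<close>

lemma partial_commute_real:
  fixes f :: "real^'m \<Rightarrow> real"
  assumes "open S" "y \<in> S" and C: "Ck_on 2 f S"
  shows "partial i (partial j f) y = partial j (partial i f) y"
proof (rule ccontr)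
  assume neq: "\<not> ?thesis"
  note C = Ck_on_2_imp[OF C]
  define a where "a i j = partial i (partial j f)" for i j
  \<comment> \<open>Half the gap: two numbers within \<open>e\<close> of the two mixed derivatives
    at \<open>y\<close> cannot coincide.\<close>
  define e where "e = \<bar>a i j y - a j i y\<bar> / 2"
  have "e > 0" using neq by (simp add: e_def a_def)
  have cont: "\<exists>d>0. \<forall>z. dist z y < d \<longrightarrow> z \<in> S \<and> \<bar>a i j z - a i j y\<bar> < e" for i j
  proof -
    have "isCont (a i j) y"
      using C(7) assms by (simp add: a_def continuous_on_eq_continuous_at)
    then obtain d where "d > 0" "\<forall>z. dist z y < d \<longrightarrow> dist (a i j z) (a i j y) < e"
      using \<open>e > 0\<close> by (auto simp: continuous_at_eps_delta)
    moreover obtain d' where "d' > 0" "\<forall>z. dist z y < d' \<longrightarrow> z \<in> S"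
      using assms by (auto simp: open_dist)
    ultimately show ?thesis
      by (intro exI[of _ "min d d'"]) (auto simp: dist_real_def)
  qed
  obtain d1 where d1: "d1 > 0" "\<And>z. dist z y < d1 \<Longrightarrow> z \<in> S \<and> \<bar>a i j z - a i j y\<bar> < e"
    using cont[of i j] by blast
  obtain d2 where d2: "d2 > 0" "\<And>z. dist z y < d2 \<Longrightarrow> z \<in> S \<and> \<bar>a j i z - a j i y\<bar> < e"
    using cont[of j i] by blast
  \<comment> \<open>Points of the square of side \<open>h\<close> are at distance at most
    \<open>2 * h\<close> from \<open>y\<close>, hence inside both neighbourhoods.\<close>
  define h where "h = min d1 d2 / 3"
  have h: "h > 0" "3 * h \<le> d1" "3 * h \<le> d2" using d1 d2 by (auto simp: h_def)
  define p where "p s t i j = y + s *\<^sub>R axis i 1 + t *\<^sub>R axis j (1::real)" for s t i j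
  have dist: "dist (p s t i j) y < 3 * h" if "0 \<le> s" "s \<le> h" "0 \<le> t" "t \<le> h" for s t i j
  proof -
    have "dist (p s t i j) y = norm (s *\<^sub>R axis i 1 + t *\<^sub>R axis j (1::real) :: real^'m)"
      by (simp add: p_def dist_norm algebra_simps)
    also have "\<dots> \<le> s + t"
      using norm_triangle_ineq[of "s *\<^sub>R axis i 1 :: real^'m" "t *\<^sub>R axis j (1::real)"] that by simp
    finally show ?thesis using that h by simp
  qed
  have key: "\<exists>s t. 0 < s \<and> s < h \<and> 0 < t \<and> t < h \<and>
      f (p h h i j) - f (p h 0 i j) - (f (p 0 h i j) - f (p 0 0 i j)) = h * h * a j i (p s t i j)"
    for i j
  proof -
    have inS: "p s t i j \<in> S" if "0 \<le> s" "s \<le> h" "0 \<le> t" "t \<le> h" for s t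
      using d1(2)[of "p s t i j"] dist[OF that, of i j] h by force
    have D1: "((\<lambda>s. F (p s t i j)) has_real_derivative partial i F (p s t i j)) (at s)"
      if "F differentiable (at (p s t i j))" for F :: "real^'m \<Rightarrow> real" and s t
    proof -
      have "((\<lambda>s. p s t i j) has_derivative (\<lambda>r. r *\<^sub>R axis i 1)) (at s)"
        unfolding p_def by (auto intro!: derivative_eq_intros)
      from diff_chain_at[OF this has_derivative_partial[OF that]]
      have "((\<lambda>s. F (p s t i j)) has_derivative (\<lambda>r. r * partial i F (p s t i j))) (at s)"
        unfolding o_def sum_scaleR_axis_scaleR by simp
      then show ?thesis by (simp add: has_field_derivative_def mult.commute[of _ "partial i F _"])
    qed
    have D2: "((\<lambda>t. F (p s t i j)) has_real_derivative partial j F (p s t i j)) (at t)"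
      if "F differentiable (at (p s t i j))" for F :: "real^'m \<Rightarrow> real" and s t
    proof -
      have "((\<lambda>t. p s t i j) has_derivative (\<lambda>r. r *\<^sub>R axis j 1)) (at t)"
        unfolding p_def by (auto intro!: derivative_eq_intros)
      from diff_chain_at[OF this has_derivative_partial[OF that]]
      have "((\<lambda>t. F (p s t i j)) has_derivative (\<lambda>r. r * partial j F (p s t i j))) (at t)"
        unfolding o_def sum_scaleR_axis_scaleR by simp
      then show ?thesis by (simp add: has_field_derivative_def mult.commute[of _ "partial j F _"])
    qed
    have "((\<lambda>s. f (p s h i j) - f (p s 0 i j)) has_real_derivative
        partial i f (p s h i j) - partial i f (p s 0 i j)) (at s)" if "0 \<le> s" "s \<le> h" for s
      using D1[of f] C(4) inS that h by (intro DERIV_diff) auto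
    from MVT2[OF h(1) this] obtain s where s: "0 < s" "s < h"
      "f (p h h i j) - f (p h 0 i j) - (f (p 0 h i j) - f (p 0 0 i j))
        = h * (partial i f (p s h i j) - partial i f (p s 0 i j))"
      by auto
    have "((\<lambda>t. partial i f (p s t i j)) has_real_derivative a j i (p s t i j)) (at t)"
      if "0 \<le> t" "t \<le> h" for t
      unfolding a_def using D2[of "partial i f"] C(5) inS that s by auto
    from MVT2[OF h(1) this] obtain t where "0 < t" "t < h"
      "partial i f (p s h i j) - partial i f (p s 0 i j) = h * a j i (p s t i j)"
      by auto
    then show ?thesis using s by (intro exI[of _ s] exI[of _ t]) simp
  qed
  \<comment> \<open>Exchanging the axes leaves the second difference unchanged, so
    \<open>key\<close> applied to \<open>j\<close> and \<open>i\<close> speaks of the same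
    number.\<close>
  have swap: "p s t j i = p t s i j" for s t by (simp add: p_def)
  obtain s t where st: "0 < s" "s < h" "0 < t" "t < h"
      "f (p h h i j) - f (p h 0 i j) - (f (p 0 h i j) - f (p 0 0 i j)) = h * h * a j i (p s t i j)"
    using key[of i j] by blast
  obtain s' t' where st': "0 < s'" "s' < h" "0 < t'" "t' < h"
      "f (p h h i j) - f (p 0 h i j) - (f (p h 0 i j) - f (p 0 0 i j)) = h * h * a i j (p t' s' i j)"
    using key[of j i] unfolding swap by blast
  have "a j i (p s t i j) = a i j (p t' s' i j)"
    using st(5) st'(5) h(1) by (smt (verit) mult_cancel_left mult_eq_0_iff)
  moreover have "\<bar>a j i (p s t i j) - a j i y\<bar> < e" "\<bar>a i j (p t' s' i j) - a i j y\<bar> < e"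
    using d2(2)[of "p s t i j"] d1(2)[of "p t' s' i j"] dist[of s t i j] dist[of t' s' i j] st st' h
    by auto
  ultimately show False by (simp add: e_def abs_if split: if_splits)
qed

lemma partial_vec_nth: "F differentiable (at y) \<Longrightarrow> partial i (\<lambda>y. F y $ a) y = partial i F y $ a"
  using partial_eqI[OF bounded_linear.has_derivative[OF bounded_linear_vec_nth has_derivative_partial], of F y i a]
  by (simp only: sum_axis_scaleR)

text \<open>Taken by components, since the mean value argument is for real functions. The transition
  maps are where it is applied.\<close>

lemma partial_commute:
  fixes F :: "real^'m \<Rightarrow> real^'n"
  assumes "open S" "y \<in> S" "Ck_on 2 F S"
  shows "partial i (partial j F) y = partial j (partial i F) y"
proof -
  note C = Ck_on_2_imp[OF assms(3)]
  have "partial i (partial j (\<lambda>y. F y $ a)) y = partial i (partial j F) y $ a" for a i j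
    using partial_cong[OF assms(1,2), of "partial j (\<lambda>y. F y $ a)" "\<lambda>y. partial j F y $ a" i]
      partial_vec_nth[OF C(4)] partial_vec_nth[OF C(5)[OF assms(2)]] by simp
  moreover have "Ck_on 2 (\<lambda>y. F y $ a) S" for a
    by (rule Ck_on_bounded_linear[OF bounded_linear_vec_nth assms(1,3)])
  ultimately show ?thesis
    using partial_commute_real[OF assms(1,2)] by (metis vec_eq_iff)
qed

section \<open>Discretely stopped martingales on path space\<close>

text \<open>The sum telescopes up to the first index at which \<open>D\<close> fails. The value
  reached there is only known to be at most \<open>B\<close>, which takes its place.\<close>

lemma stopped_sum_le:
  fixes a :: "nat \<Rightarrow> real"
  assumes "\<And>j. a j \<le> B" and "\<And>j. D (Suc j) \<Longrightarrow> D j"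
  shows "(\<Sum>j<m. of_bool (D j) * (a (Suc j) - a j)) \<le> (if D m then a m else B) - a 0"
proof (induction m)
  case 0
  then show ?case using assms by auto
next
  case (Suc m)
  then show ?case using assms(1)[of "Suc m"] assms(2)[of m] by (auto split: if_splits)
qed

lemma set_integrable_continuous_on_Ioc:
  fixes b :: "real \<Rightarrow> real"
  assumes "continuous_on {0..} b" "0 \<le> u"
  shows "set_integrable lborel {u<..v} b"
proof -
  have "set_integrable lborel {u..v} b"
    by (rule borel_integrable_atLeastAtMost')
       (use assms in \<open>auto intro: continuous_on_subset\<close>)
  then show ?thesis by (rule set_integrable_subset) auto
qed

lemma set_integral_Icc_diff:
  fixes b :: "real \<Rightarrow> real"
  assumes "continuous_on {0..} b" "0 \<le> u" "u \<le> v"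
  shows "(LINT s:{0..v}|lborel. b s) - (LINT s:{0..u}|lborel. b s) = (LINT s:{u<..v}|lborel. b s)"
proof -
  have "{0..v} = {0..u} \<union> {u<..v}" using assms by auto
  moreover have "set_integrable lborel {0..u} b"
    by (rule borel_integrable_atLeastAtMost')
       (use assms in \<open>auto intro: continuous_on_subset\<close>)
  ultimately show ?thesis
    using set_integral_Un[of "{0..u}" "{u<..v}" lborel b]
      set_integrable_continuous_on_Ioc[OF assms(1,2), of v] by (auto simp: disjoint_iff)
qed

text \<open>The error is at most the grid width \<open>t / 2 ^ k\<close>. It serves twice: to
  approach a time by grid points, and with \<open>t = 1\<close> to discretise time for joint
  measurability.\<close>

lemma dyadic_floor_tendsto:
  assumes "t > 0"
  shows "(\<lambda>k. t * real_of_int \<lfloor>r * 2 ^ k / t\<rfloor> / 2 ^ k) \<longlonglongrightarrow> r"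
proof -
  have lim: "(\<lambda>k. t * (1 / 2) ^ k) \<longlonglongrightarrow> 0"
    by (rule tendsto_mult_right_zero) (rule LIMSEQ_realpow_zero, auto)
  have "(\<lambda>k. t * real_of_int \<lfloor>r * 2 ^ k / t\<rfloor> / 2 ^ k - r) \<longlonglongrightarrow> 0"
  proof (rule Lim_null_comparison[OF _ lim], rule always_eventually, rule allI)
    fix k
    have "t * real_of_int \<lfloor>r * 2 ^ k / t\<rfloor> / 2 ^ k - r
        = (t / 2 ^ k) * (real_of_int \<lfloor>r * 2 ^ k / t\<rfloor> - r * 2 ^ k / t)"
      using assms by (simp add: field_simps)
    also have "\<bar>\<dots>\<bar> \<le> (t / 2 ^ k) * 1"
    proof -
      have "\<bar>t / 2 ^ k\<bar> = t / 2 ^ k" using assms by simp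
      moreover have "\<bar>real_of_int \<lfloor>r * 2 ^ k / t\<rfloor> - r * 2 ^ k / t\<bar> \<le> 1" by linarith
      ultimately show ?thesis
        unfolding abs_mult using assms by (metis abs_ge_zero mult_left_mono)
    qed
    finally show "norm (t * real_of_int \<lfloor>r * 2 ^ k / t\<rfloor> / 2 ^ k - r) \<le> t * (1 / 2) ^ k"
      by (simp add: power_divide)
  qed
  then show ?thesis by (simp add: LIM_zero_iff)
qed

text \<open>\<open>V\<close> stands for the set of times at which the path is in the open set. A point \<open>r\<close> before the first
  dyadic exit is a limit of \<open>V\<close>, so that \<open>lam * a r \<le> b r\<close> there by continuity; this spares the exit
  time itself.\<close>

lemma stopped_integral_limit:
  fixes a b :: "real \<Rightarrow> real" and V :: "real set"
  assumes ca: "continuous_on {0..} a" and cb: "continuous_on {0..} b" and "t > 0" "lam > 0"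
    and le: "\<And>r. r \<in> V \<Longrightarrow> lam * a r \<le> b r" and "\<And>r. 0 \<le> a r" and C: "\<And>r. \<bar>b r\<bar> \<le> C"
  defines "S \<equiv> \<lambda>k. \<Sum>j<2^k. of_bool (\<forall>i\<le>j. t * real i / 2^k \<in> V) *
      (LINT s:{t * real j / 2^k<..t * real (Suc j) / 2^k}|lborel. b s)"
  shows "\<exists>s. S \<longlonglongrightarrow> s \<and>
      lam * (of_bool (\<forall>k. \<forall>i\<le>2^k. t * real i / 2^k \<in> V) * (LINT s:{0<..t}|lborel. a s)) \<le> s"
    and "\<bar>S k\<bar> \<le> C * t"
proof -
  \<comment> \<open>The indicator of the times up to the exit as seen on the grid of level
    \<open>k\<close>. It is constant on each half-open cell, which turns \<open>S k\<close> into one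
    integral of \<open>ch k\<close> times \<open>b\<close>.\<close>
  define ch where "ch k r = (of_bool (\<forall>i. t * real i / 2^k < r \<longrightarrow> t * real i / 2^k \<in> V) :: real)" for k r
  have ch_meas: "ch k \<in> borel_measurable borel" for k
    unfolding ch_def of_bool_def by measurable
  have ib: "set_integrable lborel {u<..v} b" if "0 \<le> u" for u v
    using set_integrable_continuous_on_Ioc[OF cb that] .
  have ichb: "set_integrable lborel {u<..v} (\<lambda>r. ch k r * b r)" if "0 \<le> u" for u v k
    unfolding set_integrable_def
  proof (rule Bochner_Integration.integrable_bound[OF ib[OF that, of v, unfolded set_integrable_def]])
    have "(\<lambda>x. indicator {u<..v} x *\<^sub>R b x) \<in> borel_measurable lborel"
      using ib[OF that, of v] by (auto simp: set_integrable_def dest: borel_measurable_integrable)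
    then have "(\<lambda>x. ch k x * (indicator {u<..v} x *\<^sub>R b x)) \<in> borel_measurable lborel"
      using ch_meas by measurable
    then show "(\<lambda>x. indicator {u<..v} x *\<^sub>R (ch k x * b x)) \<in> borel_measurable lborel"
      by (simp add: mult.left_commute)
    show "AE x in lborel. norm (indicator {u<..v} x *\<^sub>R (ch k x * b x)) \<le> norm (indicator {u<..v} x *\<^sub>R b x)"
      by (auto simp: ch_def)
  qed
  have part: "(LINT r:{0<..t * real m / 2^k}|lborel. ch k r * b r) =
      (\<Sum>j<m. of_bool (\<forall>i\<le>j. t * real i / 2^k \<in> V) *
        (LINT s:{t * real j / 2^k<..t * real (Suc j) / 2^k}|lborel. b s))" for m k
  proof (induction m)
    case 0
    then show ?case by (simp add: set_lebesgue_integral_def)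
  next
    case (Suc m)
    have le1: "0 \<le> t * real m / 2^k" "t * real m / 2^k \<le> t * real (Suc m) / 2^k"
      using \<open>t > 0\<close> by (auto simp: divide_right_mono)
    then have "{0<..t * real (Suc m) / 2^k} =
        {0<..t * real m / 2^k} \<union> {t * real m / 2^k<..t * real (Suc m) / 2^k}"
      by auto
    then have "(LINT r:{0<..t * real (Suc m) / 2^k}|lborel. ch k r * b r) =
        (LINT r:{0<..t * real m / 2^k}|lborel. ch k r * b r) +
        (LINT r:{t * real m / 2^k<..t * real (Suc m) / 2^k}|lborel. ch k r * b r)"
      using ichb le1 by (simp only:) (subst set_integral_Un; auto)
    moreover have "(LINT r:{t * real m / 2^k<..t * real (Suc m) / 2^k}|lborel. ch k r * b r) =
        (LINT r:{t * real m / 2^k<..t * real (Suc m) / 2^k}|lborel.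
          of_bool (\<forall>i\<le>m. t * real i / 2^k \<in> V) * b r)"
    proof (rule set_lebesgue_integral_cong, simp, intro allI impI)
      fix r assume "r \<in> {t * real m / 2^k<..t * real (Suc m) / 2^k}"
      then have r: "t * real m / 2^k < r" "r \<le> t * (1 + real m) / 2^k" by auto
      \<comment> \<open>The strict inequality in \<open>ch\<close> matters at the right end of the
        cell: the grid point there does not yet count.\<close>
      have "t * real i / 2^k < r \<longleftrightarrow> i \<le> m" for i
      proof
        assume "i \<le> m"
        then have "t * real i / 2^k \<le> t * real m / 2^k" using \<open>t > 0\<close> by (simp add: divide_right_mono)
        then show "t * real i / 2^k < r" using r by simp
      next
        assume "t * real i / 2^k < r"
        then have "t * real i / 2^k < t * (1 + real m) / 2^k" using r by simp
        then have "real i < 1 + real m" using \<open>t > 0\<close> by (simp add: divide_less_cancel)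
        then show "i \<le> m" by linarith
      qed
      then show "ch k r * b r = of_bool (\<forall>i\<le>m. t * real i / 2^k \<in> V) * b r"
        by (simp add: ch_def)
    qed
    ultimately show ?case using Suc.IH by simp
  qed
  have S_eq: "S k = (LINT r:{0<..t}|lborel. ch k r * b r)" for k
    unfolding S_def using part[of "2^k" k, symmetric] by simp
  have abs_le: "\<bar>indicator {0<..t} r *\<^sub>R (ch k r * b r)\<bar> \<le> C * indicator {0<..t} r" for r k
    using C[of r] by (auto simp: ch_def indicator_def)
  have ii: "integrable lborel (\<lambda>r. C * indicator {0<..t} r)"
    using \<open>t > 0\<close> by (intro integrable_mult_right) (auto simp: integrable_indicator_iff)
  have lim_meas: "(\<lambda>x. indicator {0<..t} x *\<^sub>R (ch k x * b x)) \<in> borel_measurable lborel" for k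
    using ichb[of 0 t k] by (auto simp: set_integrable_def dest: borel_measurable_integrable)
  have "\<bar>S k\<bar> \<le> (LINT r|lborel. \<bar>indicator {0<..t} r *\<^sub>R (ch k r * b r)\<bar>)"
    unfolding S_eq set_lebesgue_integral_def
    using integral_norm_bound[of lborel "\<lambda>r. indicator {0<..t} r *\<^sub>R (ch k r * b r)"] by simp
  also have "\<dots> \<le> (LINT r|lborel. C * indicator {0<..t} r)"
    using integral_mono[OF integrable_norm[OF ichb[of 0 t k, unfolded set_integrable_def]] ii] abs_le[of _ k]
    by simp
  finally have "\<bar>S k\<bar> \<le> (LINT r|lborel. C * indicator {0<..t} r)" .
  then show "\<bar>S k\<bar> \<le> C * t" using \<open>t > 0\<close> by simp
  \<comment> \<open>The grids are nested, so a failure at level \<open>K\<close> recurs at every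
    later level; thus \<open>ch k r\<close> is eventually constant in \<open>k\<close>, with value
    \<open>ci r\<close>.\<close>
  define ci where "ci r = (of_bool (\<forall>k i. t * real i / 2^k < r \<longrightarrow> t * real i / 2^k \<in> V) :: real)" for r
  have ci_meas: "ci \<in> borel_measurable borel"
    unfolding ci_def of_bool_def by measurable
  have lim: "(\<lambda>k. ch k r) \<longlonglongrightarrow> ci r" for r
  proof (cases "\<forall>k i. t * real i / 2^k < r \<longrightarrow> t * real i / 2^k \<in> V")
    case True
    then have "\<And>k. ch k r = 1" "ci r = 1" unfolding ch_def ci_def by auto
    then show ?thesis by simp
  next
    case False
    then obtain K i where Ki: "t * real i / 2^K < r" "t * real i / 2^K \<notin> V" by blast
    have "ch k r = ci r" if "K \<le> k" for k
    proof -
      obtain l where "k = K + l" using \<open>K \<le> k\<close> le_Suc_ex by auto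
      then have "t * real (i * 2^(k-K)) / 2^k = t * real i / 2^K"
        by (simp add: power_add)
      then have "t * real (i * 2^(k-K)) / 2^k < r" "t * real (i * 2^(k-K)) / 2^k \<notin> V"
        using Ki by simp_all
      then have "ch k r = 0" unfolding ch_def of_bool_eq_0_iff by blast
      moreover have "ci r = 0" using False by (simp add: ci_def)
      ultimately show ?thesis by simp
    qed
    then show ?thesis
      by (intro tendsto_eventually) (auto simp: eventually_sequentially)
  qed
  have im: "(\<lambda>x. indicator {0<..t} x *\<^sub>R b x) \<in> borel_measurable lborel"
    using ib[of 0 t] by (auto simp: set_integrable_def dest: borel_measurable_integrable)
  then have lm: "(\<lambda>x. ci x * (indicator {0<..t} x *\<^sub>R b x)) \<in> borel_measurable lborel"
    using ci_meas by measurable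
  then have lm: "(\<lambda>x. indicator {0<..t} x *\<^sub>R (ci x * b x)) \<in> borel_measurable lborel"
    by (simp add: mult.left_commute)
  have conv: "(\<lambda>k. indicator {0<..t} r *\<^sub>R (ch k r * b r)) \<longlonglongrightarrow> indicator {0<..t} r *\<^sub>R (ci r * b r)" for r
    by (intro tendsto_intros lim)
  note dc = lm lim_meas ii AE_I2[OF conv] AE_I2[OF abs_le[folded real_norm_def]]
  have "S \<longlonglongrightarrow> (LINT r:{0<..t}|lborel. ci r * b r)"
    unfolding S_eq set_lebesgue_integral_def by (rule integral_dominated_convergence[OF dc])
  moreover have "lam * (of_bool (\<forall>k. \<forall>i\<le>2^k. t * real i / 2^k \<in> V) * (LINT s:{0<..t}|lborel. a s))
      \<le> (LINT r:{0<..t}|lborel. ci r * b r)" (is "lam * (of_bool ?G * _) \<le> _")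
  proof -
    have ia: "integrable lborel (\<lambda>r. lam * (of_bool ?G * (indicator {0<..t} r *\<^sub>R a r)))"
      using set_integrable_continuous_on_Ioc[OF ca, of 0 t]
      by (intro integrable_mult_right) (auto simp: set_integrable_def)
    have ici: "integrable lborel (\<lambda>x. indicator {0<..t} x *\<^sub>R (ci x * b x))"
      by (rule integrable_dominated_convergence[OF dc])
    \<comment> \<open>If all grid points before \<open>r\<close> lie in \<open>V\<close>, the
      inequality at \<open>r\<close> follows by continuity. Otherwise one of them is outside
      \<open>V\<close>; being below \<open>t\<close>, it also falsifies \<open>?G\<close>, and both
      sides are 0.\<close>
    have "lam * (of_bool ?G * (indicator {0<..t} r *\<^sub>R a r)) \<le> indicator {0<..t} r *\<^sub>R (ci r * b r)" for r
    proof (cases "0 < r \<and> r \<le> t")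
      case r: True
      show ?thesis
      proof (cases "\<forall>k i. t * real i / 2^k < r \<longrightarrow> t * real i / 2^k \<in> V")
        case True
        \<comment> \<open>The last grid point strictly before \<open>r\<close>, hence the ceiling
          minus one.\<close>
        define e where "e k = t * real (nat (\<lceil>r * 2 ^ k / t\<rceil> - 1)) / 2 ^ k" for k
        have e_eq: "e k = t * real_of_int (\<lceil>r * 2 ^ k / t\<rceil> - 1) / 2 ^ k" for k
        proof -
          have "0 < r * 2 ^ k / t" using r \<open>t > 0\<close> by simp
          then have "0 \<le> \<lceil>r * 2 ^ k / t\<rceil> - 1" by linarith
          then show ?thesis by (simp add: e_def)
        qed
        have e_less: "e k < r" for k
        proof -
          have "real_of_int (\<lceil>r * 2 ^ k / t\<rceil> - 1) < r * 2 ^ k / t" by linarith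
          then show ?thesis unfolding e_eq using \<open>t > 0\<close> by (simp add: field_simps)
        qed
        have e_V: "e k \<in> V" for k
          using True e_less[of k] unfolding e_def by blast
        have e_0: "0 \<le> e k" for k using \<open>t > 0\<close> by (simp add: e_def)
        have "e \<longlonglongrightarrow> r"
        proof -
          \<comment> \<open>The ceiling is the negated floor of the negated number, so
            \<open>dyadic_floor_tendsto\<close> is used at \<open>- r\<close>; the subtracted grid
            width tends to 0.\<close>
          have "(\<lambda>k. - (t * real_of_int \<lfloor>(- r) * 2 ^ k / t\<rfloor> / 2 ^ k) - t * (1 / 2) ^ k) \<longlonglongrightarrow> - (- r) - 0"
            by (intro tendsto_diff tendsto_minus dyadic_floor_tendsto[OF \<open>t > 0\<close>] tendsto_mult_right_zero
                LIMSEQ_realpow_zero) auto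
          moreover have "- (t * real_of_int \<lfloor>(- r) * 2 ^ k / t\<rfloor> / 2 ^ k) - t * (1 / 2) ^ k = e k" for k
            unfolding e_eq ceiling_def by (simp add: field_simps power_divide)
          ultimately show ?thesis by simp
        qed
        moreover have "\<forall>\<^sub>F k in sequentially. e k \<in> {0..}" "r \<in> {0..}" using e_0 r by simp_all
        ultimately have "(\<lambda>k. b (e k)) \<longlonglongrightarrow> b r" "(\<lambda>k. lam * a (e k)) \<longlonglongrightarrow> lam * a r"
          using continuous_on_tendsto_compose[OF cb, of e r sequentially]
            continuous_on_tendsto_compose[OF ca, of e r sequentially]
          by (auto intro!: tendsto_mult_left)
        then have "lam * a r \<le> b r"
          using le[OF e_V] by (auto intro: LIMSEQ_le)
        moreover have "0 \<le> lam * a r" using assms(6)[of r] \<open>lam > 0\<close> by simp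
        ultimately show ?thesis using True r by (auto simp: ci_def)
      next
        case False
        then obtain k i where ki: "t * real i / 2^k < r" "t * real i / 2^k \<notin> V" by blast
        then have "t * real i / 2^k < t" using r by linarith
        then have "real i < 2^k" using \<open>t > 0\<close> by (simp add: field_simps)
        then have "i \<le> 2^k" by (metis less_imp_le of_nat_less_numeral_power_cancel_iff)
        then have "\<not> ?G" using ki by blast
        then show ?thesis using False by (auto simp: ci_def)
      qed
    qed auto
    from integral_mono[OF ia ici this] show ?thesis
      by (simp add: set_lebesgue_integral_def)
  qed
  ultimately show "\<exists>s. S \<longlonglongrightarrow> s \<and>
      lam * (of_bool (\<forall>k. \<forall>i\<le>2^k. t * real i / 2^k \<in> V) * (LINT s:{0<..t}|lborel. a s)) \<le> s"
    by blast
qed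

text \<open>The conditional expectation of \<open>X t\<close> given \<open>F s\<close> is
  \<open>X s\<close>, and it is tested here on an event of \<open>F s\<close>.\<close>

lemma martingale_increment:
  assumes "prob_space P" "martingale P F X" "subalgebra P (F s)" "D \<in> sets (F s)" "0 \<le> s" "s \<le> t"
  shows "integrable P (\<lambda>\<omega>. indicator D \<omega> * (X t \<omega> - X s \<omega>))"
    and "(\<integral>\<omega>. indicator D \<omega> * (X t \<omega> - X s \<omega>) \<partial>P) = 0"
proof -
  interpret prob_space P by fact
  interpret finite_measure_subalgebra P "F s"
    by unfold_locales fact
  have D: "D \<in> sets P" using assms(3,4) by (auto simp: subalgebra_def)
  have int: "integrable P (X s)" "integrable P (X t)"
    using assms(2,5,6) by (auto simp: martingale_def)
  have int': "integrable P (\<lambda>\<omega>. indicator D \<omega> * X s \<omega>)" "integrable P (\<lambda>\<omega>. indicator D \<omega> * X t \<omega>)"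
    using integrable_mult_indicator[OF D int(1)] integrable_mult_indicator[OF D int(2)] by simp_all
  then show "integrable P (\<lambda>\<omega>. indicator D \<omega> * (X t \<omega> - X s \<omega>))"
    by (auto simp: right_diff_distrib)
  have "(\<integral>\<omega>. indicator D \<omega> * X t \<omega> \<partial>P) = (LINT \<omega>:D|P. real_cond_exp P (F s) (X t) \<omega>)"
    using real_cond_exp_intA[OF int(2) assms(4)] by (simp add: set_lebesgue_integral_def)
  also have "\<dots> = (LINT \<omega>:D|P. X s \<omega>)"
    unfolding set_lebesgue_integral_def
  proof (rule integral_cong_AE)
    have "AE \<omega> in P. real_cond_exp P (F s) (X t) \<omega> = X s \<omega>"
      using assms(2,5,6) by (simp add: martingale_def)
    then show "AE \<omega> in P. indicator D \<omega> *\<^sub>R real_cond_exp P (F s) (X t) \<omega> = indicator D \<omega> *\<^sub>R X s \<omega>"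
      by eventually_elim simp
  qed (intro borel_measurable_scaleR borel_measurable_indicator D borel_measurable_cond_exp2
      borel_measurable_integrable[OF int(1)])+
  finally show "(\<integral>\<omega>. indicator D \<omega> * (X t \<omega> - X s \<omega>) \<partial>P) = 0"
    using int' by (simp add: right_diff_distrib set_lebesgue_integral_def)
qed

section \<open>Path space: evaluation maps and exit from an open set\<close>

lemma space_path_algebra [simp]: "space (path_algebra I) = paths"
  unfolding path_algebra_def by (rule space_measure_of) auto

lemma sets_path_algebra:
  "sets (path_algebra I) = sigma_sets paths
     {{\<omega>\<in>paths. \<omega> s \<in> U} | s U. s \<in> I \<and> openin (Alexandroff_compactification euclidean) U}"
  unfolding path_algebra_def by (rule sets_measure_of) auto

lemma path_algebra_mono:
  assumes "I \<subseteq> J"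
  shows "sets (path_algebra I) \<subseteq> sets (path_algebra J)"
  unfolding sets_path_algebra by (rule sigma_sets_mono') (use assms in blast)

lemma eval_in_path_algebra:
  "s \<in> I \<Longrightarrow> openin (Alexandroff_compactification euclidean) U \<Longrightarrow>
    {\<omega>\<in>paths. \<omega> s \<in> U} \<in> sets (path_algebra I)"
  unfolding sets_path_algebra by (rule sigma_sets.Basic) blast

lemma measurable_eval_path:
  assumes "continuous_map (Alexandroff_compactification euclidean) euclideanreal F" "s \<in> I"
  shows "(\<lambda>\<omega>. F (\<omega> s)) \<in> borel_measurable (path_algebra I)"
proof (rule borel_measurableI)
  fix S :: "real set" assume "open S"
  then have "openin (Alexandroff_compactification euclidean)
      {z \<in> topspace (Alexandroff_compactification euclidean). F z \<in> S}"
    using assms(1) by (auto simp: continuous_map_def)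
  moreover have "topspace (Alexandroff_compactification (euclidean::'a topology)) = UNIV"
    by (auto simp: image_iff)
  ultimately have "openin (Alexandroff_compactification euclidean) (F -` S)"
    by (simp add: vimage_def del: topspace_Alexandroff_compactification)
  from eval_in_path_algebra[OF assms(2) this]
  show "(\<lambda>\<omega>. F (\<omega> s)) -` S \<inter> space (path_algebra I) \<in> sets (path_algebra I)"
    by (simp add: vimage_def Int_def conj_commute)
qed

lemma continuous_on_path:
  assumes "continuous_map (Alexandroff_compactification euclidean) euclideanreal F" "\<omega> \<in> paths"
  shows "continuous_on {0..} (\<lambda>s. F (\<omega> s))"
  using continuous_map_compose[of "top_of_set {0..}" _ \<omega> euclideanreal F] assms
  by (auto simp: paths_def o_def)

text \<open>Stopping is done at the first point of the grid \<open>t i / 2\<^sup>k\<close> at which the path is outside \<open>U\<close>, i.e. by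
  summing the martingale increments over the events that no earlier grid point is outside \<open>U\<close>. These
  events are measurable and no optional stopping theorem is needed; then \<open>k \<rightarrow> \<infinity>\<close>.\<close>

lemma exit_inequality:
  fixes A :: "('a::topological_space, 'm::finite) chart set"
  assumes law: "diffusion_law A L x P" and f: "test_function A f"
    and cf: "continuous_map (Alexandroff_compactification euclidean) euclideanreal (at_cemetery_zero f)"
    and ch: "continuous_map (Alexandroff_compactification euclidean) euclideanreal (at_cemetery_zero (L f))"
    and f0: "\<And>p. 0 \<le> f p" and fB: "\<And>p. f p \<le> B" and C: "\<And>p. \<bar>L f p\<bar> \<le> C"
    and "open U" "lam > 0" and le: "\<And>p. p \<in> U \<Longrightarrow> lam * f p \<le> L f p" and "t > 0"
    and mI: "(\<lambda>\<omega>. LINT s:{0<..t}|lborel. at_cemetery_zero f (\<omega> s)) \<in> borel_measurable P"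
  defines "G \<equiv> {\<omega>\<in>paths. \<forall>k. \<forall>i\<le>2^k. \<omega> (t * real i / 2^k) \<in> Some ` U}"
  shows "G \<in> sets P"
    and "lam * (\<integral>\<omega>. indicator G \<omega> * (LINT s:{0<..t}|lborel. at_cemetery_zero f (\<omega> s)) \<partial>P)
      \<le> (\<integral>\<omega>. (if \<omega> \<in> G then at_cemetery_zero f (\<omega> t) else B) \<partial>P) - f x"
proof -
  let ?e = "at_cemetery_zero"
  interpret prob_space P using law by (simp add: diffusion_law_def)
  have setsP: "sets P = sets (path_algebra {0..})" using law by (simp add: diffusion_law_def)
  have spP: "space P = paths" using sets_eq_imp_space_eq[OF setsP] by simp
  have e0: "0 \<le> ?e f z" for z using f0 by (simp add: at_cemetery_zero_def split: option.split)
  have "0 \<le> B" using f0[of undefined] fB[of undefined] by linarith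
  then have eB: "?e f z \<le> B" for z using fB by (simp add: at_cemetery_zero_def split: option.split)
  have "0 \<le> C" using C[of undefined] by linarith
  then have eC: "\<bar>?e (L f) z\<bar> \<le> C" for z using C by (simp add: at_cemetery_zero_def split: option.split)
  have ope: "openin (Alexandroff_compactification euclidean) (Some ` U)" using \<open>open U\<close> by simp
  have tk: "0 \<le> t * real i / 2^k" for i k using \<open>t > 0\<close> by simp
  define D where "D k j = {\<omega>\<in>paths. \<forall>i\<le>j. \<omega> (t * real i / 2^k) \<in> Some ` U}" for k j
  \<comment> \<open>Only times up to the left end of cell \<open>j\<close> enter, so the event is
    known before the increment with which it is paired.\<close>
  have D_sets: "D k j \<in> sets (path_algebra {0..t * real j / 2^k})" for k j
  proof -
    have "D k j = (\<Inter>i\<in>{..j}. {\<omega>\<in>paths. \<omega> (t * real i / 2^k) \<in> Some ` U})" by (auto simp: D_def)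
    also have "\<dots> \<in> sets (path_algebra {0..t * real j / 2^k})"
      by (rule sets.finite_INT) (use \<open>t > 0\<close> in \<open>auto intro!: eval_in_path_algebra[OF _ ope] simp: divide_right_mono\<close>)
    finally show ?thesis .
  qed
  have D_setsP: "D k j \<in> sets P" for k j
    using D_sets[of k j] path_algebra_mono[of "{0..t * real j / 2^k}" "{0..}"] setsP by auto
  have G_eq: "G = (\<Inter>k. D k (2^k))" by (auto simp: G_def D_def)
  show G: "G \<in> sets P" unfolding G_eq using D_setsP by (intro sets.countable_INT) auto
  define M where "M s \<omega> = ?e f (\<omega> s) - ?e f (\<omega> 0) - (LINT r:{0..s}|lborel. ?e (L f) (\<omega> r))" for s :: real and \<omega>
  have mart: "martingale P (\<lambda>s. path_algebra {0..s}) M"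
    using law f by (simp add: diffusion_law_def M_def[abs_def])
  have sub: "subalgebra P (path_algebra {0..s})" for s
    using path_algebra_mono[of "{0..s}" "{0..}"] setsP spP by (auto simp: subalgebra_def)
  have tle: "t * real j / 2^k \<le> t * real (Suc j) / 2^k" for j k
    using \<open>t > 0\<close> by (simp add: divide_right_mono)
  note inc = martingale_increment[OF prob_space_axioms mart sub D_sets tk tle]
  define fs where "fs k \<omega> = (\<Sum>j<2^k. of_bool (\<omega> \<in> D k j) * (?e f (\<omega> (t * real (Suc j) / 2^k)) - ?e f (\<omega> (t * real j / 2^k))))" for k \<omega>
  define S where "S k \<omega> = (\<Sum>j<2^k. of_bool (\<forall>i\<le>j. t * real i / 2^k \<in> {r. \<omega> r \<in> Some ` U}) *
      (LINT s:{t * real j / 2^k<..t * real (Suc j) / 2^k}|lborel. ?e (L f) (\<omega> s)))" for k \<omega>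
  have ms: "(\<Sum>j<2^k. indicator (D k j) \<omega> * (M (t * real (Suc j) / 2^k) \<omega> - M (t * real j / 2^k) \<omega>))
      = fs k \<omega> - S k \<omega>" if "\<omega> \<in> paths" for k \<omega>
    unfolding fs_def S_def sum_subtractf[symmetric]
  proof (rule sum.cong[OF refl])
    fix j
    have "M (t * real (Suc j) / 2^k) \<omega> - M (t * real j / 2^k) \<omega> =
      ?e f (\<omega> (t * real (Suc j) / 2^k)) - ?e f (\<omega> (t * real j / 2^k)) -
      (LINT s:{t * real j / 2^k<..t * real (Suc j) / 2^k}|lborel. ?e (L f) (\<omega> s))"
      using set_integral_Icc_diff[OF continuous_on_path[OF ch that] tk tle, of j k]
      unfolding M_def by linarith
    moreover have "indicator (D k j) \<omega> = (of_bool (\<omega> \<in> D k j) :: real)"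
      "(\<omega> \<in> D k j) = (\<forall>i\<le>j. t * real i / 2^k \<in> {r. \<omega> r \<in> Some ` U})"
      using that by (auto simp: D_def indicator_def)
    ultimately show "indicator (D k j) \<omega> * (M (t * real (Suc j) / 2^k) \<omega> - M (t * real j / 2^k) \<omega>) =
      of_bool (\<omega> \<in> D k j) * (?e f (\<omega> (t * real (Suc j) / 2^k)) - ?e f (\<omega> (t * real j / 2^k))) -
      of_bool (\<forall>i\<le>j. t * real i / 2^k \<in> {r. \<omega> r \<in> Some ` U}) *
      (LINT s:{t * real j / 2^k<..t * real (Suc j) / 2^k}|lborel. ?e (L f) (\<omega> s))"
      by (simp add: right_diff_distrib)
  qed
  have ef_meas: "(\<lambda>\<omega>. ?e f (\<omega> s)) \<in> borel_measurable P" if "0 \<le> s" for s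
    using measurable_eval_path[OF cf, of s "{0..}"] that measurable_cong_sets[OF setsP refl] by auto
  have ef_int: "integrable P (\<lambda>\<omega>. ?e f (\<omega> s))" if "0 \<le> s" for s
    using ef_meas[OF that] e0 eB by (intro integrable_const_bound[where B=B]) auto
  have fs_int: "integrable P (fs k)" for k
    unfolding fs_def
  proof (rule Bochner_Integration.integrable_sum)
    fix j
    have "integrable P (\<lambda>\<omega>. indicator (D k j) \<omega> *\<^sub>R (?e f (\<omega> (t * real (Suc j) / 2^k)) - ?e f (\<omega> (t * real j / 2^k))))"
      by (intro integrable_mult_indicator D_setsP Bochner_Integration.integrable_diff ef_int tk)
    then show "integrable P (\<lambda>\<omega>. of_bool (\<omega> \<in> D k j) *
       (?e f (\<omega> (t * real (Suc j) / 2^k)) - ?e f (\<omega> (t * real j / 2^k))))"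
      by (simp add: indicator_def)
  qed
  have ms_int: "integrable P (\<lambda>\<omega>. fs k \<omega> - S k \<omega>)" "(\<integral>\<omega>. fs k \<omega> - S k \<omega> \<partial>P) = 0" for k
  proof -
    have i: "integrable P (\<lambda>\<omega>. \<Sum>j<2^k. indicator (D k j) \<omega> * (M (t * real (Suc j) / 2^k) \<omega> - M (t * real j / 2^k) \<omega>))"
      by (rule Bochner_Integration.integrable_sum) (rule inc)
    have z: "(\<integral>\<omega>. (\<Sum>j<2^k. indicator (D k j) \<omega> * (M (t * real (Suc j) / 2^k) \<omega> - M (t * real j / 2^k) \<omega>)) \<partial>P) = 0"
      by (subst Bochner_Integration.integral_sum, rule inc(1)) (simp only: inc(2) sum.neutral_const)
    show "integrable P (\<lambda>\<omega>. fs k \<omega> - S k \<omega>)"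
      using i by (subst Bochner_Integration.integrable_cong[OF refl ms[symmetric]]) (auto simp: spP)
    show "(\<integral>\<omega>. fs k \<omega> - S k \<omega> \<partial>P) = 0"
      using z by (subst Bochner_Integration.integral_cong[OF refl ms[symmetric]]) (auto simp: spP)
  qed
  \<comment> \<open>Measurability of the stopped time integrals comes for free: they are the
    difference of the sum over \<open>f\<close> and the sum of martingale increments.\<close>
  have S_int: "integrable P (S k)" for k
    using Bochner_Integration.integrable_diff[OF fs_int[of k] ms_int(1)[of k]] by simp
  have ES: "(\<integral>\<omega>. S k \<omega> \<partial>P) = (\<integral>\<omega>. fs k \<omega> \<partial>P)" for k
    using ms_int(2)[of k] Bochner_Integration.integral_diff[OF fs_int[of k] S_int[of k]] by simp
  define R where "R \<omega> = (if \<omega> \<in> G then ?e f (\<omega> t) else B) - f x" for \<omega> :: "real \<Rightarrow> 'a option"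
  have R_int: "integrable P (\<lambda>\<omega>. if \<omega> \<in> G then ?e f (\<omega> t) else B)"
    using ef_meas[of t] e0 eB G \<open>t > 0\<close> \<open>0 \<le> B\<close>
    by (intro integrable_const_bound[where B=B]) (auto intro!: measurable_If_set)
  have fs_le: "(\<integral>\<omega>. fs k \<omega> \<partial>P) \<le> (\<integral>\<omega>. R \<omega> \<partial>P)" for k
  proof (rule integral_mono_AE)
    show "integrable P R" unfolding R_def using R_int by simp
    have "AE \<omega> in P. \<omega> 0 = Some x" using law by (simp add: diffusion_law_def)
    then show "AE \<omega> in P. fs k \<omega> \<le> R \<omega>"
    proof (rule AE_mp, intro AE_I2 impI)
      fix \<omega> :: "real \<Rightarrow> 'a option" assume "\<omega> 0 = Some x"
      have "fs k \<omega> \<le> (if \<omega> \<in> D k (2^k) then ?e f (\<omega> (t * real (2^k) / 2^k)) else B) - ?e f (\<omega> (t * real 0 / 2^k))"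
        unfolding fs_def by (rule stopped_sum_le) (auto simp: D_def eB)
      \<comment> \<open>\<open>G\<close> is contained in every \<open>D k (2^k)\<close>; on the
        difference of the two events the value of \<open>f\<close> is bounded by
        \<open>B\<close>.\<close>
      also have "\<dots> \<le> R \<omega>"
        using \<open>\<omega> 0 = Some x\<close> eB by (auto simp: R_def G_eq at_cemetery_zero_def)
      finally show "fs k \<omega> \<le> R \<omega>" .
    qed
  qed (rule fs_int)
  have lim: "\<exists>s. (\<lambda>k. S k \<omega>) \<longlonglongrightarrow> s \<and>
      lam * (indicator G \<omega> * (LINT s:{0<..t}|lborel. ?e f (\<omega> s))) \<le> s"
    and S_le: "\<bar>S k \<omega>\<bar> \<le> C * t" if \<omega>: "\<omega> \<in> paths" for \<omega> k
  proof -
    have "lam * ?e f (\<omega> r) \<le> ?e (L f) (\<omega> r)" if "r \<in> {r. \<omega> r \<in> Some ` U}" for r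
      using that le by (auto simp: at_cemetery_zero_def)
    note sl = stopped_integral_limit[OF continuous_on_path[OF cf \<omega>] continuous_on_path[OF ch \<omega>] \<open>t > 0\<close> \<open>lam > 0\<close>
        this e0 eC, of "{r. \<omega> r \<in> Some ` U}", simplified]
    have "indicator G \<omega> = (of_bool (\<forall>k. \<forall>i\<le>2^k. \<omega> (t * real i / 2^k) \<in> Some ` U) :: real)"
      using \<omega> by (auto simp: G_def indicator_def)
    then show "\<exists>s. (\<lambda>k. S k \<omega>) \<longlonglongrightarrow> s \<and>
      lam * (indicator G \<omega> * (LINT s:{0<..t}|lborel. ?e f (\<omega> s))) \<le> s"
      using sl(1) unfolding S_def[abs_def] by simp
    show "\<bar>S k \<omega>\<bar> \<le> C * t" using sl(2)[of k] unfolding S_def by simp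
  qed
  define Sl where "Sl \<omega> = lim (\<lambda>k. S k \<omega>)" for \<omega> :: "real \<Rightarrow> 'a option"
  have Sl: "(\<lambda>k. S k \<omega>) \<longlonglongrightarrow> Sl \<omega>" "lam * (indicator G \<omega> * (LINT s:{0<..t}|lborel. ?e f (\<omega> s))) \<le> Sl \<omega>"
    if "\<omega> \<in> paths" for \<omega>
    using lim[OF that] unfolding Sl_def by (auto simp: limI)
  have S_meas: "S k \<in> borel_measurable P" for k using S_int by auto
  have Sl_meas: "Sl \<in> borel_measurable P"
    by (rule borel_measurable_LIMSEQ_real[OF _ S_meas]) (use Sl spP in auto)
  have ic: "integrable P (\<lambda>_. C * t)" by simp
  have AE1: "AE \<omega> in P. (\<lambda>k. S k \<omega>) \<longlonglongrightarrow> Sl \<omega>" using Sl spP by auto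
  have AE2: "AE \<omega> in P. norm (S k \<omega>) \<le> C * t" for k using S_le spP by auto
  have Sl_int: "integrable P Sl"
    by (rule integrable_dominated_convergence[OF Sl_meas S_meas ic AE1 AE2])
  have "(\<lambda>k. \<integral>\<omega>. S k \<omega> \<partial>P) \<longlonglongrightarrow> (\<integral>\<omega>. Sl \<omega> \<partial>P)"
    by (rule integral_dominated_convergence[OF Sl_meas S_meas ic AE1 AE2])
  then have "(\<integral>\<omega>. Sl \<omega> \<partial>P) \<le> (\<integral>\<omega>. R \<omega> \<partial>P)"
    using fs_le unfolding ES by (intro LIMSEQ_le_const2) auto
  moreover have "(\<integral>\<omega>. lam * (indicator G \<omega> * (LINT s:{0<..t}|lborel. ?e f (\<omega> s))) \<partial>P) \<le> (\<integral>\<omega>. Sl \<omega> \<partial>P)"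
  proof (rule integral_mono')
    show "0 \<le> Sl \<omega>" if "\<omega> \<in> space P" for \<omega>
    proof -
      have "0 \<le> (LINT s:{0<..t}|lborel. ?e f (\<omega> s))"
        unfolding set_lebesgue_integral_def by (rule Bochner_Integration.integral_nonneg) (simp add: e0)
      then have "0 \<le> lam * (indicator G \<omega> * (LINT s:{0<..t}|lborel. ?e f (\<omega> s)))"
        using \<open>lam > 0\<close> by simp
      then show ?thesis using Sl(2)[of \<omega>] that spP by simp
    qed
  qed (use Sl_int Sl spP in auto)
  moreover have "(\<integral>\<omega>. R \<omega> \<partial>P) = (\<integral>\<omega>. (if \<omega> \<in> G then ?e f (\<omega> t) else B) \<partial>P) - f x"
    unfolding R_def using R_int by (simp add: prob_space)
  ultimately show "lam * (\<integral>\<omega>. indicator G \<omega> * (LINT s:{0<..t}|lborel. ?e f (\<omega> s)) \<partial>P)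
      \<le> (\<integral>\<omega>. (if \<omega> \<in> G then ?e f (\<omega> t) else B) \<partial>P) - f x"
    by simp
qed

text \<open>With time rounded down to a dyadic grid the map takes countably many times and is
  measurable; continuity of the paths passes this to the limit. It prepares the exchange of
  expectation and time integral.\<close>

lemma borel_measurable_path_joint:
  fixes F :: "'a::topological_space option \<Rightarrow> real" and t :: real
  assumes cf: "continuous_map (Alexandroff_compactification euclidean) euclideanreal F"
    and P: "sets P = sets (path_algebra {0..})"
  shows "(\<lambda>(\<omega>, r). indicator {0<..t} r * F (\<omega> r)) \<in> borel_measurable (P \<Otimes>\<^sub>M lborel)"
proof -
  have spP: "space P = paths" using sets_eq_imp_space_eq[OF P] by simp
  have F_meas: "(\<lambda>\<omega>. F (\<omega> s)) \<in> borel_measurable P" if "0 \<le> s" for s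
    using measurable_eval_path[OF cf, of s "{0..}"] that measurable_cong_sets[OF P refl] by auto
  \<comment> \<open>\<open>max 0\<close> makes the rounded time nonnegative for every integer
    \<open>i\<close>, so that each evaluation is measurable; for negative times the indicator
    vanishes anyway. The factors 1 match \<open>dyadic_floor_tendsto\<close> at
    \<open>t = 1\<close>.\<close>
  have m: "(\<lambda>x. indicator {0<..t} (snd x) * F (fst x (max 0 (1 * real_of_int \<lfloor>(snd x :: real) * 2 ^ k / 1\<rfloor> / 2 ^ k))))
      \<in> borel_measurable (P \<Otimes>\<^sub>M lborel)" for k :: nat
  proof (intro borel_measurable_times)
    show "(\<lambda>x. F (fst x (max 0 (1 * real_of_int \<lfloor>(snd x :: real) * 2 ^ k / 1\<rfloor> / 2 ^ k)))) \<in> borel_measurable (P \<Otimes>\<^sub>M lborel)"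
    proof (rule measurable_compose_countable[where f="\<lambda>i x. F (fst x (max 0 (1 * real_of_int i / 2 ^ k)))"
          and g="\<lambda>x. \<lfloor>(snd x :: real) * 2 ^ k / 1\<rfloor>"])
      show "(\<lambda>x. F (fst x (max 0 (1 * real_of_int i / 2 ^ k)))) \<in> borel_measurable (P \<Otimes>\<^sub>M lborel)" for i
        using measurable_compose[OF measurable_fst F_meas, of "max 0 (1 * real_of_int i / 2 ^ k)"] by simp
      show "(\<lambda>x. \<lfloor>(snd x :: real) * 2 ^ k / 1\<rfloor>) \<in> P \<Otimes>\<^sub>M lborel \<rightarrow>\<^sub>M count_space UNIV"
        by measurable
    qed
  qed measurable
  have "(\<lambda>x. indicator {0<..t} (snd x) * F (fst x (snd x))) \<in> borel_measurable (P \<Otimes>\<^sub>M lborel)"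
  proof (rule borel_measurable_LIMSEQ_real)
    fix x :: "(real \<Rightarrow> 'a option) \<times> real" assume "x \<in> space (P \<Otimes>\<^sub>M lborel)"
    then have \<omega>: "fst x \<in> paths" unfolding space_pair_measure spP by (simp add: mem_Times_iff)
    show "(\<lambda>k. indicator {0<..t} (snd x) * F (fst x (max 0 (1 * real_of_int \<lfloor>(snd x :: real) * 2 ^ k / 1\<rfloor> / 2 ^ k))))
      \<longlonglongrightarrow> indicator {0<..t} (snd x) * F (fst x (snd x))"
    proof (cases "0 < snd x")
      case True
      have "(\<lambda>k. max 0 (1 * real_of_int \<lfloor>(snd x :: real) * 2 ^ k / 1\<rfloor> / 2 ^ k)) \<longlonglongrightarrow> max 0 (snd x)"
        by (intro tendsto_max tendsto_const dyadic_floor_tendsto) simp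
      then have "(\<lambda>k. max 0 (1 * real_of_int \<lfloor>(snd x :: real) * 2 ^ k / 1\<rfloor> / 2 ^ k)) \<longlonglongrightarrow> snd x"
        using True by simp
      from continuous_on_tendsto_compose[OF continuous_on_path[OF cf \<omega>] this]
      have "(\<lambda>k. F (fst x (max 0 (1 * real_of_int \<lfloor>(snd x :: real) * 2 ^ k / 1\<rfloor> / 2 ^ k)))) \<longlonglongrightarrow> F (fst x (snd x))"
        using True by simp
      then show ?thesis by (intro tendsto_mult tendsto_const)
    qed simp
  qed (rule m)
  then show ?thesis by (simp add: case_prod_beta)
qed

text \<open>The interval is compact and the path, being alive on it, pulls the sets
  \<open>U n\<close> back to a relatively open cover; as these increase, one index suffices.\<close>

lemma path_exhaustion:
  fixes U :: "nat \<Rightarrow> 'a::topological_space set"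
  assumes "\<omega> \<in> paths" "\<And>s. 0 \<le> s \<Longrightarrow> \<omega> s \<noteq> None"
    and "\<And>n. open (U n)" "\<And>n. U n \<subseteq> U (Suc n)" "(\<Union>n. U n) = UNIV"
  shows "\<exists>N. \<forall>n\<ge>N. \<forall>s\<in>{0..t}. \<omega> s \<in> Some ` U n"
proof -
  define V where "V n = {s\<in>{0..}. \<omega> s \<in> Some ` U n}" for n
  have "openin (top_of_set {0..}) (V n)" for n
  proof -
    have "continuous_map (top_of_set {0..}) (Alexandroff_compactification euclidean) \<omega>"
      using assms(1) by (simp add: paths_def)
    moreover have "openin (Alexandroff_compactification euclidean) (Some ` U n)"
      using assms(3) by simp
    ultimately show ?thesis by (auto simp: V_def continuous_map_def)
  qed
  then obtain W where W: "\<And>n. open (W n)" "\<And>n. V n = {0..} \<inter> W n"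
    unfolding openin_open by metis
  have cover: "{0..t} \<subseteq> (\<Union>n\<in>UNIV. W n)"
  proof
    fix s assume s: "s \<in> {0..t}"
    then obtain p where "\<omega> s = Some p" using assms(2)[of s] by auto
    moreover obtain n where "p \<in> U n" using assms(5) by blast
    ultimately have "s \<in> V n" using s by (simp add: V_def)
    then show "s \<in> (\<Union>n\<in>UNIV. W n)" using W(2)[of n] by auto
  qed
  obtain I where I: "finite I" "{0..t} \<subseteq> (\<Union>n\<in>I. W n)"
    by (rule compactE_image[OF compact_Icc W(1) cover])
  have mono: "U m \<subseteq> U n" if "m \<le> n" for m n
    using lift_Suc_mono_le[of U] assms(4) that by blast
  \<comment> \<open>Inserting 0 keeps \<open>Max\<close> meaningful when \<open>I\<close> is
    empty.\<close>
  have "\<omega> s \<in> Some ` U n" if n: "Max (insert 0 I) \<le> n" and s: "s \<in> {0..t}" for n s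
  proof -
    obtain m where m: "m \<in> I" "s \<in> W m" using I s by blast
    then have "s \<in> V m" using W(2)[of m] s by auto
    then have "\<omega> s \<in> Some ` U m" by (simp add: V_def)
    moreover have "m \<le> n" using m I n by simp
    ultimately show ?thesis using mono by blast
  qed
  then show ?thesis by blast
qed

text \<open>\<open>w\<close> enters through its localisations only: test functions have compact
  support, and \<open>f n\<close> satisfies the differential inequality only where it agrees with
  \<open>w\<close>.\<close>

lemma stochastically_complete_subsolution:
  fixes A :: "('a::topological_space, 'm::finite) chart set" and U :: "nat \<Rightarrow> 'a set"
  assumes sc: "stochastically_complete A L"
    and f: "\<And>n. test_function A (f n)"
    and cf: "\<And>n. continuous_map (Alexandroff_compactification euclidean) euclideanreal (at_cemetery_zero (f n))"
    and ch: "\<And>n. continuous_map (Alexandroff_compactification euclidean) euclideanreal (at_cemetery_zero (L (f n)))"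
    and bd: "\<And>n. \<exists>C. \<forall>p. \<bar>L (f n) p\<bar> \<le> C"
    and f0: "\<And>n p. 0 \<le> f n p" and fB: "\<And>n p. f n p \<le> B"
    and U: "\<And>n. open (U n)" "\<And>n. U n \<subseteq> U (Suc n)" "(\<Union>n. U n) = UNIV"
    and lam: "lam > 0" and le: "\<And>n p. p \<in> U n \<Longrightarrow> lam * f n p \<le> L (f n) p"
    and fw: "\<And>n p. p \<in> U n \<Longrightarrow> f n p = w p"
  shows "w x \<le> 0"
proof -
  let ?e = "at_cemetery_zero"
  obtain P where law: "diffusion_law A L x P" and life: "AE \<omega> in P. lifetime \<omega> = \<infinity>"
    using sc by (auto simp: stochastically_complete_def)
  interpret prob_space P using law by (simp add: diffusion_law_def)
  have setsP: "sets P = sets (path_algebra {0..})" using law by (simp add: diffusion_law_def)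
  have spP: "space P = paths" using sets_eq_imp_space_eq[OF setsP] by simp
  have mono: "U m \<subseteq> U n" if "m \<le> n" for m n
    using lift_Suc_mono_le[of U] U(2) that by blast
  have ev: "\<exists>N. \<forall>n\<ge>N. p \<in> U n" for p
    using U(3) mono by (metis UNIV_I UN_E subsetD)
  have w: "0 \<le> w p" "w p \<le> B" for p
    using ev[of p] f0 fB fw by (metis order_refl)+
  have B: "0 \<le> B" using w[of x] by linarith
  have e0: "0 \<le> ?e (f n) z" "?e (f n) z \<le> B" for n z
    using f0 fB B by (auto simp: at_cemetery_zero_def split: option.split)
  have ew: "0 \<le> ?e w z" "?e w z \<le> B" for z
    using w B by (auto simp: at_cemetery_zero_def split: option.split)
  have lim_e: "(\<lambda>n. ?e (f n) z) \<longlonglongrightarrow> ?e w z" for z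
  proof (cases z)
    case (Some p)
    then show ?thesis using ev[of p] fw
      by (intro tendsto_eventually) (auto simp: eventually_sequentially at_cemetery_zero_def)
  qed (simp add: at_cemetery_zero_def)
  \<comment> \<open>Joint measurability for \<open>w\<close> is inherited from the
    \<open>f n\<close>, which converge to it pointwise, also at the cemetery.\<close>
  have joint_w: "(\<lambda>(\<omega>, r). indicator {0<..t} r * ?e w (\<omega> r)) \<in> borel_measurable (P \<Otimes>\<^sub>M lborel)" for t
    by (rule borel_measurable_LIMSEQ_real[OF _ borel_measurable_path_joint[OF cf setsP]])
       (auto intro!: tendsto_mult lim_e)
  have If_meas: "(\<lambda>\<omega>. LINT s:{0<..t}|lborel. ?e (f n) (\<omega> s)) \<in> borel_measurable P" for n t
    using lborel.borel_measurable_lebesgue_integral[OF borel_measurable_path_joint[OF cf setsP]]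
    by (simp add: set_lebesgue_integral_def)
  have Iw_meas: "(\<lambda>\<omega>. LINT s:{0<..t}|lborel. ?e w (\<omega> s)) \<in> borel_measurable P" for t
    using lborel.borel_measurable_lebesgue_integral[OF joint_w]
    by (simp add: set_lebesgue_integral_def)
  have ef_meas: "(\<lambda>\<omega>. ?e (f n) (\<omega> s)) \<in> borel_measurable P" if "0 \<le> s" for n s
    using measurable_eval_path[OF cf, of s "{0..}"] that measurable_cong_sets[OF setsP refl] by auto
  have ew_meas: "(\<lambda>\<omega>. ?e w (\<omega> s)) \<in> borel_measurable P" if "0 \<le> s" for s
    by (rule borel_measurable_LIMSEQ_real[OF lim_e ef_meas[OF that]])
  have alive: "AE \<omega> in P. \<forall>s\<ge>0. \<omega> s \<noteq> None"
    using life
  proof (rule AE_mp, intro AE_I2 impI allI notI)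
    fix \<omega> :: "real \<Rightarrow> 'a option" and s :: real
    assume "lifetime \<omega> = \<infinity>" "0 \<le> s" "\<omega> s = None"
    then have "Inf (ereal ` {t. 0 \<le> t \<and> \<omega> t = None}) \<le> ereal s" by (intro Inf_lower) auto
    then show False using \<open>lifetime \<omega> = \<infinity>\<close> by (simp add: lifetime_def)
  qed
  have bound: "lam * (\<integral>\<omega>. (LINT s:{0<..t}|lborel. ?e w (\<omega> s)) \<partial>P) \<le> (\<integral>\<omega>. ?e w (\<omega> t) \<partial>P) - w x"
    if "0 < t" for t
  proof -
    define G where "G n = {\<omega>\<in>paths. \<forall>k. \<forall>i\<le>2^k. \<omega> (t * real i / 2^k) \<in> Some ` U n}" for n
    define J where "J n \<omega> = indicator (G n) \<omega> * (LINT s:{0<..t}|lborel. ?e (f n) (\<omega> s))" for n \<omega>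
    define K where "K n \<omega> = (if \<omega> \<in> G n then ?e (f n) (\<omega> t) else B)" for n \<omega>
    have ex: "G n \<in> sets P" "lam * (\<integral>\<omega>. J n \<omega> \<partial>P) \<le> (\<integral>\<omega>. K n \<omega> \<partial>P) - f n x" for n
    proof -
      obtain C where C: "\<And>p. \<bar>L (f n) p\<bar> \<le> C" using bd[of n] by blast
      note exi = exit_inequality[OF law f cf ch f0 fB C U(1)[of n] lam le that If_meas, folded G_def]
      show "G n \<in> sets P" by (rule exi(1))
      show "lam * (\<integral>\<omega>. J n \<omega> \<partial>P) \<le> (\<integral>\<omega>. K n \<omega> \<partial>P) - f n x"
        unfolding J_def K_def by (rule exi(2))
    qed
    \<comment> \<open>For almost every path both the stopping and the localisation become invisible
      from some \<open>n\<close> on; hence \<open>J n\<close> and \<open>K n\<close> are eventually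
      constant along the path.\<close>
    have evG: "AE \<omega> in P. \<exists>N. \<forall>n\<ge>N. \<omega> \<in> G n \<and> (\<forall>s\<in>{0..t}. \<omega> s \<in> Some ` U n)"
      using alive
    proof (rule AE_mp, intro AE_I2 impI)
      fix \<omega> assume "\<omega> \<in> space P" "\<forall>s\<ge>0. \<omega> s \<noteq> None"
      then obtain N where N: "\<forall>n\<ge>N. \<forall>s\<in>{0..t}. \<omega> s \<in> Some ` U n"
        using path_exhaustion[OF _ _ U, of \<omega> t] spP by blast
      have "t * real i / 2^k \<in> {0..t}" if "i \<le> 2^k" for i k
      proof -
        have "real i \<le> 2^k" using that by (metis of_nat_le_numeral_power_cancel_iff)
        then show ?thesis using \<open>0 < t\<close> by (simp add: field_simps)
      qed
      then show "\<exists>N. \<forall>n\<ge>N. \<omega> \<in> G n \<and> (\<forall>s\<in>{0..t}. \<omega> s \<in> Some ` U n)"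
        using N \<open>\<omega> \<in> space P\<close> spP unfolding G_def by blast
    qed
    have fw': "?e (f n) z = ?e w z" if "z \<in> Some ` U n" for n z
      using that fw by (auto simp: at_cemetery_zero_def)
    have J_lim: "AE \<omega> in P. (\<lambda>n. J n \<omega>) \<longlonglongrightarrow> (LINT s:{0<..t}|lborel. ?e w (\<omega> s))"
      using evG
    proof (rule AE_mp, intro AE_I2 impI)
      fix \<omega> assume "\<exists>N. \<forall>n\<ge>N. \<omega> \<in> G n \<and> (\<forall>s\<in>{0..t}. \<omega> s \<in> Some ` U n)"
      then obtain N where N: "\<forall>n\<ge>N. \<omega> \<in> G n \<and> (\<forall>s\<in>{0..t}. \<omega> s \<in> Some ` U n)" by blast
      have "J n \<omega> = (LINT s:{0<..t}|lborel. ?e w (\<omega> s))" if "N \<le> n" for n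
      proof -
        have "(LINT s:{0<..t}|lborel. ?e (f n) (\<omega> s)) = (LINT s:{0<..t}|lborel. ?e w (\<omega> s))"
          by (rule set_lebesgue_integral_cong) (use N that fw' in auto)
        then show ?thesis using N that by (simp add: J_def)
      qed
      then show "(\<lambda>n. J n \<omega>) \<longlonglongrightarrow> (LINT s:{0<..t}|lborel. ?e w (\<omega> s))"
        by (intro tendsto_eventually) (auto simp: eventually_sequentially)
    qed
    have K_lim: "AE \<omega> in P. (\<lambda>n. K n \<omega>) \<longlonglongrightarrow> ?e w (\<omega> t)"
      using evG
    proof (rule AE_mp, intro AE_I2 impI)
      fix \<omega> assume "\<exists>N. \<forall>n\<ge>N. \<omega> \<in> G n \<and> (\<forall>s\<in>{0..t}. \<omega> s \<in> Some ` U n)"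
      then obtain N where N: "\<forall>n\<ge>N. \<omega> \<in> G n \<and> (\<forall>s\<in>{0..t}. \<omega> s \<in> Some ` U n)" by blast
      have "K n \<omega> = ?e w (\<omega> t)" if "N \<le> n" for n
        using N that fw' \<open>0 < t\<close> by (simp add: K_def)
      then show "(\<lambda>n. K n \<omega>) \<longlonglongrightarrow> ?e w (\<omega> t)"
        by (intro tendsto_eventually) (auto simp: eventually_sequentially)
    qed
    have J_meas: "J n \<in> borel_measurable P" for n
      unfolding J_def using ex(1) If_meas by (intro borel_measurable_times borel_measurable_indicator)
    have K_meas: "K n \<in> borel_measurable P" for n
      unfolding K_def using ex(1) ef_meas[of t] \<open>0 < t\<close> by (intro measurable_If_set) auto
    have I_bd: "0 \<le> (LINT s:{0<..t}|lborel. ?e (f n) (\<omega> s))"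
      "(LINT s:{0<..t}|lborel. ?e (f n) (\<omega> s)) \<le> B * t" for n \<omega>
    proof -
      show "0 \<le> (LINT s:{0<..t}|lborel. ?e (f n) (\<omega> s))"
        unfolding set_lebesgue_integral_def
        by (rule Bochner_Integration.integral_nonneg) (simp add: e0)
      have "(LINT s:{0<..t}|lborel. ?e (f n) (\<omega> s)) \<le> (LINT s|lborel. B * indicator {0<..t} s)"
        unfolding set_lebesgue_integral_def
      proof (rule integral_mono')
        show "integrable lborel (\<lambda>s. B * indicator {0<..t} s)"
          using \<open>0 < t\<close> by (intro integrable_mult_right) (auto simp: integrable_indicator_iff)
      qed (use B e0 in \<open>auto simp: indicator_def\<close>)
      then show "(LINT s:{0<..t}|lborel. ?e (f n) (\<omega> s)) \<le> B * t" using \<open>0 < t\<close> by simp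
    qed
    have J_bd: "AE \<omega> in P. norm (J n \<omega>) \<le> B * t" for n
      using I_bd B \<open>0 < t\<close> by (intro AE_I2) (auto simp: J_def indicator_def abs_of_nonneg)
    have K_bd: "AE \<omega> in P. norm (K n \<omega>) \<le> B" for n
      using e0 B by (intro AE_I2) (auto simp: K_def abs_of_nonneg)
    have "(\<lambda>n. \<integral>\<omega>. J n \<omega> \<partial>P) \<longlonglongrightarrow> (\<integral>\<omega>. (LINT s:{0<..t}|lborel. ?e w (\<omega> s)) \<partial>P)"
      by (rule integral_dominated_convergence[OF Iw_meas J_meas _ J_lim J_bd]) simp
    moreover have "(\<lambda>n. \<integral>\<omega>. K n \<omega> \<partial>P) \<longlonglongrightarrow> (\<integral>\<omega>. ?e w (\<omega> t) \<partial>P)"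
      by (rule integral_dominated_convergence[OF ew_meas K_meas _ K_lim K_bd]) (use \<open>0 < t\<close> in auto)
    moreover have "(\<lambda>n. f n x) \<longlonglongrightarrow> w x"
      using lim_e[of "Some x"] by (simp add: at_cemetery_zero_def)
    ultimately show ?thesis
      using ex(2) by (intro LIMSEQ_le[OF tendsto_mult_left tendsto_diff]) auto
  qed
  have I0: "0 \<le> (LINT s:{0<..t}|lborel. ?e w (\<omega> s))" for t \<omega>
    unfolding set_lebesgue_integral_def
    by (rule Bochner_Integration.integral_nonneg) (simp add: ew)
  have lower: "w x \<le> (\<integral>\<omega>. ?e w (\<omega> t) \<partial>P)" if "0 < t" for t
  proof -
    have "0 \<le> lam * (\<integral>\<omega>. (LINT s:{0<..t}|lborel. ?e w (\<omega> s)) \<partial>P)"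
      using lam I0 by (intro mult_nonneg_nonneg Bochner_Integration.integral_nonneg) auto
    then show ?thesis using bound[OF that] by linarith
  qed
  have upper: "(\<integral>\<omega>. ?e w (\<omega> t) \<partial>P) \<le> B" if "0 < t" for t
    using ew ew_meas[of t] that B
    by (intro integral_le_const integrable_const_bound[where B=B]) auto
  \<comment> \<open>After exchanging the integrals the lower bound on the expectation holds at each
    time separately and is integrated over the interval.\<close>
  have Fubini: "t * w x \<le> (\<integral>\<omega>. (LINT s:{0<..t}|lborel. ?e w (\<omega> s)) \<partial>P)" if "0 < t" for t
  proof -
    interpret Q: pair_sigma_finite P lborel ..
    let ?h = "\<lambda>\<omega> r. indicator {0<..t} r * ?e w (\<omega> r)"
    have "integrable (P \<Otimes>\<^sub>M lborel) (\<lambda>(\<omega>, r). ?h \<omega> r)"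
    proof (rule Bochner_Integration.integrable_bound[where f="\<lambda>x. B * indicator (space P \<times> {0<..t}) x"])
      have "emeasure (P \<Otimes>\<^sub>M lborel) (space P \<times> {0<..t}) < \<infinity>"
        using that by (subst lborel.emeasure_pair_measure_Times) (auto simp: emeasure_space_1)
      moreover have "space P \<times> {0<..t} \<in> sets (P \<Otimes>\<^sub>M lborel)" by auto
      ultimately show "integrable (P \<Otimes>\<^sub>M lborel) (\<lambda>x. B * indicator (space P \<times> {0<..t}) x)"
        by (intro integrable_mult_right) (auto simp: integrable_indicator_iff)
      show "(\<lambda>(\<omega>, r). ?h \<omega> r) \<in> borel_measurable (P \<Otimes>\<^sub>M lborel)" by (rule joint_w)
      show "AE x in P \<Otimes>\<^sub>M lborel. norm (case x of (\<omega>, r) \<Rightarrow> ?h \<omega> r) \<le> norm (B * indicator (space P \<times> {0<..t}) x)"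
        using ew B by (intro AE_I2) (auto simp: indicator_def space_pair_measure)
    qed
    note int = this
    have "(\<integral>\<omega>. (LINT s:{0<..t}|lborel. ?e w (\<omega> s)) \<partial>P) = (LINT r|lborel. (\<integral>\<omega>. ?h \<omega> r \<partial>P))"
      using Q.Fubini_integral[OF int] by (simp add: set_lebesgue_integral_def)
    also have "\<dots> \<ge> (LINT r|lborel. w x * indicator {0<..t} r)"
    proof (rule integral_mono)
      show "integrable lborel (\<lambda>r. w x * indicator {0<..t} r)"
        using that by (intro integrable_mult_right) (auto simp: integrable_indicator_iff)
      show "integrable lborel (\<lambda>r. \<integral>\<omega>. ?h \<omega> r \<partial>P)"
        using Q.integrable_snd[OF int] by simp
      show "w x * indicator {0<..t} r \<le> (\<integral>\<omega>. ?h \<omega> r \<partial>P)" for r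
        using lower[of r] by (auto simp: indicator_def)
    qed
    finally show ?thesis using that by (simp add: mult.commute)
  qed
  show ?thesis
  proof (rule ccontr)
    assume "\<not> w x \<le> 0"
    then have wx: "0 < w x" by simp
    \<comment> \<open>Chosen so that \<open>lam * t * w x = B + 1\<close>, above the largest value
      \<open>B - w x\<close> that the bound permits.\<close>
    define t where "t = (B + 1) / (lam * w x)"
    have t: "0 < t" using B lam wx by (simp add: t_def)
    have "lam * (t * w x) \<le> lam * (\<integral>\<omega>. (LINT s:{0<..t}|lborel. ?e w (\<omega> s)) \<partial>P)"
      using Fubini[OF t] lam by (intro mult_left_mono) auto
    also have "\<dots> \<le> B - w x" using bound[OF t] upper[OF t] by linarith
    finally have "lam * (t * w x) \<le> B - w x" .
    moreover have "lam * (t * w x) = B + 1" using lam wx by (simp add: t_def)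
    ultimately show False using wx by linarith
  qed
qed

section \<open>Coordinate invariance of the Laplacian\<close>

text \<open>The contraction of a covariant with a contravariant 2-tensor does not depend on
  coordinates; \<open>J\<close> is the Jacobian. The Laplacian, the energy density and the
  Christoffel term of the Hessian are instances.\<close>

lemma contraction_pullback:
  fixes Gc Gd H J :: "'m::finite \<Rightarrow> 'm \<Rightarrow> real"
  assumes "\<And>a b. (\<Sum>i\<in>UNIV. \<Sum>j\<in>UNIV. Gc i j * (J i a * J j b)) = Gd a b"
  shows "(\<Sum>i\<in>UNIV. \<Sum>j\<in>UNIV. Gc i j * (\<Sum>a\<in>UNIV. \<Sum>b\<in>UNIV. J i a * J j b * H a b)) =
    (\<Sum>a\<in>UNIV. \<Sum>b\<in>UNIV. Gd a b * H a b)"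
proof -
  have "(\<Sum>i\<in>UNIV. \<Sum>j\<in>UNIV. Gc i j * (\<Sum>a\<in>UNIV. \<Sum>b\<in>UNIV. J i a * J j b * H a b)) =
      (\<Sum>i\<in>UNIV. \<Sum>j\<in>UNIV. \<Sum>a\<in>UNIV. \<Sum>b\<in>UNIV. Gc i j * (J i a * J j b) * H a b)"
    by (simp add: sum_distrib_left mult.assoc)
  also have "\<dots> = (\<Sum>i\<in>UNIV. \<Sum>a\<in>UNIV. \<Sum>j\<in>UNIV. \<Sum>b\<in>UNIV. Gc i j * (J i a * J j b) * H a b)"
    by (rule sum.cong[OF refl]) (rule sum.swap)
  also have "\<dots> = (\<Sum>a\<in>UNIV. \<Sum>i\<in>UNIV. \<Sum>j\<in>UNIV. \<Sum>b\<in>UNIV. Gc i j * (J i a * J j b) * H a b)"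
    by (rule sum.swap)
  also have "\<dots> = (\<Sum>a\<in>UNIV. \<Sum>i\<in>UNIV. \<Sum>b\<in>UNIV. \<Sum>j\<in>UNIV. Gc i j * (J i a * J j b) * H a b)"
    by (rule sum.cong[OF refl], rule sum.cong[OF refl], rule sum.swap)
  also have "\<dots> = (\<Sum>a\<in>UNIV. \<Sum>b\<in>UNIV. \<Sum>i\<in>UNIV. \<Sum>j\<in>UNIV. Gc i j * (J i a * J j b) * H a b)"
    by (rule sum.cong[OF refl]) (rule sum.swap)
  also have "\<dots> = (\<Sum>a\<in>UNIV. \<Sum>b\<in>UNIV. Gd a b * H a b)"
    by (simp only: sum_distrib_right[symmetric] assms)
  finally show ?thesis .
qed

lemma half_sum_mult:
  fixes G E :: "'m::finite \<Rightarrow> real"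
  shows "1/2 * (\<Sum>l\<in>UNIV. G l * E l) * X = (\<Sum>l\<in>UNIV. G l * (1/2 * E l * X))"
  by (simp add: sum_distrib_left sum_distrib_right mult_ac)

text \<open>\<open>P\<close> will carry the second derivatives of the transition map,
  \<open>Q\<close> the tensorial part of the transformed Christoffel symbol.\<close>

lemma contraction_split:
  fixes G :: "'m::finite \<Rightarrow> 'm \<Rightarrow> real"
  shows "(\<Sum>a\<in>UNIV. \<Sum>e\<in>UNIV. G a e * (1/2 * F a * (2 * P e + Q e))) =
    (\<Sum>a\<in>UNIV. F a * (\<Sum>e\<in>UNIV. G a e * P e)) + (\<Sum>a\<in>UNIV. F a * (\<Sum>e\<in>UNIV. G a e * (1/2 * Q e)))"
  by (simp add: sum.distrib[symmetric] sum_distrib_left ring_distribs mult_ac)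

section \<open>Linear algebra of the inverse metric\<close>

lemma invertible_pos_def:
  fixes M :: "real^'m^'m"
  assumes "\<And>w. w \<noteq> 0 \<Longrightarrow> w \<bullet> (M *v w) > 0"
  shows "invertible M"
  unfolding invertible_left_inverse matrix_left_invertible_ker
  using assms by (metis inner_zero_right less_irrefl)

lemma matrix_inv_mult:
  assumes "invertible M"
  shows "M ** matrix_inv M = mat 1" "matrix_inv M ** M = mat 1"
  using someI_ex[OF assms[unfolded invertible_def]] unfolding matrix_inv_def by auto

text \<open>Determinants show that \<open>J\<close> is invertible. Cancelling it in
  \<open>matrix_inv Gc ** Gc = mat 1\<close> exhibits the left-hand side as a left inverse of
  \<open>Gd\<close>.\<close>

lemma matrix_inv_cong:
  fixes Gc Gd J :: "real^'m^'m"
  assumes Gc: "Gc = transpose J ** Gd ** J" and inv: "invertible Gc" "invertible Gd"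
  shows "J ** matrix_inv Gc ** transpose J = matrix_inv Gd"
proof -
  have "det Gc = det J * det Gd * det J" by (simp add: Gc det_mul)
  then have "invertible J" using inv by (auto simp: invertible_det_nz)
  then obtain K where K: "J ** K = mat 1" by (auto simp: invertible_def)
  have "matrix_inv Gc ** Gc = mat 1" using inv by (simp add: matrix_inv_mult)
  then have "J ** (matrix_inv Gc ** (transpose J ** Gd ** J)) ** K = J ** K"
    by (simp add: Gc)
  then have "J ** matrix_inv Gc ** transpose J ** Gd ** (J ** K) = J ** K"
    by (simp add: matrix_mul_assoc)
  then have 1: "J ** matrix_inv Gc ** transpose J ** Gd = mat 1" using K by simp
  have 2: "Gd ** matrix_inv Gd = mat 1" using inv by (simp add: matrix_inv_mult)
  have "J ** matrix_inv Gc ** transpose J = J ** matrix_inv Gc ** transpose J ** (Gd ** matrix_inv Gd)"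
    by (simp add: 2)
  also have "\<dots> = matrix_inv Gd"
    by (simp add: matrix_mul_assoc 1)
  finally show ?thesis .
qed

lemma matrix_inv_pullback:
  fixes Gc Gd :: "real^'m^'m" and J :: "'m \<Rightarrow> real^'m"
  assumes "\<And>i j. Gc $ i $ j = (\<Sum>a\<in>UNIV. \<Sum>b\<in>UNIV. J i $ a * J j $ b * Gd $ a $ b)"
    and inv: "invertible Gc" "invertible Gd"
  shows "(\<Sum>i\<in>UNIV. \<Sum>j\<in>UNIV. matrix_inv Gc $ i $ j * (J i $ a * J j $ b)) = matrix_inv Gd $ a $ b"
proof -
  define M where "M = (\<chi> a i. J i $ a)"
  have "Gc = transpose M ** Gd ** M"
    by (simp add: vec_eq_iff assms(1) M_def matrix_matrix_mult_def transpose_def sum_distrib_right)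
       (subst sum.swap, simp add: mult_ac)
  from matrix_inv_cong[OF this inv]
  have "matrix_inv Gd $ a $ b = (M ** matrix_inv Gc ** transpose M) $ a $ b" by simp
  also have "\<dots> = (\<Sum>j\<in>UNIV. \<Sum>i\<in>UNIV. J i $ a * matrix_inv Gc $ i $ j * J j $ b)"
    by (simp add: M_def matrix_matrix_mult_def transpose_def sum_distrib_right)
  also have "\<dots> = (\<Sum>i\<in>UNIV. \<Sum>j\<in>UNIV. matrix_inv Gc $ i $ j * (J i $ a * J j $ b))"
    by (subst sum.swap) (simp add: mult_ac)
  finally show ?thesis by simp
qed

text \<open>Cramer's rule; it makes the entries of the inverse metric visibly continuous in the
  entries of the metric.\<close>

lemma matrix_inv_entry:
  fixes M :: "real^'m^'m"
  assumes "invertible M"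
  shows "matrix_inv M $ i $ j = det (\<chi> a b. if b = i then axis j 1 $ a else M $ a $ b) / det M"
proof -
  have "M ** matrix_inv M = mat 1" using assms by (simp add: matrix_inv_mult)
  then have "M *v (matrix_inv M *v axis j 1) = axis j 1"
    by (simp add: matrix_vector_mul_assoc)
  moreover have "det M \<noteq> 0" using assms by (simp add: invertible_det_nz)
  ultimately have "matrix_inv M *v axis j 1 =
      (\<chi> k. det (\<chi> a b. if b = k then axis j 1 $ a else M $ a $ b) / det M)"
    using cramer by blast
  then have "(matrix_inv M *v axis j 1) $ i = det (\<chi> a b. if b = i then axis j 1 $ a else M $ a $ b) / det M"
    by simp
  then show ?thesis by (simp add: matrix_vector_mul_component matrix_vector_mult_basis column_def)
qed

lemma continuous_on_det:
  fixes M :: "'a::topological_space \<Rightarrow> real^'m^'m"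
  assumes "\<And>i j. continuous_on S (\<lambda>y. M y $ i $ j)"
  shows "continuous_on S (\<lambda>y. det (M y))"
  unfolding det_def by (intro continuous_intros assms)

lemma continuous_on_matrix_inv:
  fixes M :: "'a::topological_space \<Rightarrow> real^'m^'m"
  assumes "\<And>i j. continuous_on S (\<lambda>y. M y $ i $ j)" "\<And>y. y \<in> S \<Longrightarrow> invertible (M y)"
  shows "continuous_on S (\<lambda>y. matrix_inv (M y) $ i $ j)"
proof -
  have "continuous_on S (\<lambda>y. det (\<chi> a b. if b = i then axis j 1 $ a else M y $ a $ b) / det (M y))"
  proof (intro continuous_on_divide continuous_on_det assms(1))
    show "continuous_on S (\<lambda>y. (\<chi> a b. if b = i then axis j 1 $ a else M y $ a $ b) $ k $ l)" for k l
      using assms(1) by (cases "l = i") auto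
  qed (use assms(2) invertible_det_nz in auto)
  then show ?thesis
    using matrix_inv_entry[OF assms(2)] by (subst continuous_on_cong[OF refl]) auto
qed

text \<open>Substituting \<open>w = M *v u\<close> turns the form of the inverse at \<open>w\<close>
  into the form of \<open>M\<close> at \<open>u\<close>.\<close>

lemma matrix_inv_pos_semidef:
  fixes M :: "real^'m^'m"
  assumes sym: "transpose M = M" and pos: "\<And>w. w \<noteq> 0 \<Longrightarrow> w \<bullet> (M *v w) > 0"
  shows "(\<Sum>i\<in>UNIV. \<Sum>j\<in>UNIV. matrix_inv M $ i $ j * (w $ i * w $ j)) \<ge> 0"
proof -
  have inv: "invertible M" by (rule invertible_pos_def) (rule pos)
  define u where "u = matrix_inv M *v w"
  have "M ** matrix_inv M = mat 1" using inv by (simp add: matrix_inv_mult)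
  then have w: "w = M *v u" by (simp add: u_def matrix_vector_mul_assoc)
  have "(\<Sum>i\<in>UNIV. \<Sum>j\<in>UNIV. matrix_inv M $ i $ j * (w $ i * w $ j)) = w \<bullet> u"
    by (simp add: u_def inner_vec_def matrix_vector_mult_def sum_distrib_left mult_ac)
  also have "\<dots> = u \<bullet> (M *v u)" using w by (simp add: inner_commute)
  also have "\<dots> \<ge> 0" using pos[of u] by (cases "u = 0") auto
  finally show ?thesis .
qed

section \<open>Charts, overlaps and the transformation of Christoffel symbols and Hessian\<close>

lemma chart_props:
  assumes "is_chart c"
  shows "open (chart_dom c)" "open (chart_image c)"
    "continuous_on (chart_dom c) (chart_map c)" "continuous_on (chart_image c) (chart_inv c)"
    "\<And>p. p \<in> chart_dom c \<Longrightarrow> chart_inv c (chart_map c p) = p"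
    "\<And>p. p \<in> chart_dom c \<Longrightarrow> chart_map c p \<in> chart_image c"
    "\<And>y. y \<in> chart_image c \<Longrightarrow> chart_map c (chart_inv c y) = y"
    "\<And>y. y \<in> chart_image c \<Longrightarrow> chart_inv c y \<in> chart_dom c"
  using assms unfolding is_chart_def homeomorphism_def by auto

lemma open_chart_map_image:
  assumes "is_chart c" "open N" "N \<subseteq> chart_dom c"
  shows "open (chart_map c ` N)"
proof -
  note C = chart_props[OF assms(1)]
  have "chart_map c ` N = chart_image c \<inter> chart_inv c -` N"
  proof (intro equalityI subsetI)
    fix y assume "y \<in> chart_image c \<inter> chart_inv c -` N"
    then show "y \<in> chart_map c ` N" using C(7)[of y] by (auto intro!: image_eqI[of y _ "chart_inv c y"])
  qed (use assms(3) C in auto)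
  then show ?thesis using continuous_open_preimage[OF C(4,2) assms(2)] by simp
qed

locale riemannian =
  fixes A :: "('a::{t2_space,second_countable_topology}, 'm::finite) chart set"
    and g :: "('a, 'm) metric_field"
  assumes manifold: "riemannian_manifold A g"
begin

lemma chart: "c \<in> A \<Longrightarrow> is_chart c"
  using manifold by (simp add: riemannian_manifold_def smooth_atlas_def)

lemmas chart_simps = chart_props[OF chart]

lemma chart_at: "chart_at A p \<in> A" "p \<in> chart_dom (chart_at A p)"
proof -
  have "\<exists>c. c \<in> A \<and> p \<in> chart_dom c"
    using manifold unfolding riemannian_manifold_def smooth_atlas_def by blast
  then have "chart_at A p \<in> A \<and> p \<in> chart_dom (chart_at A p)"
    unfolding chart_at_def by (rule someI_ex)
  then show "chart_at A p \<in> A" "p \<in> chart_dom (chart_at A p)" by auto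
qed

lemma metric_props:
  assumes "c \<in> A" "y \<in> chart_image c"
  shows "transpose (g c y) = g c y" "\<And>w. w \<noteq> 0 \<Longrightarrow> w \<bullet> (g c y *v w) > 0" "invertible (g c y)"
    "g c y $ i $ j = g c y $ j $ i"
proof -
  show s: "transpose (g c y) = g c y" and p: "\<And>w. w \<noteq> 0 \<Longrightarrow> w \<bullet> (g c y *v w) > 0"
    using manifold assms by (auto simp: riemannian_manifold_def riemannian_metric_def)
  show "invertible (g c y)" by (rule invertible_pos_def) (rule p)
  show "g c y $ i $ j = g c y $ j $ i" using s by (metis transpose_def vec_lambda_beta)
qed

lemma Ck_on_metric:
  assumes "c \<in> A"
  shows "Ck_on k (\<lambda>y. g c y $ i $ j) (chart_image c)"
proof -
  have "Ck_on k (g c) (chart_image c)"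
    using manifold assms unfolding riemannian_manifold_def riemannian_metric_def smooth_on_def by blast
  then have "Ck_on k (\<lambda>y. g c y $ i) (chart_image c)"
    by (rule Ck_on_bounded_linear[OF bounded_linear_vec_nth chart_simps(2)[OF assms]])
  then show ?thesis
    by (rule Ck_on_bounded_linear[OF bounded_linear_vec_nth chart_simps(2)[OF assms]])
qed

lemma Ck_on_transition:
  assumes "c \<in> A" "d \<in> A"
  shows "Ck_on k (transition c d) (chart_map c ` (chart_dom c \<inter> chart_dom d))"
  using manifold assms by (auto simp: riemannian_manifold_def smooth_atlas_def smooth_on_def)

lemma open_overlap:
  assumes "c \<in> A" "d \<in> A"
  shows "open (chart_map c ` (chart_dom c \<inter> chart_dom d))"
  using assms by (intro open_chart_map_image chart open_Int chart_simps) auto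

lemma transition_overlap:
  assumes "c \<in> A" "d \<in> A"
  shows "transition c d ` (chart_map c ` (chart_dom c \<inter> chart_dom d)) \<subseteq> chart_image d"
    "\<And>p. p \<in> chart_dom c \<inter> chart_dom d \<Longrightarrow> transition c d (chart_map c p) = chart_map d p"
    "\<And>y. y \<in> chart_map c ` (chart_dom c \<inter> chart_dom d) \<Longrightarrow>
      (f \<circ> chart_inv c) y = (f \<circ> chart_inv d) (transition c d y)"
  using chart_simps(5,6)[OF assms(1)] chart_simps(5,6)[OF assms(2)] by (auto simp: transition_def)

lemma metric_transformation:
  assumes "c \<in> A" "d \<in> A" "y \<in> chart_map c ` (chart_dom c \<inter> chart_dom d)"
  shows "g c y $ i $ j = (\<Sum>a\<in>UNIV. \<Sum>b\<in>UNIV.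
     partial i (transition c d) y $ a * partial j (transition c d) y $ b * g d (transition c d y) $ a $ b)"
proof -
  obtain p where p: "p \<in> chart_dom c \<inter> chart_dom d" "y = chart_map c p" using assms(3) by blast
  have law: "\<forall>p\<in>chart_dom c \<inter> chart_dom d. \<forall>i j. g c (chart_map c p) $ i $ j =
      (\<Sum>a\<in>UNIV. \<Sum>b\<in>UNIV. partial i (transition c d) (chart_map c p) $ a *
        partial j (transition c d) (chart_map c p) $ b * g d (chart_map d p) $ a $ b)"
    using manifold assms(1,2) unfolding riemannian_manifold_def riemannian_metric_def by blast
  show ?thesis
    unfolding p(2) transition_overlap(2)[OF assms(1,2) p(1)] using bspec[OF law p(1)] by blast
qed

text \<open>Twice the Christoffel symbol of the first kind.\<close>

definition bracket :: "('a, 'm) chart \<Rightarrow> real^'m \<Rightarrow> 'm \<Rightarrow> 'm \<Rightarrow> 'm \<Rightarrow> real" where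
  "bracket c y l i j = partial i (\<lambda>z. g c z $ j $ l) y + partial j (\<lambda>z. g c z $ i $ l) y
     - partial l (\<lambda>z. g c z $ i $ j) y"

lemma christoffel_bracket:
  "christoffel g c y k i j = 1/2 * (\<Sum>l\<in>UNIV. matrix_inv (g c y) $ k $ l * bracket c y l i j)"
  by (simp add: christoffel_def bracket_def)

text \<open>Product rule in the transformation law. The first two sums are deliberately brought to
  one shape, differing by exchange of \<open>j\<close> and \<open>l\<close>, which prepares the
  cancellation in \<open>bracket_transformation\<close>.\<close>

lemma partial_metric_transformation:
  assumes "c \<in> A" "d \<in> A" and y: "y \<in> chart_map c ` (chart_dom c \<inter> chart_dom d)"
  defines "\<psi> \<equiv> transition c d"
  shows "partial i (\<lambda>z. g c z $ j $ l) y =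
    (\<Sum>a\<in>UNIV. \<Sum>b\<in>UNIV. partial i (partial j \<psi>) y $ a * partial l \<psi> y $ b * g d (\<psi> y) $ a $ b) +
    (\<Sum>a\<in>UNIV. \<Sum>b\<in>UNIV. partial i (partial l \<psi>) y $ a * partial j \<psi> y $ b * g d (\<psi> y) $ a $ b) +
    (\<Sum>e\<in>UNIV. \<Sum>a\<in>UNIV. \<Sum>b\<in>UNIV. partial i \<psi> y $ e * partial j \<psi> y $ a * partial l \<psi> y $ b *
       partial e (\<lambda>z. g d z $ a $ b) (\<psi> y))"
proof -
  let ?W = "chart_map c ` (chart_dom c \<inter> chart_dom d)"
  have W: "open ?W" using open_overlap assms by blast
  note C = Ck_on_2_imp[OF Ck_on_transition[OF assms(1,2), of 2], folded \<psi>_def]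
  have \<psi>y: "\<psi> y \<in> chart_image d" using transition_overlap(1)[OF assms(1,2)] y by (auto simp: \<psi>_def)
  have dpsi: "((\<lambda>z. partial k \<psi> z $ a) has_derivative (\<lambda>w. (\<Sum>i\<in>UNIV. w $ i *\<^sub>R partial i (partial k \<psi>) y) $ a)) (at y)" for k a
    by (rule bounded_linear.has_derivative[OF bounded_linear_vec_nth has_derivative_partial]) (use C(5) y in auto)
  have dg: "((\<lambda>z. g d (\<psi> z) $ a $ b) has_derivative
      (\<lambda>w. \<Sum>e\<in>UNIV. (\<Sum>i\<in>UNIV. w $ i *\<^sub>R partial i \<psi> y) $ e *\<^sub>R partial e (\<lambda>z. g d z $ a $ b) (\<psi> y))) (at y)" for a b
    by (rule has_derivative_comp_partial[where G="\<lambda>z. g d z $ a $ b"])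
       (use C(4) y Ck_on_2_imp(4)[OF Ck_on_metric[OF assms(2)] \<psi>y] in auto)
  have D: "((\<lambda>z. \<Sum>a\<in>UNIV. \<Sum>b\<in>UNIV. partial j \<psi> z $ a * partial l \<psi> z $ b * g d (\<psi> z) $ a $ b) has_derivative
    (\<lambda>w. \<Sum>a\<in>UNIV. \<Sum>b\<in>UNIV. partial j \<psi> y $ a * partial l \<psi> y $ b *
       (\<Sum>e\<in>UNIV. (\<Sum>i\<in>UNIV. w $ i *\<^sub>R partial i \<psi> y) $ e *\<^sub>R partial e (\<lambda>z. g d z $ a $ b) (\<psi> y)) +
      (partial j \<psi> y $ a * (\<Sum>i\<in>UNIV. w $ i *\<^sub>R partial i (partial l \<psi>) y) $ b +
       (\<Sum>i\<in>UNIV. w $ i *\<^sub>R partial i (partial j \<psi>) y) $ a * partial l \<psi> y $ b) * g d (\<psi> y) $ a $ b)) (at y)"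
    by (intro has_derivative_sum has_derivative_mult dpsi dg)
  have "partial i (\<lambda>z. g c z $ j $ l) y =
      partial i (\<lambda>z. \<Sum>a\<in>UNIV. \<Sum>b\<in>UNIV. partial j \<psi> z $ a * partial l \<psi> z $ b * g d (\<psi> z) $ a $ b) y"
    using metric_transformation[OF assms(1,2)] unfolding \<psi>_def by (intro partial_cong[OF W y]) auto
  also have "\<dots> = (\<Sum>a\<in>UNIV. \<Sum>b\<in>UNIV. partial j \<psi> y $ a * partial l \<psi> y $ b *
       (\<Sum>e\<in>UNIV. partial i \<psi> y $ e * partial e (\<lambda>z. g d z $ a $ b) (\<psi> y)) +
      (partial j \<psi> y $ a * partial i (partial l \<psi>) y $ b +
       partial i (partial j \<psi>) y $ a * partial l \<psi> y $ b) * g d (\<psi> y) $ a $ b)"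
    using partial_eqI[OF D, of i] by (simp only: sum_axis_scaleR) simp
  also have "\<dots> = (\<Sum>a\<in>UNIV. \<Sum>b\<in>UNIV. partial i (partial j \<psi>) y $ a * partial l \<psi> y $ b * g d (\<psi> y) $ a $ b) +
    (\<Sum>a\<in>UNIV. \<Sum>b\<in>UNIV. partial j \<psi> y $ a * partial i (partial l \<psi>) y $ b * g d (\<psi> y) $ a $ b) +
    (\<Sum>a\<in>UNIV. \<Sum>b\<in>UNIV. \<Sum>e\<in>UNIV. partial i \<psi> y $ e * partial j \<psi> y $ a * partial l \<psi> y $ b *
       partial e (\<lambda>z. g d z $ a $ b) (\<psi> y))"
    by (simp add: sum.distrib sum_distrib_left algebra_simps)
  \<comment> \<open>Renaming the summation indices and using the symmetry of
    \<open>g d\<close>.\<close>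
  also have "(\<Sum>a\<in>UNIV. \<Sum>b\<in>UNIV. partial j \<psi> y $ a * partial i (partial l \<psi>) y $ b * g d (\<psi> y) $ a $ b) =
      (\<Sum>a\<in>UNIV. \<Sum>b\<in>UNIV. partial i (partial l \<psi>) y $ a * partial j \<psi> y $ b * g d (\<psi> y) $ a $ b)"
  proof (subst sum.swap, intro sum.cong[OF refl])
    fix a b
    show "partial j \<psi> y $ b * partial i (partial l \<psi>) y $ a * g d (\<psi> y) $ b $ a =
      partial i (partial l \<psi>) y $ a * partial j \<psi> y $ b * g d (\<psi> y) $ a $ b"
      using metric_props(4)[OF assms(2) \<psi>y, of a b] by simp
  qed
  also have "(\<Sum>a\<in>UNIV. \<Sum>b\<in>UNIV. \<Sum>e\<in>UNIV. partial i \<psi> y $ e * partial j \<psi> y $ a * partial l \<psi> y $ b *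
       partial e (\<lambda>z. g d z $ a $ b) (\<psi> y)) = 
      (\<Sum>e\<in>UNIV. \<Sum>a\<in>UNIV. \<Sum>b\<in>UNIV. partial i \<psi> y $ e * partial j \<psi> y $ a * partial l \<psi> y $ b *
       partial e (\<lambda>z. g d z $ a $ b) (\<psi> y))" (is "(\<Sum>a\<in>UNIV. \<Sum>b\<in>UNIV. \<Sum>e\<in>UNIV. ?t a b e) = _")
  proof -
    have "(\<Sum>a\<in>UNIV. \<Sum>b\<in>UNIV. \<Sum>e\<in>UNIV. ?t a b e) = (\<Sum>a\<in>UNIV. \<Sum>e\<in>UNIV. \<Sum>b\<in>UNIV. ?t a b e)"
      by (rule sum.cong[OF refl]) (rule sum.swap)
    also have "\<dots> = (\<Sum>e\<in>UNIV. \<Sum>a\<in>UNIV. \<Sum>b\<in>UNIV. ?t a b e)" by (rule sum.swap)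
    finally show ?thesis .
  qed
  finally show ?thesis .
qed

text \<open>Second derivatives of the transition map commute, so \<open>T\<close> is symmetric in
  its first two indices. Of the six \<open>T\<close> terms in the alternating combination four
  cancel and two coincide.\<close>

lemma bracket_transformation:
  assumes "c \<in> A" "d \<in> A" and y: "y \<in> chart_map c ` (chart_dom c \<inter> chart_dom d)"
  defines "\<psi> \<equiv> transition c d"
  shows "bracket c y l i j = (\<Sum>e\<in>UNIV. partial l \<psi> y $ e *
    (2 * (\<Sum>a\<in>UNIV. partial i (partial j \<psi>) y $ a * g d (\<psi> y) $ a $ e) +
     (\<Sum>a\<in>UNIV. \<Sum>b\<in>UNIV. partial i \<psi> y $ a * partial j \<psi> y $ b * bracket d (\<psi> y) e a b)))"
proof -
  define T where "T i j l = (\<Sum>a\<in>UNIV. \<Sum>b\<in>UNIV. partial i (partial j \<psi>) y $ a * partial l \<psi> y $ b * g d (\<psi> y) $ a $ b)" for i j l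
  define R where "R i j l = (\<Sum>e\<in>UNIV. \<Sum>a\<in>UNIV. \<Sum>b\<in>UNIV. partial i \<psi> y $ e * partial j \<psi> y $ a * partial l \<psi> y $ b *
       partial e (\<lambda>z. g d z $ a $ b) (\<psi> y))" for i j l
  have p: "partial i (\<lambda>z. g c z $ j $ l) y = T i j l + T i l j + R i j l" for i j l
    using partial_metric_transformation[OF assms(1-3)] by (simp add: T_def R_def \<psi>_def)
  have Tsym: "T i j l = T j i l" for i j l
    using partial_commute[OF open_overlap[OF assms(1,2)] y Ck_on_transition[OF assms(1,2)], of i j]
    by (simp add: T_def \<psi>_def)
  have "bracket c y l i j = 2 * T i j l + (R i j l + R j i l - R l i j)"
    unfolding bracket_def p using Tsym[of i j l] Tsym[of i l j] Tsym[of j l i] by simp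
  moreover have "T i j l = (\<Sum>e\<in>UNIV. partial l \<psi> y $ e * (\<Sum>a\<in>UNIV. partial i (partial j \<psi>) y $ a * g d (\<psi> y) $ a $ e))"
    unfolding T_def by (subst sum.swap) (simp add: sum_distrib_left mult_ac)
  moreover have "R i j l + R j i l - R l i j = (\<Sum>e\<in>UNIV. partial l \<psi> y $ e *
     (\<Sum>a\<in>UNIV. \<Sum>b\<in>UNIV. partial i \<psi> y $ a * partial j \<psi> y $ b * bracket d (\<psi> y) e a b))"
  proof -
    define t where "t a b e = partial i \<psi> y $ a * partial j \<psi> y $ b * partial l \<psi> y $ e" for a b e
    define D where "D e a b = partial e (\<lambda>z. g d z $ a $ b) (\<psi> y)" for e a b
    have "R i j l = (\<Sum>a\<in>UNIV. \<Sum>b\<in>UNIV. \<Sum>e\<in>UNIV. t a b e * D a b e)"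
      by (simp add: R_def t_def D_def mult_ac)
    moreover have "R j i l = (\<Sum>a\<in>UNIV. \<Sum>b\<in>UNIV. \<Sum>e\<in>UNIV. t a b e * D b a e)"
      unfolding R_def t_def D_def by (subst sum.swap) (simp add: mult_ac)
    moreover have "R l i j = (\<Sum>a\<in>UNIV. \<Sum>b\<in>UNIV. \<Sum>e\<in>UNIV. t a b e * D e a b)"
    proof -
      have "R l i j = (\<Sum>e\<in>UNIV. \<Sum>a\<in>UNIV. \<Sum>b\<in>UNIV. t a b e * D e a b)"
        by (simp add: R_def t_def D_def mult_ac)
      also have "\<dots> = (\<Sum>a\<in>UNIV. \<Sum>e\<in>UNIV. \<Sum>b\<in>UNIV. t a b e * D e a b)" by (rule sum.swap)
      also have "\<dots> = (\<Sum>a\<in>UNIV. \<Sum>b\<in>UNIV. \<Sum>e\<in>UNIV. t a b e * D e a b)"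
        by (rule sum.cong[OF refl]) (rule sum.swap)
      finally show ?thesis .
    qed
    ultimately have "R i j l + R j i l - R l i j = (\<Sum>a\<in>UNIV. \<Sum>b\<in>UNIV. \<Sum>e\<in>UNIV. t a b e * bracket d (\<psi> y) e a b)"
      by (simp add: bracket_def D_def[symmetric] sum.distrib sum_subtractf ring_distribs)
    also have "\<dots> = (\<Sum>a\<in>UNIV. \<Sum>e\<in>UNIV. \<Sum>b\<in>UNIV. t a b e * bracket d (\<psi> y) e a b)"
      by (rule sum.cong[OF refl]) (rule sum.swap)
    also have "\<dots> = (\<Sum>e\<in>UNIV. \<Sum>a\<in>UNIV. \<Sum>b\<in>UNIV. t a b e * bracket d (\<psi> y) e a b)"
      by (rule sum.swap)
    finally show ?thesis by (simp add: t_def sum_distrib_left mult_ac)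
  qed
  ultimately show ?thesis
    by (simp add: sum.distrib sum_distrib_left ring_distribs mult_ac)
qed

text \<open>Second coordinate derivatives are not tensorial: they leave the extra sum of
  \<open>S a * Fp a\<close>. The Christoffel term leaves the same sum, and the difference is a
  tensor.\<close>

lemma hessian_transformation:
  fixes f :: "'a \<Rightarrow> real"
  assumes "c \<in> A" "d \<in> A" and y: "y \<in> chart_map c ` (chart_dom c \<inter> chart_dom d)" and f: "C2_map A f"
  defines "\<psi> \<equiv> transition c d"
  shows "hessian g f c y i j = (\<Sum>a\<in>UNIV. \<Sum>b\<in>UNIV. partial i \<psi> y $ a * partial j \<psi> y $ b * hessian g f d (\<psi> y) a b)"
proof -
  let ?W = "chart_map c ` (chart_dom c \<inter> chart_dom d)"
  define F where "F = f \<circ> chart_inv d"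
  have W: "open ?W" using open_overlap assms by blast
  note C = Ck_on_2_imp[OF Ck_on_transition[OF assms(1,2), of 2], folded \<psi>_def]
  have \<psi>W: "\<psi> z \<in> chart_image d" if "z \<in> ?W" for z
    using transition_overlap(1)[OF assms(1,2)] that by (auto simp: \<psi>_def)
  have yc: "y \<in> chart_image c" using y chart_simps(6)[OF assms(1)] by auto
  have "Ck_on 2 F (chart_image d)" using f assms(2) by (auto simp: C2_map_def F_def)
  note CF = Ck_on_2_imp[OF this]
  define J where "J i a = partial i \<psi> y $ a" for i a
  define S where "S a = partial i (partial j \<psi>) y $ a" for a
  define Gd where "Gd a b = matrix_inv (g d (\<psi> y)) $ a $ b" for a b
  define Fp where "Fp a = partial a F (\<psi> y)" for a
  have p1: "partial k (f \<circ> chart_inv c) z = (\<Sum>a\<in>UNIV. partial k \<psi> z $ a * partial a F (\<psi> z))" if "z \<in> ?W" for k z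
  proof -
    have "partial k (f \<circ> chart_inv c) z = partial k (\<lambda>z. F (\<psi> z)) z"
      by (rule partial_cong[OF W that]) (simp add: transition_overlap(3)[OF assms(1,2)] F_def \<psi>_def del: o_apply)
    also have "\<dots> = (\<Sum>a\<in>UNIV. partial k \<psi> z $ a * partial a F (\<psi> z))"
      using partial_comp[of \<psi> z F k] C(4) CF(4) \<psi>W that by simp
    finally show ?thesis .
  qed
  have dpsi: "((\<lambda>z. partial j \<psi> z $ a) has_derivative (\<lambda>w. (\<Sum>i\<in>UNIV. w $ i *\<^sub>R partial i (partial j \<psi>) y) $ a)) (at y)" for a
    by (rule bounded_linear.has_derivative[OF bounded_linear_vec_nth has_derivative_partial]) (use C(5) y in auto)
  have dF: "((\<lambda>z. partial a F (\<psi> z)) has_derivative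
      (\<lambda>w. \<Sum>e\<in>UNIV. (\<Sum>i\<in>UNIV. w $ i *\<^sub>R partial i \<psi> y) $ e *\<^sub>R partial e (partial a F) (\<psi> y))) (at y)" for a
    by (rule has_derivative_comp_partial[where G="partial a F"]) (use C(4) CF(5) \<psi>W y in auto)
  have D: "((\<lambda>z. \<Sum>a\<in>UNIV. partial j \<psi> z $ a * partial a F (\<psi> z)) has_derivative
     (\<lambda>w. \<Sum>a\<in>UNIV. partial j \<psi> y $ a * (\<Sum>e\<in>UNIV. (\<Sum>i\<in>UNIV. w $ i *\<^sub>R partial i \<psi> y) $ e *\<^sub>R partial e (partial a F) (\<psi> y))
       + (\<Sum>i\<in>UNIV. w $ i *\<^sub>R partial i (partial j \<psi>) y) $ a * partial a F (\<psi> y))) (at y)"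
    by (intro has_derivative_sum has_derivative_mult dpsi dF)
  have "partial i (partial j (f \<circ> chart_inv c)) y = partial i (\<lambda>z. \<Sum>a\<in>UNIV. partial j \<psi> z $ a * partial a F (\<psi> z)) y"
    by (rule partial_cong[OF W y]) (rule p1)
  also have "\<dots> = (\<Sum>a\<in>UNIV. J j a * (\<Sum>e\<in>UNIV. J i e * partial e (partial a F) (\<psi> y)) + S a * Fp a)"
    using partial_eqI[OF D, of i] by (simp only: sum_axis_scaleR) (simp add: J_def S_def Fp_def)
  also have "\<dots> = (\<Sum>a\<in>UNIV. \<Sum>b\<in>UNIV. J i a * J j b * partial a (partial b F) (\<psi> y)) + (\<Sum>a\<in>UNIV. S a * Fp a)"
    by (subst sum.swap) (simp add: sum.distrib sum_distrib_left mult_ac)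
  finally have second: "partial i (partial j (f \<circ> chart_inv c)) y =
    (\<Sum>a\<in>UNIV. \<Sum>b\<in>UNIV. J i a * J j b * partial a (partial b F) (\<psi> y)) + (\<Sum>a\<in>UNIV. S a * Fp a)" .
  \<comment> \<open>The metric appears with transposed indices, as it does in the transformed
    bracket; its symmetry reduces this to the inverse matrix identity.\<close>
  have GdG: "(\<Sum>e\<in>UNIV. Gd a e * g d (\<psi> y) $ b $ e) = (if a = b then 1 else 0)" for a b
  proof -
    have "matrix_inv (g d (\<psi> y)) ** g d (\<psi> y) = mat 1"
      using metric_props(3)[OF assms(2) \<psi>W[OF y]] by (simp add: matrix_inv_mult)
    then have "(matrix_inv (g d (\<psi> y)) ** g d (\<psi> y)) $ a $ b = (if a = b then 1 else 0)"
      by (simp add: mat_def)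
    then show ?thesis
      using metric_props(4)[OF assms(2) \<psi>W[OF y], of b] by (simp add: matrix_matrix_mult_def Gd_def)
  qed
  have inv: "(\<Sum>i\<in>UNIV. \<Sum>j\<in>UNIV. matrix_inv (g c y) $ i $ j * (J i a * J j b)) = Gd a b" for a b
    unfolding J_def Gd_def
    by (rule matrix_inv_pullback)
       (use metric_transformation[OF assms(1,2) y] metric_props(3) assms(1,2) yc \<psi>W[OF y] in \<open>auto simp: \<psi>_def\<close>)
  \<comment> \<open>Twice the bracket of \<open>c\<close> is the Jacobian applied to a covector in
    the free index; contraction with the inverse metric then moves it to the chart
    \<open>d\<close>.\<close>
  define V where "V e = 2 * (\<Sum>a\<in>UNIV. S a * g d (\<psi> y) $ a $ e) +
     (\<Sum>a\<in>UNIV. \<Sum>b\<in>UNIV. J i a * J j b * bracket d (\<psi> y) e a b)" for e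
  have br: "bracket c y l i j = (\<Sum>e\<in>UNIV. J l e * V e)" for l
    using bracket_transformation[OF assms(1-3), of l i j] by (simp add: V_def J_def S_def \<psi>_def)
  have "(\<Sum>k\<in>UNIV. christoffel g c y k i j * partial k (f \<circ> chart_inv c) y) =
      (\<Sum>k\<in>UNIV. \<Sum>l\<in>UNIV. matrix_inv (g c y) $ k $ l * (\<Sum>a\<in>UNIV. \<Sum>e\<in>UNIV. J k a * J l e * (1/2 * Fp a * V e)))"
  proof (rule sum.cong[OF refl])
    fix k
    have "christoffel g c y k i j * partial k (f \<circ> chart_inv c) y =
        (\<Sum>l\<in>UNIV. matrix_inv (g c y) $ k $ l * (1/2 * (\<Sum>e\<in>UNIV. J l e * V e) * (\<Sum>a\<in>UNIV. J k a * Fp a)))"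
      unfolding christoffel_bracket br p1[OF y] J_def[symmetric] Fp_def[symmetric]
      by (rule half_sum_mult)
    also have "\<dots> = (\<Sum>l\<in>UNIV. matrix_inv (g c y) $ k $ l * (\<Sum>a\<in>UNIV. \<Sum>e\<in>UNIV. J k a * J l e * (1/2 * Fp a * V e)))"
    proof (rule sum.cong[OF refl])
      fix l
      have "1/2 * (\<Sum>e\<in>UNIV. J l e * V e) * (\<Sum>a\<in>UNIV. J k a * Fp a) = 1/2 * ((\<Sum>a\<in>UNIV. J k a * Fp a) * (\<Sum>e\<in>UNIV. J l e * V e))"
        by simp
      also have "\<dots> = (\<Sum>a\<in>UNIV. \<Sum>e\<in>UNIV. J k a * J l e * (1/2 * Fp a * V e))"
        by (subst sum_product) (simp add: sum_distrib_left mult_ac)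
      finally show "matrix_inv (g c y) $ k $ l * (1/2 * (\<Sum>e\<in>UNIV. J l e * V e) * (\<Sum>a\<in>UNIV. J k a * Fp a)) =
          matrix_inv (g c y) $ k $ l * (\<Sum>a\<in>UNIV. \<Sum>e\<in>UNIV. J k a * J l e * (1/2 * Fp a * V e))"
        by simp
    qed
    finally show "christoffel g c y k i j * partial k (f \<circ> chart_inv c) y = 
      (\<Sum>l\<in>UNIV. matrix_inv (g c y) $ k $ l * (\<Sum>a\<in>UNIV. \<Sum>e\<in>UNIV. J k a * J l e * (1/2 * Fp a * V e)))" .
  qed
  also have "\<dots> = (\<Sum>a\<in>UNIV. \<Sum>e\<in>UNIV. Gd a e * (1/2 * Fp a * V e))"
    by (rule contraction_pullback) (rule inv)
  also have "\<dots> = (\<Sum>k\<in>UNIV. Fp k * (\<Sum>e\<in>UNIV. Gd k e * (\<Sum>a\<in>UNIV. S a * g d (\<psi> y) $ a $ e))) +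
      (\<Sum>k\<in>UNIV. Fp k * (\<Sum>e\<in>UNIV. Gd k e * (1/2 * (\<Sum>a\<in>UNIV. \<Sum>b\<in>UNIV. J i a * J j b * bracket d (\<psi> y) e a b))))"
    unfolding V_def by (rule contraction_split)
  also have "(\<Sum>k\<in>UNIV. Fp k * (\<Sum>e\<in>UNIV. Gd k e * (\<Sum>a\<in>UNIV. S a * g d (\<psi> y) $ a $ e))) = (\<Sum>a\<in>UNIV. S a * Fp a)"
  proof (rule sum.cong[OF refl])
    fix k
    have "(\<Sum>e\<in>UNIV. Gd k e * (\<Sum>a\<in>UNIV. S a * g d (\<psi> y) $ a $ e)) = (\<Sum>e\<in>UNIV. \<Sum>a\<in>UNIV. S a * (Gd k e * g d (\<psi> y) $ a $ e))"
      by (simp add: sum_distrib_left mult_ac)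
    also have "\<dots> = (\<Sum>a\<in>UNIV. S a * (\<Sum>e\<in>UNIV. Gd k e * g d (\<psi> y) $ a $ e))"
      by (subst sum.swap) (simp add: sum_distrib_left)
    also have "\<dots> = (\<Sum>a\<in>UNIV. if k = a then S a else 0)"
      unfolding GdG by (intro sum.cong) auto
    also have "\<dots> = S k" by simp
    finally show "Fp k * (\<Sum>e\<in>UNIV. Gd k e * (\<Sum>a\<in>UNIV. S a * g d (\<psi> y) $ a $ e)) = S k * Fp k" by simp
  qed
  also have "(\<Sum>k\<in>UNIV. Fp k * (\<Sum>e\<in>UNIV. Gd k e * (1/2 * (\<Sum>a\<in>UNIV. \<Sum>b\<in>UNIV. J i a * J j b * bracket d (\<psi> y) e a b)))) =
      (\<Sum>a\<in>UNIV. \<Sum>b\<in>UNIV. J i a * J j b * (\<Sum>k\<in>UNIV. christoffel g d (\<psi> y) k a b * Fp k))"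
  proof -
    have "(\<Sum>k\<in>UNIV. Fp k * (\<Sum>e\<in>UNIV. Gd k e * (1/2 * (\<Sum>a\<in>UNIV. \<Sum>b\<in>UNIV. J i a * J j b * bracket d (\<psi> y) e a b)))) =
      (\<Sum>k\<in>UNIV. \<Sum>e\<in>UNIV. \<Sum>a\<in>UNIV. \<Sum>b\<in>UNIV. 1/2 * Fp k * Gd k e * (J i a * J j b) * bracket d (\<psi> y) e a b)" (is "_ = (\<Sum>k\<in>UNIV. \<Sum>e\<in>UNIV. \<Sum>a\<in>UNIV. \<Sum>b\<in>UNIV. ?t k e a b)")
      by (simp add: sum_distrib_left mult_ac)
    also have "\<dots> = (\<Sum>k\<in>UNIV. \<Sum>a\<in>UNIV. \<Sum>b\<in>UNIV. \<Sum>e\<in>UNIV. ?t k e a b)"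
    proof (rule sum.cong[OF refl])
      fix k
      have "(\<Sum>e\<in>UNIV. \<Sum>a\<in>UNIV. \<Sum>b\<in>UNIV. ?t k e a b) = (\<Sum>a\<in>UNIV. \<Sum>e\<in>UNIV. \<Sum>b\<in>UNIV. ?t k e a b)" by (rule sum.swap)
      also have "\<dots> = (\<Sum>a\<in>UNIV. \<Sum>b\<in>UNIV. \<Sum>e\<in>UNIV. ?t k e a b)" by (rule sum.cong[OF refl]) (rule sum.swap)
      finally show "(\<Sum>e\<in>UNIV. \<Sum>a\<in>UNIV. \<Sum>b\<in>UNIV. ?t k e a b) = (\<Sum>a\<in>UNIV. \<Sum>b\<in>UNIV. \<Sum>e\<in>UNIV. ?t k e a b)" .
    qed
    also have "\<dots> = (\<Sum>a\<in>UNIV. \<Sum>k\<in>UNIV. \<Sum>b\<in>UNIV. \<Sum>e\<in>UNIV. ?t k e a b)" by (rule sum.swap)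
    also have "\<dots> = (\<Sum>a\<in>UNIV. \<Sum>b\<in>UNIV. \<Sum>k\<in>UNIV. \<Sum>e\<in>UNIV. ?t k e a b)" by (rule sum.cong[OF refl]) (rule sum.swap)
    also have "\<dots> = (\<Sum>a\<in>UNIV. \<Sum>b\<in>UNIV. J i a * J j b * (\<Sum>k\<in>UNIV. christoffel g d (\<psi> y) k a b * Fp k))"
      unfolding christoffel_bracket Gd_def[symmetric]
      by (simp add: sum_distrib_left sum_distrib_right sum_divide_distrib mult_ac)
    finally show ?thesis .
  qed
  finally have chr: "(\<Sum>k\<in>UNIV. christoffel g c y k i j * partial k (f \<circ> chart_inv c) y) =
    (\<Sum>a\<in>UNIV. S a * Fp a) + (\<Sum>a\<in>UNIV. \<Sum>b\<in>UNIV. J i a * J j b * (\<Sum>k\<in>UNIV. christoffel g d (\<psi> y) k a b * Fp k))" .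
  show ?thesis
    unfolding hessian_def real_scaleR_def second chr F_def[symmetric] J_def[symmetric] Fp_def[symmetric]
    by (simp add: right_diff_distrib sum_subtractf)
qed

end

section \<open>Cutoff functions and bounded subsolutions\<close>

text \<open>If \<open>S\<close> contains 0, the points whose value lies outside \<open>S\<close>
  form a closed subset of \<open>K\<close>; their complement together with \<open>None\<close> is
  therefore open in the compactification.\<close>

lemma continuous_map_at_cemetery_zero:
  fixes f :: "'a::t2_space \<Rightarrow> real"
  assumes f: "continuous_on UNIV f" and K: "compact K" "\<And>p. p \<notin> K \<Longrightarrow> f p = 0"
  shows "continuous_map (Alexandroff_compactification euclidean) euclideanreal (at_cemetery_zero f)"
  unfolding continuous_map_def
proof (intro conjI allI impI)
  fix S :: "real set" assume "openin euclideanreal S"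
  then have S: "open S" by simp
  let ?V = "{z \<in> topspace (Alexandroff_compactification euclidean). at_cemetery_zero f z \<in> S}"
  show "openin (Alexandroff_compactification euclidean) ?V"
  proof (cases "0 \<in> S")
    case True
    have "closed (f -` (- S))" using f S by (simp add: closed_vimage closed_open vimage_Compl open_vimage)
    moreover have "f -` (- S) \<subseteq> K" using True K(2) by force
    ultimately have "compact (f -` (- S))" using K(1) closed_Int_compact by (metis inf.absorb1)
    moreover have "?V = insert None (Some ` (UNIV - f -` (- S)))"
    proof (rule set_eqI)
      fix z show "z \<in> ?V \<longleftrightarrow> z \<in> insert None (Some ` (UNIV - f -` (- S)))"
        using True by (cases z) (auto simp: at_cemetery_zero_def)
    qed
    ultimately show ?thesis
      using \<open>closed (f -` (- S))\<close> unfolding openin_Alexandroff_compactification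
      by (intro disjI2 exI[of _ "f -` (- S)"]) auto
  next
    case False
    have "open (f -` S)" using f S by (simp add: open_vimage)
    moreover have "?V = Some ` (f -` S)"
      using False by (auto simp: at_cemetery_zero_def split: option.splits)
    ultimately show ?thesis by simp
  qed
qed simp

text \<open>Common to \<open>bump\<close>, with \<open>a = 2\<close>, and to \<open>barrier\<close>,
  with negative \<open>b\<close>.\<close>

lemma Ck_on_norm_square_diff:
  fixes y0 :: "real^'m"
  assumes "open S"
  shows "Ck_on k (\<lambda>y. a - b * ((y - y0) \<bullet> (y - y0))) S"
proof -
  have d: "Ck_on k (\<lambda>y. y - y0) S"
    using Ck_on_add[OF assms Ck_on_ident Ck_on_const[of k "- y0"]] by simp
  have "Ck_on k (\<lambda>y. (y - y0) \<bullet> (y - y0)) S"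
    by (rule Ck_on_bilinear[OF bounded_bilinear_inner assms d d])
  then have "Ck_on k (\<lambda>y. (- b) * ((y - y0) \<bullet> (y - y0))) S"
    by (rule Ck_on_bounded_linear[OF bounded_linear_mult_right assms])
  from Ck_on_add[OF assms Ck_on_const[of k a] this] show ?thesis by simp
qed

text \<open>With \<open>p(s) = max(0, s)\<^sup>3\<close>, the function \<open>1 - p(1 - p(2 - s))\<close> is of class \<open>C\<^sup>2\<close>, equal to 1 for \<open>s \<le> 1\<close> and
  to 0 for \<open>s \<ge> 2\<close>.\<close>

definition bump :: "real \<Rightarrow> real^'m \<Rightarrow> real^'m \<Rightarrow> real" where
  "bump r y0 y = 1 - max 0 (1 - max 0 (2 - (1 / r\<^sup>2) * ((y - y0) \<bullet> (y - y0))) ^ 3) ^ 3"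

lemma Ck_on_bump:
  fixes S :: "(real^'m) set"
  assumes "open S"
  shows "Ck_on 2 (bump r y0) S"
proof -
  have 1: "Ck_on 2 (\<lambda>y. 1 + (-1) * h y) S" if "Ck_on 2 h S" for h :: "real^'m \<Rightarrow> real"
    using Ck_on_add[OF assms Ck_on_const Ck_on_bounded_linear[OF bounded_linear_mult_right assms that]] .
  have "Ck_on 2 (\<lambda>y. 1 + (-1) * (max 0 (1 + (-1) * max 0 (2 - (1 / r\<^sup>2) * ((y - y0) \<bullet> (y - y0))) ^ 3) ^ 3)) S"
    by (rule 1, rule Ck_on_pos_cube[OF assms], rule 1, rule Ck_on_pos_cube[OF assms],
        rule Ck_on_norm_square_diff[OF assms])
  then show ?thesis by (simp add: bump_def[abs_def])
qed

lemma bump_bounds: "0 \<le> bump r y0 y" "bump r y0 y \<le> 1"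
proof -
  have "max 0 (1 - max 0 (2 - (1 / r\<^sup>2) * ((y - y0) \<bullet> (y - y0))) ^ 3) ^ 3 \<le> (1::real)"
    by (rule power_le_one) auto
  then show "0 \<le> bump r y0 y" by (simp add: bump_def)
  show "bump r y0 y \<le> 1" by (simp add: bump_def)
qed

lemma bump_eq_1:
  assumes "r > 0" "dist y y0 \<le> r"
  shows "bump r y0 y = 1"
proof -
  have "(y - y0) \<bullet> (y - y0) \<le> r\<^sup>2"
    using assms by (simp add: dot_square_norm dist_norm power_mono)
  then have "1 \<le> 2 - (1 / r\<^sup>2) * ((y - y0) \<bullet> (y - y0))"
    using assms by (simp add: field_simps)
  then have "1 \<le> max 0 (2 - (1 / r\<^sup>2) * ((y - y0) \<bullet> (y - y0))) ^ 3"
    by (intro one_le_power) auto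
  then show ?thesis by (simp add: bump_def)
qed

lemma bump_eq_0:
  assumes "r > 0" "2 * r \<le> dist y y0"
  shows "bump r y0 y = 0"
proof -
  have "(2 * r)\<^sup>2 \<le> (y - y0) \<bullet> (y - y0)"
    unfolding dot_square_norm using assms by (intro power_mono) (auto simp: dist_norm)
  moreover have "(2 * r)\<^sup>2 = 4 * r\<^sup>2" by (simp add: power_mult_distrib)
  ultimately have "2 * r\<^sup>2 \<le> (y - y0) \<bullet> (y - y0)"
    using zero_le_power2[of r] by linarith
  then have "2 - (1 / r\<^sup>2) * ((y - y0) \<bullet> (y - y0)) \<le> 0"
    using assms by (simp add: field_simps)
  then show ?thesis by (simp add: bump_def max_def)
qed

context riemannian
begin

text \<open>The values of \<^const>\<open>laplace_beltrami\<close> and \<^const>\<open>energy_density\<close> in an arbitrary chart rather than in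
  the one selected by \<^const>\<open>chart_at\<close>.\<close>

definition lap :: "('a \<Rightarrow> real) \<Rightarrow> ('a, 'm) chart \<Rightarrow> real^'m \<Rightarrow> real" where
  "lap f c y = (\<Sum>i\<in>UNIV. \<Sum>j\<in>UNIV. matrix_inv (g c y) $ i $ j * hessian g f c y i j)"

definition energy :: "('a \<Rightarrow> real^'n) \<Rightarrow> ('a, 'm) chart \<Rightarrow> real^'m \<Rightarrow> real" where
  "energy f c y = (\<Sum>i\<in>UNIV. \<Sum>j\<in>UNIV. matrix_inv (g c y) $ i $ j *
     (partial i (f \<circ> chart_inv c) y \<bullet> partial j (f \<circ> chart_inv c) y))"

lemma inverse_metric_transformation:
  assumes "c \<in> A" "d \<in> A" and y: "y \<in> chart_map c ` (chart_dom c \<inter> chart_dom d)"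
  shows "(\<Sum>i\<in>UNIV. \<Sum>j\<in>UNIV. matrix_inv (g c y) $ i $ j *
      (partial i (transition c d) y $ a * partial j (transition c d) y $ b))
    = matrix_inv (g d (transition c d y)) $ a $ b"
proof (rule matrix_inv_pullback)
  show "invertible (g c y)"
    using y chart_simps(6)[OF assms(1)] by (intro metric_props(3)[OF assms(1)]) auto
  show "invertible (g d (transition c d y))"
    using y transition_overlap(1)[OF assms(1,2)] by (intro metric_props(3)[OF assms(2)]) auto
qed (rule metric_transformation[OF assms])

text \<open>The chart selected by \<open>chart_at\<close> may jump from point to point. Expressing
  the Laplacian in one fixed chart makes its continuity provable.\<close>

lemma laplace_beltrami_chart:
  assumes f: "C2_map A f" and d: "d \<in> A" "p \<in> chart_dom d"
  shows "laplace_beltrami A g f p = lap f d (chart_map d p)"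
proof -
  let ?c = "chart_at A p"
  let ?y = "chart_map ?c p"
  note c = chart_at[of p]
  have y: "?y \<in> chart_map ?c ` (chart_dom ?c \<inter> chart_dom d)" using c d by blast
  have "lap f ?c ?y = lap f d (transition ?c d ?y)"
    unfolding lap_def hessian_transformation[OF c(1) d(1) y f]
    by (rule contraction_pullback) (rule inverse_metric_transformation[OF c(1) d(1) y])
  also have "transition ?c d ?y = chart_map d p"
    using transition_overlap(2)[OF c(1) d(1)] c d by blast
  finally show ?thesis by (simp add: laplace_beltrami_def lap_def Let_def)
qed

lemma energy_density_chart:
  fixes f :: "'a \<Rightarrow> real^'n"
  assumes f: "C2_map A f" and d: "d \<in> A" "p \<in> chart_dom d"
  shows "energy_density A g f p = energy f d (chart_map d p)"
proof -
  let ?c = "chart_at A p"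
  let ?y = "chart_map ?c p"
  let ?W = "chart_map ?c ` (chart_dom ?c \<inter> chart_dom d)"
  note c = chart_at[of p]
  have y: "?y \<in> ?W" using c d by blast
  define F where "F = f \<circ> chart_inv d"
  have ty: "transition ?c d ?y = chart_map d p"
    using transition_overlap(2)[OF c(1) d(1)] c d by blast
  have tF: "F differentiable (at (transition ?c d ?y))"
    using f d chart_simps(6)[OF d] Ck_on_2_imp(4)[of F "chart_image d"] unfolding ty
    by (auto simp: C2_map_def F_def)
  have p1: "partial k (f \<circ> chart_inv ?c) ?y = (\<Sum>a\<in>UNIV. partial k (transition ?c d) ?y $ a *\<^sub>R partial a F (chart_map d p))" for k
  proof -
    have "partial k (f \<circ> chart_inv ?c) ?y = partial k (\<lambda>z. F (transition ?c d z)) ?y"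
      by (rule partial_cong[OF open_overlap[OF c(1) d(1)] y])
         (simp add: transition_overlap(3)[OF c(1) d(1)] F_def del: o_apply)
    also have "\<dots> = (\<Sum>a\<in>UNIV. partial k (transition ?c d) ?y $ a *\<^sub>R partial a F (transition ?c d ?y))"
      by (rule partial_comp) (use Ck_on_2_imp(4)[OF Ck_on_transition[OF c(1) d(1)] y] tF in auto)
    finally show ?thesis unfolding ty .
  qed
  have p2: "partial i (f \<circ> chart_inv ?c) ?y \<bullet> partial j (f \<circ> chart_inv ?c) ?y =
      (\<Sum>a\<in>UNIV. \<Sum>b\<in>UNIV. partial i (transition ?c d) ?y $ a * partial j (transition ?c d) ?y $ b *
        (partial a F (chart_map d p) \<bullet> partial b F (chart_map d p)))" for i j
    unfolding p1 by (simp add: inner_sum_left inner_sum_right sum_distrib_left mult.assoc) (subst sum.swap, simp add: mult_ac)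
  have "energy f ?c ?y = energy f d (chart_map d p)"
    unfolding energy_def p2 F_def[symmetric]
    by (rule contraction_pullback) (rule inverse_metric_transformation[OF c(1) d(1) y, unfolded ty])
  then show ?thesis by (simp add: energy_density_def energy_def Let_def)
qed

lemma continuous_on_chartwise:
  assumes h: "\<And>c. c \<in> A \<Longrightarrow> continuous_on (chart_image c) (h c)"
    and eq: "\<And>c p. c \<in> A \<Longrightarrow> p \<in> chart_dom c \<Longrightarrow> H p = h c (chart_map c p)"
  shows "continuous_on UNIV H"
proof (rule continuous_at_imp_continuous_on, rule ballI)
  fix p :: 'a
  let ?c = "chart_at A p"
  note c = chart_at[of p] and C = chart_simps[OF chart_at(1)[of p]]
  have "continuous_on (chart_dom ?c) (\<lambda>p. h ?c (chart_map ?c p))"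
    by (rule continuous_on_compose2[OF h[OF c(1)] C(3)]) (use C(6) in auto)
  then have "continuous_on (chart_dom ?c) H"
    using eq[OF c(1)] by (subst continuous_on_cong[OF refl]) auto
  then show "isCont H p" using c C(1) by (simp add: continuous_on_eq_continuous_at)
qed

lemma C2_map_continuous:
  assumes "C2_map A f"
  shows "continuous_on UNIV f"
proof (rule continuous_on_chartwise)
  show "continuous_on (chart_image c) (f \<circ> chart_inv c)" if "c \<in> A" for c
    using assms that Ck_on_2_imp(3) unfolding C2_map_def by blast
  show "f p = (f \<circ> chart_inv c) (chart_map c p)" if "c \<in> A" "p \<in> chart_dom c" for c p
    using chart_simps(5)[OF that] by simp
qed

lemma continuous_on_matrix_inv_metric:
  assumes "c \<in> A"
  shows "continuous_on (chart_image c) (\<lambda>y. matrix_inv (g c y) $ i $ j)"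
  by (rule continuous_on_matrix_inv) (use Ck_on_metric[OF assms, of 0] metric_props(3)[OF assms] in auto)

lemma continuous_on_laplace_beltrami:
  assumes "C2_map A f"
  shows "continuous_on UNIV (laplace_beltrami A g f)"
proof (rule continuous_on_chartwise[where h="lap f", OF _ laplace_beltrami_chart[OF assms]])
  fix c assume c: "c \<in> A"
  have "Ck_on 2 (f \<circ> chart_inv c) (chart_image c)" using assms c by (simp add: C2_map_def)
  note F = Ck_on_2_imp[OF this]
  have G: "continuous_on (chart_image c) (partial k (\<lambda>z. g c z $ i $ j))" for i j k
    by (rule Ck_on_2_imp(6)[OF Ck_on_metric[OF c]])
  show "continuous_on (chart_image c) (lap f c)"
    unfolding lap_def hessian_def christoffel_def
    by (intro continuous_intros continuous_on_matrix_inv_metric[OF c] F G)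
qed

lemma continuous_on_energy_density:
  fixes f :: "'a \<Rightarrow> real^'n"
  assumes "C2_map A f"
  shows "continuous_on UNIV (energy_density A g f)"
proof (rule continuous_on_chartwise[where h="energy f", OF _ energy_density_chart[OF assms]])
  fix c assume c: "c \<in> A"
  have "Ck_on 2 (f \<circ> chart_inv c) (chart_image c)" using assms c by (simp add: C2_map_def)
  note F = Ck_on_2_imp[OF this]
  show "continuous_on (chart_image c) (energy f c)"
    unfolding energy_def
    by (intro continuous_intros continuous_on_matrix_inv_metric[OF c] F)
qed

lemma laplace_beltrami_cong:
  fixes f h :: "'a \<Rightarrow> real"
  assumes N: "open N" "p \<in> N" "\<And>x. x \<in> N \<Longrightarrow> f x = h x"
  shows "laplace_beltrami A g f p = laplace_beltrami A g h p"
proof -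
  let ?c = "chart_at A p"
  let ?y = "chart_map ?c p"
  let ?W = "chart_map ?c ` (N \<inter> chart_dom ?c)"
  note c = chart_at[of p] and C = chart_simps[OF chart_at(1)[of p]]
  have W: "open ?W" using N C by (intro open_chart_map_image chart c) auto
  have y: "?y \<in> ?W" using N c by blast
  have eq: "(f \<circ> chart_inv ?c) z = (h \<circ> chart_inv ?c) z" if "z \<in> ?W" for z
    using that N(3) C(5) by auto
  have p1: "partial k (f \<circ> chart_inv ?c) z = partial k (h \<circ> chart_inv ?c) z" if "z \<in> ?W" for k z
    by (rule partial_cong[OF W that eq])
  have p2: "partial i (partial k (f \<circ> chart_inv ?c)) ?y = partial i (partial k (h \<circ> chart_inv ?c)) ?y" for i k
    by (rule partial_cong[OF W y p1])
  show ?thesis by (simp add: laplace_beltrami_def hessian_def Let_def p2 p1[OF y])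
qed

lemma laplace_beltrami_zero: "laplace_beltrami A g (\<lambda>p. 0) p = 0"
proof -
  have "partial i ((\<lambda>p. 0 :: real) \<circ> chart_inv c) = (\<lambda>y. 0)" for i c
    by (simp add: fun_eq_iff partial_def o_def)
  moreover have "partial i (\<lambda>y::real^'m. 0 :: real) = (\<lambda>y. 0)" for i
    by (simp add: fun_eq_iff partial_def)
  ultimately show ?thesis by (simp add: laplace_beltrami_def hessian_def Let_def)
qed

lemma C2_map_const: "C2_map A (\<lambda>p. k)"
  by (simp add: C2_map_def o_def Ck_on_const)

lemma C2_map_mult:
  fixes f h :: "'a \<Rightarrow> real"
  assumes "C2_map A f" "C2_map A h"
  shows "C2_map A (\<lambda>p. f p * h p)"
  unfolding C2_map_def o_def
proof
  fix c assume "c \<in> A"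
  then show "Ck_on 2 (\<lambda>y. f (chart_inv c y) * h (chart_inv c y)) (chart_image c)"
    using assms by (intro Ck_on_bilinear[OF bounded_bilinear_mult chart_simps(2)]) (auto simp: C2_map_def o_def)
qed

lemma C2_map_diff:
  fixes f h :: "'a \<Rightarrow> real"
  assumes "C2_map A f" "C2_map A h"
  shows "C2_map A (\<lambda>p. f p - h p)"
  unfolding C2_map_def o_def
proof
  fix c assume c: "c \<in> A"
  have "Ck_on 2 (\<lambda>y. - h (chart_inv c y)) (chart_image c)"
    using assms c by (intro Ck_on_bounded_linear[OF bounded_linear_minus[OF bounded_linear_ident] chart_simps(2)]) (auto simp: C2_map_def o_def)
  moreover have "Ck_on 2 (\<lambda>y. f (chart_inv c y)) (chart_image c)"
    using assms c by (auto simp: C2_map_def o_def)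
  ultimately show "Ck_on 2 (\<lambda>y. f (chart_inv c y) - h (chart_inv c y)) (chart_image c)"
    using Ck_on_add[OF chart_simps(2)[OF c]] by force
qed

lemma C2_map_compose:
  fixes f :: "'a \<Rightarrow> real^'n"
  assumes "C2_map A f" "range f \<subseteq> T" "Ck_on 2 H T"
  shows "C2_map A (\<lambda>p. H (f p))"
  unfolding C2_map_def o_def
proof
  fix c assume c: "c \<in> A"
  show "Ck_on 2 (\<lambda>y. H (f (chart_inv c y))) (chart_image c)"
    using assms c by (intro Ck_on_compose[OF chart_simps(2)[OF c] _ _ assms(3)]) (auto simp: C2_map_def o_def)
qed

text \<open>A Euclidean bump carried over by a chart. Any other chart is covered by two open sets:
  the overlap, where the transition map is smooth, and the complement of \<open>K\<close>, where the
  function is 0. \<open>K\<close> is closed because the space is Hausdorff.\<close>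

lemma exists_bump:
  "\<exists>b V K. C2_map A b \<and> open V \<and> p \<in> V \<and> compact K \<and> (\<forall>x. 0 \<le> b x \<and> b x \<le> (1::real)) \<and>
     (\<forall>x\<in>V. b x = 1) \<and> (\<forall>x. x \<notin> K \<longrightarrow> b x = 0)"
proof -
  let ?c = "chart_at A p"
  let ?y0 = "chart_map ?c p"
  note c = chart_at[of p] and C = chart_simps[OF chart_at(1)[of p]]
  obtain e where e: "e > 0" "cball ?y0 e \<subseteq> chart_image ?c"
    using C(2,6) c by (meson open_contains_cball)
  \<comment> \<open>Half of \<open>e\<close>, so that the bump, which vanishes from distance
    \<open>2 * r\<close> on, is supported inside the chart.\<close>
  define r where "r = e / 2"
  have r: "r > 0" "e = 2 * r" using e by (auto simp: r_def)
  define K where "K = chart_inv ?c ` cball ?y0 e"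
  define b where "b x = (if x \<in> chart_dom ?c then bump r ?y0 (chart_map ?c x) else 0)" for x
  define V where "V = chart_inv ?c ` ball ?y0 r"
  have br: "ball ?y0 r \<subseteq> chart_image ?c"
    using e r by (auto simp: subset_iff)
  have V_eq: "V = chart_dom ?c \<inter> chart_map ?c -` ball ?y0 r"
  proof (intro equalityI subsetI)
    fix x assume "x \<in> chart_dom ?c \<inter> chart_map ?c -` ball ?y0 r"
    then show "x \<in> V" unfolding V_def using C(5)[of x] by (intro image_eqI[of x _ "chart_map ?c x"]) auto
  qed (use br C(7,8) in \<open>auto simp: V_def\<close>)
  have K: "compact K" unfolding K_def
    by (rule compact_continuous_image[OF continuous_on_subset[OF C(4) e(2)] compact_cball])
  have bK: "b x = 0" if "x \<notin> K" for x
  proof (cases "x \<in> chart_dom ?c")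
    case True
    have "chart_map ?c x \<notin> cball ?y0 e"
    proof
      assume "chart_map ?c x \<in> cball ?y0 e"
      then have "chart_inv ?c (chart_map ?c x) \<in> K" unfolding K_def by blast
      then show False using that C(5)[OF True] by simp
    qed
    then have "bump r ?y0 (chart_map ?c x) = 0"
      using r by (intro bump_eq_0) (auto simp: dist_commute)
    then show ?thesis by (simp add: b_def)
  qed (simp add: b_def)
  have "C2_map A b"
    unfolding C2_map_def
  proof
    fix d assume d: "d \<in> A"
    note D = chart_simps[OF d]
    show "Ck_on 2 (b \<circ> chart_inv d) (chart_image d)"
    proof (rule Ck_on_local)
      fix y assume y: "y \<in> chart_image d"
      show "\<exists>T. open T \<and> y \<in> T \<and> Ck_on 2 (b \<circ> chart_inv d) T"
      proof (cases "chart_inv d y \<in> chart_dom ?c")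
        case True
        let ?T = "chart_map d ` (chart_dom d \<inter> chart_dom ?c)"
        have T: "open ?T" by (rule open_overlap[OF d c(1)])
        have "y \<in> ?T" using True D(7,8)[OF y] by (metis IntI image_eqI)
        moreover have "Ck_on 2 (b \<circ> chart_inv d) ?T"
        proof (rule Ck_on_cong[OF T])
          show "bump r ?y0 (transition d ?c z) = (b \<circ> chart_inv d) z" if "z \<in> ?T" for z
            using that D(5) by (auto simp: b_def transition_def)
          show "Ck_on 2 (\<lambda>z. bump r ?y0 (transition d ?c z)) ?T"
            by (rule Ck_on_compose[OF T subset_UNIV Ck_on_transition[OF d c(1)] Ck_on_bump[OF open_UNIV]])
        qed
        ultimately show ?thesis using T by blast
      next
        case False
        let ?T = "chart_map d ` (chart_dom d - K)"
        have "chart_inv d y \<notin> K" using False e(2) C(8) unfolding K_def by auto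
        then have "y \<in> ?T" using D(7,8)[OF y] by (metis DiffI image_eqI)
        moreover have T: "open ?T"
          using K by (intro open_chart_map_image chart[OF d] open_Diff D(1) compact_imp_closed) auto
        moreover have "Ck_on 2 (b \<circ> chart_inv d) ?T"
        proof (rule Ck_on_cong[OF T _ Ck_on_const])
          show "0 = (b \<circ> chart_inv d) z" if "z \<in> ?T" for z
            using that D(5) bK by auto
        qed
        ultimately show ?thesis by blast
      qed
    qed
  qed
  moreover have "open V"
    unfolding V_eq using continuous_open_preimage[OF C(3,1)] by blast
  moreover have "p \<in> V" unfolding V_eq using c r by simp
  moreover have "b x = 1" if "x \<in> V" for x
    using that r unfolding V_eq b_def by (auto intro!: bump_eq_1 simp: dist_commute)
  moreover have "0 \<le> b x \<and> b x \<le> 1" for x by (simp add: b_def bump_bounds)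
  ultimately show ?thesis using K bK by blast
qed

text \<open>Lindelof reduces the sets on which the bumps equal 1 to a countable subcover; finite
  unions of these sets exhaust the manifold.\<close>

lemma exists_cutoff_exhaustion:
  "\<exists>cut U K. (\<forall>n. C2_map A (cut n) \<and> open (U n) \<and> U n \<subseteq> U (Suc n) \<and> compact (K n) \<and>
     (\<forall>x. 0 \<le> cut n x \<and> cut n x \<le> (1::real)) \<and> (\<forall>x\<in>U n. cut n x = 1) \<and> (\<forall>x. x \<notin> K n \<longrightarrow> cut n x = 0)) \<and>
     (\<Union>n. U n) = UNIV"
proof -
  obtain b V K where b: "\<And>p. C2_map A (b p) \<and> open (V p) \<and> p \<in> V p \<and> compact (K p) \<and>
      (\<forall>x. 0 \<le> b p x \<and> b p x \<le> (1::real)) \<and> (\<forall>x\<in>V p. b p x = 1) \<and> (\<forall>x. x \<notin> K p \<longrightarrow> b p x = 0)"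
    using exists_bump by metis
  obtain \<F>' where F': "\<F>' \<subseteq> range V" "countable \<F>'" "\<Union>\<F>' = \<Union>(range V)"
    using Lindelof[of "range V"] b by blast
  then obtain I where I: "countable I" "\<F>' = V ` I"
    by (metis countable_subset_image)
  have bV: "p \<in> V p" for p using b[of p] by simp
  have cover: "x \<in> (\<Union>p\<in>I. V p)" for x
  proof -
    have "x \<in> \<Union>(range V)" using bV[of x] by blast
    then show ?thesis using F'(3) I(2) by simp
  qed
  then have "I \<noteq> {}" by blast
  define e where "e = from_nat_into I"
  have e: "range e = I" using range_from_nat_into[OF \<open>I \<noteq> {}\<close> I(1)] by (simp add: e_def)
  \<comment> \<open>A C^2 substitute for the maximum of the first \<open>n\<close> bumps: it is 1
    where one of them is 1 and 0 where all of them vanish.\<close>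
  define cut where "cut n x = 1 - (\<Prod>i<n. 1 - b (e i) x)" for n x
  define U where "U n = (\<Union>i<n. V (e i))" for n
  define K' where "K' n = (\<Union>i<n. K (e i))" for n
  have P: "C2_map A (\<lambda>x. \<Prod>i<n. 1 - b (e i) x)" for n
  proof (induction n)
    case (Suc n)
    have "C2_map A (\<lambda>x. 1 - b (e n) x)" using b by (intro C2_map_diff C2_map_const) blast
    from C2_map_mult[OF Suc this] show ?case by simp
  qed (simp add: C2_map_const)
  have "C2_map A (cut n)" for n
    unfolding cut_def by (intro C2_map_diff C2_map_const P)
  moreover have "open (U n)" for n unfolding U_def using b by blast
  moreover have "U n \<subseteq> U (Suc n)" for n unfolding U_def by (rule UN_mono) auto
  moreover have "compact (K' n)" for n unfolding K'_def using b by (intro compact_UN) auto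
  moreover have "0 \<le> cut n x \<and> cut n x \<le> 1" for n x
  proof -
    have "0 \<le> (\<Prod>i<n. 1 - b (e i) x)" using b by (intro prod_nonneg) auto
    moreover have "(\<Prod>i<n. 1 - b (e i) x) \<le> 1" using b by (intro prod_le_1) auto
    ultimately show ?thesis by (simp add: cut_def)
  qed
  moreover have "cut n x = 1" if x: "x \<in> U n" for n x
  proof -
    obtain i where i: "i < n" "x \<in> V (e i)" using x by (auto simp: U_def)
    then have "1 - b (e i) x = 0" using b by auto
    then have "(\<Prod>i<n. 1 - b (e i) x) = 0" using i by (intro prod_zero) auto
    then show ?thesis by (simp add: cut_def)
  qed
  moreover have "cut n x = 0" if "x \<notin> K' n" for n x
    using that b by (simp add: cut_def K'_def)
  moreover have "(\<Union>n. U n) = UNIV"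
  proof -
    have "x \<in> (\<Union>n. U n)" for x
    proof -
      obtain i where "x \<in> V (e i)" using cover[of x] unfolding e[symmetric] by blast
      then have "x \<in> U (Suc i)" unfolding U_def by blast
      then show ?thesis by blast
    qed
    then show ?thesis by blast
  qed
  ultimately show ?thesis by (intro exI[of _ cut] exI[of _ U] exI[of _ K']) blast
qed

text \<open>One direction of the Khasminskii test. Off \<open>K n\<close> the localised function and
  its image under the operator both vanish, so both extend continuously by 0 to the
  cemetery.\<close>

lemma bounded_subsolution_nonpos:
  fixes \<phi> :: "'a \<Rightarrow> real^'n" and w :: "'a \<Rightarrow> real"
  assumes \<phi>: "C2_map A \<phi>" and pos: "\<And>x. energy_density A g \<phi> x > 0"
    and sc: "stochastically_complete A (map_laplacian A g \<phi>)"
    and w: "C2_map A w" "\<And>x. 0 \<le> w x" "\<And>x. w x \<le> B"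
    and lam: "lam > 0" and le: "\<And>x. lam * w x \<le> map_laplacian A g \<phi> w x"
  shows "w x \<le> 0"
proof -
  let ?L = "map_laplacian A g \<phi>"
  obtain cut :: "nat \<Rightarrow> 'a \<Rightarrow> real" and U K where *: "\<forall>n. C2_map A (cut n) \<and> open (U n) \<and> U n \<subseteq> U (Suc n) \<and> compact (K n) \<and>
     (\<forall>x. 0 \<le> cut n x \<and> cut n x \<le> (1::real)) \<and> (\<forall>x\<in>U n. cut n x = 1) \<and> (\<forall>x. x \<notin> K n \<longrightarrow> cut n x = 0)"
     "(\<Union>n. U n) = UNIV"
    using exists_cutoff_exhaustion by blast
  define f where "f n x = cut n x * w x" for n x
  have f: "C2_map A (f n)" for n unfolding f_def using * w by (intro C2_map_mult) auto
  have fK: "f n x = 0" if "x \<notin> K n" for n x using * that by (simp add: f_def)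
  have closed_K: "closed (K n)" for n using * compact_imp_closed by blast
  have fw: "f n x = w x" if "x \<in> U n" for n x using * that by (simp add: f_def)
  have Lf: "?L (f n) x = ?L w x" if "x \<in> U n" for n x
    using laplace_beltrami_cong[of "U n" x "f n" w] * fw that by (simp add: map_laplacian_def)
  have LK: "?L (f n) x = 0" if "x \<notin> K n" for n x
    using laplace_beltrami_cong[of "- K n" x "f n" "\<lambda>_. 0"] closed_K fK that
    by (simp add: map_laplacian_def laplace_beltrami_zero open_Compl)
  have cL: "continuous_on UNIV (?L (f n))" for n
    unfolding map_laplacian_def[abs_def]
    by (intro continuous_on_divide continuous_on_laplace_beltrami f continuous_on_energy_density \<phi>)
       (use pos less_irrefl in metis)
  have test: "test_function A (f n)" for n
  proof -
    have "closure {p. f n p \<noteq> 0} \<subseteq> K n"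
      by (rule closure_minimal[OF _ closed_K]) (use fK in blast)
    then have "compact (closure {p. f n p \<noteq> 0})"
      using * compact_Int_closed[of "K n" "closure {p. f n p \<noteq> 0}"] by (simp add: inf.absorb2)
    then show ?thesis using f by (simp add: test_function_def)
  qed
  have bd: "\<exists>C. \<forall>p. \<bar>?L (f n) p\<bar> \<le> C" for n
  proof -
    have "bounded (?L (f n) ` K n)"
      using * by (intro compact_imp_bounded compact_continuous_image continuous_on_subset[OF cL]) auto
    then obtain C where C: "\<And>p. p \<in> K n \<Longrightarrow> \<bar>?L (f n) p\<bar> \<le> C" by (auto simp: bounded_iff)
    have "\<bar>?L (f n) p\<bar> \<le> max 0 C" for p
    proof (cases "p \<in> K n")
      case True
      then show ?thesis using C[of p] by linarith
    next
      case False
      then show ?thesis using LK[of p n] by simp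
    qed
    then show ?thesis by blast
  qed
  show ?thesis
  proof (rule stochastically_complete_subsolution[OF sc test, where U=U and B=B])
    show "continuous_map (Alexandroff_compactification euclidean) euclideanreal (at_cemetery_zero (f n))" for n
      by (rule continuous_map_at_cemetery_zero[OF C2_map_continuous[OF f], where K="K n"]) (use * fK in auto)
    show "continuous_map (Alexandroff_compactification euclidean) euclideanreal (at_cemetery_zero (?L (f n)))" for n
      by (rule continuous_map_at_cemetery_zero[OF cL, where K="K n"]) (use * LK in auto)
    show "0 \<le> f n p" for n p using * w by (simp add: f_def)
    show "f n p \<le> B" for n p
    proof -
      have "f n p \<le> 1 * w p" unfolding f_def using * w by (intro mult_right_mono) auto
      then show ?thesis using w(3)[of p] by linarith
    qed
    show "lam * f n p \<le> ?L (f n) p" if "p \<in> U n" for n p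
      using le[of p] fw[OF that] Lf[OF that] by simp
  qed (use * bd lam fw in auto)
qed

end

section \<open>The cone\<close>

text \<open>For the upper bound, \<alpha>^4 (1 - \<alpha>^2) \<le> \<alpha>^2 (1 - \<alpha>^2) \<le>
  1/4. Together the two bounds give 2 \<le> 1/\<open>A_const \<eta>\<close>.\<close>

lemma A_const_bounds:
  assumes "\<eta> > 0"
  shows "0 < A_const \<eta>" "A_const \<eta> \<le> 1 / 2"
proof -
  let ?S = "{\<xi> * \<alpha>\<^sup>2 * sqrt (1 - \<alpha>\<^sup>2) | \<xi> \<alpha>.
     0 < \<xi> \<and> \<xi> < 1 \<and> 0 < \<alpha> \<and> \<alpha> < min 1 (\<eta> * sqrt (1 - \<xi>))}"
  have le: "x \<le> 1 / 2" if x: "x \<in> ?S" for x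
  proof -
    obtain \<xi> \<alpha> where x: "x = \<xi> * \<alpha>\<^sup>2 * sqrt (1 - \<alpha>\<^sup>2)" "0 < \<xi>" "\<xi> < 1" "0 < \<alpha>" "\<alpha> < 1"
      using x by auto
    have a1: "\<alpha>\<^sup>2 \<le> 1" using x by (simp add: power_le_one)
    have "\<alpha>\<^sup>2 * (1 - \<alpha>\<^sup>2) \<le> 1 / 4"
      using zero_le_power2[of "\<alpha>\<^sup>2 - 1 / 2"] by (simp add: power2_eq_square algebra_simps)
    moreover have "\<alpha>\<^sup>2 * (\<alpha>\<^sup>2 * (1 - \<alpha>\<^sup>2)) \<le> 1 * (\<alpha>\<^sup>2 * (1 - \<alpha>\<^sup>2))"
      using a1 by (intro mult_right_mono) auto
    moreover have s: "(sqrt (1 - \<alpha>\<^sup>2))\<^sup>2 = 1 - \<alpha>\<^sup>2" using a1 by simp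
    have "(\<alpha>\<^sup>2 * sqrt (1 - \<alpha>\<^sup>2))\<^sup>2 = \<alpha>\<^sup>2 * (\<alpha>\<^sup>2 * (1 - \<alpha>\<^sup>2))"
      unfolding power_mult_distrib s by (simp add: power2_eq_square)
    moreover have "(1 / 2 :: real)\<^sup>2 = 1 / 4" by (simp add: power_divide)
    ultimately have "(\<alpha>\<^sup>2 * sqrt (1 - \<alpha>\<^sup>2))\<^sup>2 \<le> (1 / 2)\<^sup>2" by linarith
    then have "\<alpha>\<^sup>2 * sqrt (1 - \<alpha>\<^sup>2) \<le> 1 / 2" by (rule power2_le_imp_le) simp
    moreover have "\<xi> * (\<alpha>\<^sup>2 * sqrt (1 - \<alpha>\<^sup>2)) \<le> 1 * (\<alpha>\<^sup>2 * sqrt (1 - \<alpha>\<^sup>2))"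
      using x a1 by (intro mult_right_mono) auto
    ultimately show ?thesis using x(1) by simp
  qed
  \<comment> \<open>Half of the bound allowed for \<xi> = 1/2: an admissible pair with a positive
    value, showing also that the set is not empty.\<close>
  define \<alpha> where "\<alpha> = min 1 (\<eta> * sqrt (1 - 1 / 2)) / 2"
  have "0 < min 1 (\<eta> * sqrt (1 - 1 / 2))" using assms by simp
  then have \<alpha>: "0 < \<alpha>" "\<alpha> < min 1 (\<eta> * sqrt (1 - 1 / 2))" unfolding \<alpha>_def by linarith+
  define x where "x = 1 / 2 * \<alpha>\<^sup>2 * sqrt (1 - \<alpha>\<^sup>2)"
  have xS: "x \<in> ?S"
    unfolding x_def using \<alpha> by (intro CollectI exI[of _ "1 / 2"] exI[of _ \<alpha>]) simp
  have "\<alpha>\<^sup>2 < 1" using \<alpha> by (simp add: power_less_one_iff)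
  then have "0 < x" using \<alpha> by (simp add: x_def)
  also have "x \<le> A_const \<eta>"
    unfolding A_const_def by (rule cSup_upper[OF xS]) (rule bdd_aboveI[OF le])
  finally show "0 < A_const \<eta>" .
  show "A_const \<eta> \<le> 1 / 2"
    unfolding A_const_def by (rule cSup_least) (use xS le in blast)+
qed

section \<open>The barrier function and its composition with the map\<close>

lemma norm_scaleR_diff_square:
  fixes a v :: "'a::real_inner"
  shows "(norm (c *\<^sub>R a - v))\<^sup>2 = c\<^sup>2 * (norm a)\<^sup>2 - 2 * c * (a \<bullet> v) + (norm v)\<^sup>2"
  unfolding power2_norm_eq_inner
  by (simp add: inner_diff_left inner_diff_right inner_commute power2_eq_square)

text \<open>The u of the overview as a function on the target. Its Hessian is \<open>c\<close> times
  the flat metric and its gradient is \<open>c *\<^sub>R (x - q) - v\<close>; so the Laplacian of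
  its composition with \<phi> involves only the energy density and the tension field.\<close>

definition barrier :: "real \<Rightarrow> real \<Rightarrow> real^'n \<Rightarrow> real^'n \<Rightarrow> real^'n \<Rightarrow> real" where
  "barrier k c q v x = k + c / 2 * ((x - q) \<bullet> (x - q)) - (x - q) \<bullet> v"

lemma Ck_on_barrier:
  fixes S :: "(real^'n) set"
  assumes "open S"
  shows "Ck_on j (barrier k c q v) S"
proof -
  have "Ck_on j (\<lambda>x. - x \<bullet> v) S"
    by (rule Ck_on_bounded_linear[OF _ assms Ck_on_ident])
       (intro bounded_linear_inner_left_comp bounded_linear_minus bounded_linear_ident)
  from Ck_on_add[OF assms this Ck_on_const[of j "q \<bullet> v"]]
  have "Ck_on j (\<lambda>x. - ((x - q) \<bullet> v)) S" by (simp add: inner_diff_left)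
  from Ck_on_add[OF assms Ck_on_norm_square_diff[OF assms, of j k "- c / 2" q] this]
  show ?thesis by (simp add: barrier_def[abs_def])
qed

lemma partial_barrier:
  fixes F :: "real^'m \<Rightarrow> real^'n"
  assumes S: "open S" "y \<in> S" and F: "Ck_on 2 F S"
  shows "partial j (\<lambda>y. barrier k c q v (F y)) y = (c *\<^sub>R (F y - q) - v) \<bullet> partial j F y"
    and "partial i (partial j (\<lambda>y. barrier k c q v (F y))) y =
      c * (partial i F y \<bullet> partial j F y) + (c *\<^sub>R (F y - q) - v) \<bullet> partial i (partial j F) y"
proof -
  note C = Ck_on_2_imp[OF F]
  have 1: "partial j (\<lambda>y. barrier k c q v (F y)) y = (c *\<^sub>R (F y - q) - v) \<bullet> partial j F y" if y: "y \<in> S" for y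
  proof -
    obtain D where D: "(F has_derivative D) (at y)"
      using C(4)[OF y] by (auto simp: differentiable_def)
    have "((\<lambda>y. barrier k c q v (F y)) has_derivative (\<lambda>w. (c *\<^sub>R (F y - q) - v) \<bullet> D w)) (at y)"
      unfolding barrier_def
      by (rule derivative_eq_intros D refl)+
         (simp add: fun_eq_iff inner_diff_left inner_diff_right inner_add_right inner_commute algebra_simps)
    from partial_eqI[OF this] partial_eqI[OF D] show ?thesis by simp
  qed
  show "partial j (\<lambda>y. barrier k c q v (F y)) y = (c *\<^sub>R (F y - q) - v) \<bullet> partial j F y"
    by (rule 1[OF S(2)])
  obtain D where D: "(F has_derivative D) (at y)"
    using C(4)[OF S(2)] by (auto simp: differentiable_def)
  obtain E where E: "(partial j F has_derivative E) (at y)"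
    using C(5)[OF S(2)] by (auto simp: differentiable_def)
  have "((\<lambda>y. (c *\<^sub>R (F y - q) - v) \<bullet> partial j F y) has_derivative
      (\<lambda>w. c * (D w \<bullet> partial j F y) + (c *\<^sub>R (F y - q) - v) \<bullet> E w)) (at y)"
    by (rule derivative_eq_intros D E refl)+ (simp add: algebra_simps)
  from partial_eqI[OF this] partial_eqI[OF D] partial_eqI[OF E]
  have "partial i (\<lambda>y. (c *\<^sub>R (F y - q) - v) \<bullet> partial j F y) y =
      c * (partial i F y \<bullet> partial j F y) + (c *\<^sub>R (F y - q) - v) \<bullet> partial i (partial j F) y"
    by simp
  moreover have "partial i (partial j (\<lambda>y. barrier k c q v (F y))) y =
      partial i (\<lambda>y. (c *\<^sub>R (F y - q) - v) \<bullet> partial j F y) y"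
    by (rule partial_cong[OF S 1])
  ultimately show "partial i (partial j (\<lambda>y. barrier k c q v (F y))) y =
      c * (partial i F y \<bullet> partial j F y) + (c *\<^sub>R (F y - q) - v) \<bullet> partial i (partial j F) y"
    by simp
qed

context riemannian
begin

text \<open>With p(s) = max(0,s)^3 one has \<Delta> p(u) = p'(u) \<Delta> u + p''(u) |\<nabla> u|^2,
  and p is convex.\<close>

lemma laplace_beltrami_pos_cube:
  fixes u :: "'a \<Rightarrow> real"
  assumes "C2_map A u"
  shows "3 * (max 0 (u p))\<^sup>2 * laplace_beltrami A g u p \<le> laplace_beltrami A g (\<lambda>p. max 0 (u p) ^ 3) p"
proof -
  let ?c = "chart_at A p"
  let ?y = "chart_map ?c p"
  note c = chart_at[of p] and C = chart_simps[OF chart_at(1)[of p]]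
  define U where "U = u \<circ> chart_inv ?c"
  have y: "?y \<in> chart_image ?c" using C(6) c by blast
  have U: "Ck_on 2 U (chart_image ?c)" using assms c by (simp add: C2_map_def U_def)
  have Uy: "U ?y = u p" using C(5) c by (simp add: U_def)
  have comp: "(\<lambda>p. max 0 (u p) ^ 3) \<circ> chart_inv ?c = (\<lambda>y. max 0 (U y) ^ 3)"
    by (simp add: U_def o_def)
  have hess: "hessian g (\<lambda>p. max 0 (u p) ^ 3) ?c ?y i j =
      6 * max 0 (u p) * (partial i U ?y * partial j U ?y) + 3 * (max 0 (u p))\<^sup>2 * hessian g u ?c ?y i j" for i j
    unfolding hessian_def comp partial_partial_pos_cube(1)[OF C(2) y U] partial_pos_cube[OF Ck_on_2_imp(4)[OF U y]]
      U_def[symmetric] Uy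
    by (simp add: right_diff_distrib sum_distrib_left mult_ac)
  let ?G = "matrix_inv (g ?c ?y)"
  have "0 \<le> (\<Sum>i\<in>UNIV. \<Sum>j\<in>UNIV. ?G $ i $ j * ((\<chi> i. partial i U ?y) $ i * (\<chi> i. partial i U ?y) $ j))"
    by (rule matrix_inv_pos_semidef) (use metric_props[OF c(1) y] in auto)
  then have nn: "0 \<le> 6 * max 0 (u p) * (\<Sum>i\<in>UNIV. \<Sum>j\<in>UNIV. ?G $ i $ j * (partial i U ?y * partial j U ?y))"
    by simp
  have "laplace_beltrami A g (\<lambda>p. max 0 (u p) ^ 3) p =
      6 * max 0 (u p) * (\<Sum>i\<in>UNIV. \<Sum>j\<in>UNIV. ?G $ i $ j * (partial i U ?y * partial j U ?y)) +
      3 * (max 0 (u p))\<^sup>2 * laplace_beltrami A g u p"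
    unfolding laplace_beltrami_def Let_def hess
    by (simp add: ring_distribs sum.distrib sum_distrib_left mult_ac)
  then show ?thesis using nn by linarith
qed

lemma laplace_beltrami_barrier:
  fixes \<phi> :: "'a \<Rightarrow> real^'n"
  assumes "C2_map A \<phi>"
  shows "laplace_beltrami A g (\<lambda>p. barrier k c q v (\<phi> p)) p =
    c * energy_density A g \<phi> p + (c *\<^sub>R (\<phi> p - q) - v) \<bullet> tension_field A g \<phi> p"
proof -
  let ?c = "chart_at A p"
  let ?y = "chart_map ?c p"
  note ch = chart_at[of p] and C = chart_simps[OF chart_at(1)[of p]]
  define F where "F = \<phi> \<circ> chart_inv ?c"
  have y: "?y \<in> chart_image ?c" using C(6) ch by blast
  have F: "Ck_on 2 F (chart_image ?c)" using assms ch by (simp add: C2_map_def F_def)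
  have Fy: "F ?y = \<phi> p" using C(5) ch by (simp add: F_def)
  have comp: "(\<lambda>p. barrier k c q v (\<phi> p)) \<circ> chart_inv ?c = (\<lambda>y. barrier k c q v (F y))"
    by (simp add: F_def o_def)
  define z where "z = c *\<^sub>R (\<phi> p - q) - v"
  have hess: "hessian g (\<lambda>p. barrier k c q v (\<phi> p)) ?c ?y i j =
      c * (partial i F ?y \<bullet> partial j F ?y) + z \<bullet> hessian g \<phi> ?c ?y i j" for i j
    unfolding hessian_def comp partial_barrier[OF C(2) y F] F_def[symmetric] Fy z_def[symmetric]
    by (simp add: inner_diff_right inner_sum_right)
  show ?thesis
    unfolding laplace_beltrami_def energy_density_def tension_field_def Let_def hess
      F_def[symmetric] z_def[symmetric]
    by (simp add: ring_distribs sum.distrib sum_distrib_left inner_sum_right mult_ac)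
qed

text \<open>Formulated with real numbers \<open>b\<close>, \<open>T\<close>, \<open>d\<close> for
  the cosine, the supremum and the distance; the extended-real conventions are left to the
  theorem.\<close>

lemma cone_width_bound:
  fixes \<phi> :: "'a \<Rightarrow> real^'n" and q v :: "real^'n"
  assumes \<phi>: "C2_map A \<phi>" and pos: "\<And>x. energy_density A g \<phi> x > 0"
    and sc: "stochastically_complete A (map_laplacian A g \<phi>)"
    and v: "norm v = 1" and b: "0 < b" and cone: "\<And>p. b * norm (\<phi> p - q) \<le> (\<phi> p - q) \<bullet> v"
    and T: "\<And>p. norm (tension_field A g \<phi> p) \<le> T * energy_density A g \<phi> p"
    and d: "\<And>\<epsilon>. \<epsilon> > 0 \<Longrightarrow> \<exists>p. (\<phi> p - q) \<bullet> v < d + \<epsilon>" and d0: "0 \<le> d"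
  shows "b\<^sup>2 \<le> 2 * d * T"
proof (rule ccontr)
  assume "\<not> ?thesis"
  then have less: "2 * d * T < b\<^sup>2" by simp
  have T0: "0 \<le> T"
  proof -
    obtain p :: 'a where True by simp
    have "0 \<le> T * energy_density A g \<phi> p" using T[of p] norm_ge_zero order_trans by blast
    then show ?thesis using pos[of p] by (simp add: zero_le_mult_iff)
  qed
  \<comment> \<open>The strict inequality leaves room to replace \<open>T\<close> by a slightly
    larger \<open>c\<close>; if \<open>d = 0\<close>, any larger \<open>c\<close> will do.\<close>
  obtain c where c: "T < c" "2 * d * c < b\<^sup>2"
  proof (cases "d = 0")
    case True
    then show ?thesis using that[of "T + 1"] b by simp
  next
    case False
    then have "T < b\<^sup>2 / (2 * d)" using less d0 by (simp add: field_simps)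
    then obtain c where "T < c" "c < b\<^sup>2 / (2 * d)" using dense by blast
    then show ?thesis using that[of c] False d0 by (simp add: field_simps)
  qed
  have c0: "0 < c" using c T0 by simp
  have "d < b\<^sup>2 / (2 * c)" using c c0 by (simp add: field_simps)
  then obtain k where k: "d < k" "k < b\<^sup>2 / (2 * c)" using dense by blast
  have k0: "0 < k" using k d0 by simp
  define R where "R = b / c"
  have R: "0 < R" "c * R = b" using b c0 by (auto simp: R_def)
  have kR: "k < b * R / 2" using k c0 by (simp add: R_def power2_eq_square field_simps)
  define Q where "Q = barrier k c q v"
  define H where "H x = (if dist x q < R then max 0 (Q x) ^ 3 else 0)" for x
  \<comment> \<open>The truncation \<open>H\<close> is of class C^2 on the open ball together with
    \<open>W\<close>, not on the whole space: on the sphere of radius \<open>R\<close> outside the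
    cone \<open>Q\<close> may be positive. The image of \<phi> avoids that part, by
    \<open>far\<close>.\<close>
  define W where "W = {x. Q x < 0} \<union> {x. R < dist x q}"
  have Q_cont: "continuous_on UNIV Q"
    using Ck_on_barrier[OF open_UNIV, of 0 k c q v] by (simp add: Q_def)
  have oW: "open W"
    unfolding W_def using Q_cont by (intro open_Un open_Collect_less continuous_intros)
  have W0: "H x = 0" if "x \<in> W" for x
    using that by (auto simp: W_def H_def max_def)
  have oB: "open {x. dist x q < R}" by (intro open_Collect_less continuous_intros)
  have HC2: "Ck_on 2 H ({x. dist x q < R} \<union> W)"
  proof (rule Ck_on_local)
    fix y assume "y \<in> {x. dist x q < R} \<union> W"
    then consider "y \<in> {x. dist x q < R}" | "y \<in> W" by blast
    then show "\<exists>T. open T \<and> y \<in> T \<and> Ck_on 2 H T"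
    proof cases
      case 1
      have "Ck_on 2 H {x. dist x q < R}"
        by (rule Ck_on_cong[OF oB _ Ck_on_pos_cube[OF oB Ck_on_barrier[OF oB, of 2 k c q v]]])
           (simp add: H_def Q_def)
      then show ?thesis using 1 oB by blast
    next
      case 2
      have "Ck_on 2 H W"
        by (rule Ck_on_cong[OF oW _ Ck_on_const[of 2 0]]) (simp add: W0)
      then show ?thesis using 2 oW by blast
    qed
  qed
  have Q_le: "Q (\<phi> p) \<le> k + c / 2 * (norm (\<phi> p - q))\<^sup>2 - b * norm (\<phi> p - q)" for p
    using cone[of p] by (simp add: Q_def barrier_def dot_square_norm)
  have far: "\<phi> p \<in> W" if "\<not> dist (\<phi> p) q < R" for p
  proof (cases "dist (\<phi> p) q = R")
    case True
    then have n: "norm (\<phi> p - q) = R" by (simp add: dist_norm)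
    have "Q (\<phi> p) \<le> k + c / 2 * R\<^sup>2 - b * R" using Q_le[of p] n by simp
    also have "\<dots> = k - b * R / 2" using R by (simp add: power2_eq_square field_simps)
    also have "\<dots> < 0" using kR by simp
    finally show ?thesis by (simp add: W_def)
  qed (use that in \<open>auto simp: W_def\<close>)
  have range: "range \<phi> \<subseteq> {x. dist x q < R} \<union> W" using far by blast
  define w where "w p = H (\<phi> p)" for p
  have wC2: "C2_map A w" unfolding w_def by (rule C2_map_compose[OF \<phi> range HC2])
  have w0: "0 \<le> w p" for p by (simp add: w_def H_def)
  \<comment> \<open>An upper bound of \<open>Q\<close> on the ball within the cone, dropping the
    negative linear term.\<close>
  define B where "B = k + c / 2 * R\<^sup>2"
  have B0: "0 < B" using k0 c0 by (simp add: B_def add_pos_nonneg)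
  have QB: "max 0 (Q (\<phi> p)) \<le> B" if "dist (\<phi> p) q < R" for p
  proof -
    have "(norm (\<phi> p - q))\<^sup>2 \<le> R\<^sup>2" using that by (intro power_mono) (auto simp: dist_norm)
    then have "c / 2 * (norm (\<phi> p - q))\<^sup>2 \<le> c / 2 * R\<^sup>2" using c0 by (intro mult_left_mono) auto
    moreover have "0 \<le> b * norm (\<phi> p - q)" using b by simp
    ultimately show ?thesis using Q_le[of p] B0 by (simp add: B_def)
  qed
  have wB: "w p \<le> B ^ 3" for p
  proof (cases "dist (\<phi> p) q < R")
    case True
    then show ?thesis using power_mono[OF QB[OF True], of 3] by (simp add: w_def H_def)
  next
    case False
    then show ?thesis using B0 by (simp add: w_def H_def)
  qed
  have \<phi>_cont: "continuous_on UNIV \<phi>" by (rule C2_map_continuous[OF \<phi>])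
  \<comment> \<open>Inside the ball \<open>w\<close> is at most \<open>B\<close> times the squared
    positive part, while the operator gives at least \<open>3 * (c - T)\<close> times that
    square.\<close>
  define lam where "lam = 3 * (c - T) / B"
  have lam0: "0 < lam" using c B0 by (simp add: lam_def)
  have "lam * w p \<le> map_laplacian A g \<phi> w p" for p
  proof (cases "dist (\<phi> p) q < R")
    case True
    define u where "u p = barrier k c q v (\<phi> p)" for p
    let ?N = "\<phi> -` {x. dist x q < R}"
    let ?t = "tension_field A g \<phi> p" and ?e = "energy_density A g \<phi> p"
    have uC2: "C2_map A u"
      unfolding u_def by (rule C2_map_compose[OF \<phi> subset_UNIV Ck_on_barrier[OF open_UNIV]])
    have "laplace_beltrami A g w p = laplace_beltrami A g (\<lambda>p. max 0 (u p) ^ 3) p"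
      by (rule laplace_beltrami_cong[of ?N])
         (use True open_vimage[OF oB \<phi>_cont] in \<open>auto simp: w_def H_def u_def Q_def\<close>)
    then have lap: "3 * (max 0 (u p))\<^sup>2 * (c * ?e + (c *\<^sub>R (\<phi> p - q) - v) \<bullet> ?t) \<le> laplace_beltrami A g w p"
      using laplace_beltrami_pos_cube[OF uC2, of p] laplace_beltrami_barrier[OF \<phi>, of k c q v p]
      by (simp add: u_def[abs_def])
    let ?r = "norm (\<phi> p - q)"
    have "(norm (c *\<^sub>R (\<phi> p - q) - v))\<^sup>2 = c\<^sup>2 * ?r\<^sup>2 - 2 * c * ((\<phi> p - q) \<bullet> v) + 1"
      using norm_scaleR_diff_square[of c "\<phi> p - q" v] v by simp
    also have "\<dots> \<le> c\<^sup>2 * ?r\<^sup>2 - 2 * c * (b * ?r) + 1"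
      using cone[of p] c0 by simp
    \<comment> \<open>The product is nonpositive because \<open>c * ?r\<close> is at most
      \<open>c * R = b\<close>.\<close>
    also have "\<dots> = c * ?r * (c * ?r - 2 * b) + 1"
      by (simp add: power2_eq_square algebra_simps)
    also have "\<dots> \<le> 1\<^sup>2"
    proof -
      have "c * ?r \<le> c * R" using True c0 by (intro mult_left_mono) (auto simp: dist_norm)
      then have "c * ?r - 2 * b \<le> 0" using R b by simp
      then have "c * ?r * (c * ?r - 2 * b) \<le> 0" using c0 by (intro mult_nonneg_nonpos) auto
      then show ?thesis by simp
    qed
    finally have n1: "norm (c *\<^sub>R (\<phi> p - q) - v) \<le> 1" by (rule power2_le_imp_le) simp
    have "\<bar>(c *\<^sub>R (\<phi> p - q) - v) \<bullet> ?t\<bar> \<le> norm (c *\<^sub>R (\<phi> p - q) - v) * norm ?t"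
      by (rule Cauchy_Schwarz_ineq2)
    also have "\<dots> \<le> 1 * norm ?t" by (rule mult_right_mono[OF n1 norm_ge_zero])
    also have "\<dots> \<le> T * ?e" using T[of p] by simp
    finally have "(c - T) * ?e \<le> c * ?e + (c *\<^sub>R (\<phi> p - q) - v) \<bullet> ?t"
      by (simp add: algebra_simps)
    then have "3 * (max 0 (u p))\<^sup>2 * ((c - T) * ?e) \<le> laplace_beltrami A g w p"
      using lap by (meson mult_left_mono order_trans zero_le_power2 zero_le_mult_iff zero_le_numeral)
    then have L: "3 * (max 0 (u p))\<^sup>2 * (c - T) \<le> map_laplacian A g \<phi> w p"
      using pos[of p] by (simp add: map_laplacian_def pos_le_divide_eq mult.assoc)
    have "w p = max 0 (u p) * (max 0 (u p))\<^sup>2"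
      using True by (simp add: w_def H_def u_def Q_def power3_eq_cube power2_eq_square)
    also have "\<dots> \<le> B * (max 0 (u p))\<^sup>2"
      using QB[OF True] by (intro mult_right_mono) (auto simp: u_def Q_def)
    finally have "lam * w p \<le> lam * (B * (max 0 (u p))\<^sup>2)"
      using lam0 by (intro mult_left_mono) auto
    also have "\<dots> = 3 * (max 0 (u p))\<^sup>2 * (c - T)" using B0 by (simp add: lam_def)
    finally show ?thesis using L by linarith
  next
    case False
    \<comment> \<open>Such a point has a neighbourhood mapped into \<open>W\<close>, where
      \<open>w\<close> vanishes identically.\<close>
    have "laplace_beltrami A g w p = laplace_beltrami A g (\<lambda>_. 0) p"
      by (rule laplace_beltrami_cong[of "\<phi> -` W"])
         (use far[OF False] W0 open_vimage[OF oW \<phi>_cont] in \<open>auto simp: w_def\<close>)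
    then show ?thesis
      using W0[OF far[OF False]] by (simp add: map_laplacian_def laplace_beltrami_zero w_def)
  qed
  note sub = bounded_subsolution_nonpos[OF \<phi> pos sc wC2 w0 wB lam0 this]
  \<comment> \<open>A point of height below \<open>k\<close>: the cone condition and
    \<open>k < b * R / 2\<close> place it inside the ball, and the barrier is positive
    there.\<close>
  obtain p where p: "(\<phi> p - q) \<bullet> v < k" using d[of "k - d"] k by auto
  have "b * norm (\<phi> p - q) < b * R" using cone[of p] p kR b R by (smt (verit) mult_pos_pos field_sum_of_halves)
  then have "dist (\<phi> p) q < R" using b by (simp add: dist_norm)
  moreover have "0 < Q (\<phi> p)"
  proof -
    have "0 \<le> c / 2 * ((\<phi> p - q) \<bullet> (\<phi> p - q))" using c0 by simp
    then show ?thesis using p by (simp add: Q_def barrier_def)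
  qed
  ultimately have "0 < w p" by (simp add: w_def H_def)
  then show False using sub[of p] by linarith
qed

end

theorem theorem1p4:
  fixes A :: "('a::{t2_space,second_countable_topology}, 'm::finite) chart set"
    and g :: "('a, 'm) metric_field"
    and \<phi> :: "'a \<Rightarrow> real^'n"
    and q v :: "real^'n"
    and \<theta> :: real
  assumes "riemannian_manifold A g"
    and "connected (UNIV :: 'a set)"
    and "\<not> compact (UNIV :: 'a set)"
    and "CARD('m) \<ge> 2"
    and "CARD('n) \<ge> 2"
    and "C2_map A \<phi>"
    and "\<And>x. energy_density A g \<phi> x > 0"
    and "stochastically_complete A (map_laplacian A g \<phi>)"
    and "q \<notin> range \<phi>"
    and "norm v = 1"
    and "0 < \<theta>" and "\<theta> < pi / 2"
    and "range \<phi> \<subseteq> cone_at q v \<theta>"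
  shows "ereal (cos \<theta>) \<le>
           cone_bound (A_const 1) (setdist (hyperplane_at q v) (range \<phi>))
             (SUP x. ereal (norm (tension_field A g \<phi> x) / energy_density A g \<phi> x)) \<and>
         (isometric_immersion A g \<phi> \<longrightarrow>
           ereal (cos \<theta>) \<le>
             cone_bound (A_const (real CARD('m))) (setdist (hyperplane_at q v) (range \<phi>))
               (SUP x. ereal (norm (tension_field A g \<phi> x) / energy_density A g \<phi> x)))"
proof -
  interpret riemannian A g by unfold_locales fact
  define S where "S = (SUP x. ereal (norm (tension_field A g \<phi> x) / energy_density A g \<phi> x))"
  define d where "d = setdist (hyperplane_at q v) (range \<phi>)"
  define T where "T = real_of_ereal S"
  have cos0: "0 < cos \<theta>" using assms(11,12) by (intro cos_gt_zero) auto
  have d0: "0 \<le> d" by (simp add: d_def setdist_pos_le)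
  have bound: "(cos \<theta>)\<^sup>2 \<le> 2 * d * T" and T0: "0 \<le> T" if "S \<noteq> \<infinity>"
  proof -
    have up: "ereal (norm (tension_field A g \<phi> p) / energy_density A g \<phi> p) \<le> S" for p
      unfolding S_def by (rule SUP_upper) simp
    have nn: "0 \<le> norm (tension_field A g \<phi> p) / energy_density A g \<phi> p" for p
      using assms(7)[of p] by simp
    \<comment> \<open>\<open>undefined\<close> stands for some point of the manifold; its
      nonnegative quotient excludes a supremum of minus infinity.\<close>
    have "0 \<le> S" using up[of undefined] nn[of undefined] by (meson ereal_less_eq(5) order_trans)
    then have ST: "S = ereal T" using that unfolding T_def by (cases S) auto
    show T0: "0 \<le> T" using \<open>0 \<le> S\<close> ST by simp
    show "(cos \<theta>)\<^sup>2 \<le> 2 * d * T"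
    proof (rule cone_width_bound[OF assms(6-8,10) cos0 _ _ _ d0])
      fix p
      have "\<phi> p \<in> cone_at q v \<theta>" using assms(13) by blast
      then have "\<phi> p \<noteq> q" "cos \<theta> \<le> ((\<phi> p - q) \<bullet> v) / norm (\<phi> p - q)"
        by (auto simp: cone_at_def divide_inverse mult.commute)
      then show "cos \<theta> * norm (\<phi> p - q) \<le> (\<phi> p - q) \<bullet> v" by (simp add: pos_le_divide_eq)
      show "norm (tension_field A g \<phi> p) \<le> T * energy_density A g \<phi> p"
        using up[of p] assms(7)[of p] unfolding ST by (simp add: pos_divide_le_eq)
    next
      fix \<epsilon> :: real assume "0 < \<epsilon>"
      then have "setdist (hyperplane_at q v) (range \<phi>) < d + \<epsilon>" by (simp add: d_def)
      moreover have "q \<in> hyperplane_at q v" by (simp add: hyperplane_at_def)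
      ultimately obtain h x where hx: "h \<in> hyperplane_at q v" "x \<in> range \<phi>" "dist h x < d + \<epsilon>"
        using setdist_ltE by blast
      then obtain p where p: "x = \<phi> p" by blast
      \<comment> \<open>The height over the hyperplane is the same from any of its points, hence at
        most the distance to the nearly closest one.\<close>
      have "(\<phi> p - q) \<bullet> v = (\<phi> p - h) \<bullet> v"
        using hx(1) by (simp add: hyperplane_at_def inner_diff_left)
      also have "\<dots> \<le> norm (\<phi> p - h) * norm v" by (rule norm_cauchy_schwarz)
      also have "\<dots> < d + \<epsilon>" using hx(3) assms(10) p by (simp add: dist_norm norm_minus_commute)
      finally show "\<exists>p. (\<phi> p - q) \<bullet> v < d + \<epsilon>" by blast
    qed
  qed
  \<comment> \<open>One argument for all positive \<eta>; the theorem takes \<eta> = 1 and \<eta>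
    equal to the dimension.\<close>
  have "ereal (cos \<theta>) \<le> cone_bound (A_const \<eta>) d S" if "0 < \<eta>" for \<eta>
  proof (cases "S = \<infinity>")
    case False
    have "2 \<le> 1 / A_const \<eta>" using A_const_bounds[OF that] by (simp add: field_simps)
    then have "2 * (d * T) \<le> 1 / A_const \<eta> * (d * T)"
      using d0 T0[OF False] by (intro mult_right_mono) auto
    then have "(cos \<theta>)\<^sup>2 \<le> 1 / A_const \<eta> * d * T" using bound[OF False] by (simp add: mult.assoc)
    then have "cos \<theta> \<le> sqrt (1 / A_const \<eta> * d * T)" by (rule real_le_rsqrt)
    then show ?thesis using False by (simp add: cone_bound_def T_def)
  qed (simp add: cone_bound_def)
  then show ?thesis unfolding S_def d_def by simp
qed

end
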